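(* Let $R$ be a ring and let $\kappa$ be an infinite cardinal. If $R$ is left $(<\aleph_{\kappa+1})$-noetherian but not left $(<\aleph_{\kappa})$-noetherian (where $\kappa+1$ denotes the ordinal successor of $\kappa$), then for every cardinal $\lambda \geq (\operatorname{card}(R)+\aleph_0)^+$ such that $(R\text{-Mod}, \subseteq_R)$ is stable in $\lambda$, $(R\text{-Mod}, \subseteq_R)$ has exactly $\kappa$ non-isomorphic $\lambda$-limit models.
   Context: Rings are associative with unity, modules are left $R$-modules, ideals are left ideals; $\operatorname{card}(R)$ is the cardinality of $R$, $\|M\|$ the cardinality of a module $M$, and $N \subseteq_R M$ means $N$ is a submodule of $M$. $\mu^+$ is the least cardinal greater than $\mu$. For an infinite cardinal $\mu$, an ideal is $(<\mu)$-generated if it is generated by a set of fewer than $\mu$ elements; $R$ is left $(<\mu)$-noetherian if every left ideal of $R$ is $(<\mu)$-generated. Limit models (in the class of all left $R$-modules with embeddings, denoted $(R\text{-Mod}, \subseteq_R)$): $M$ is universal over $N$ if $\|M\|=\|N\|$, $N \subseteq_R M$, and for every module $N^*$ with $\|N^*\|=\|M\|$ and $N\subseteq_R N^*$ there is an embedding $f: N^* \to M$ with $f\restriction N=\mathrm{id}_N$. For an infinite cardinal $\lambda$ and a limit ordinal $\alpha<\lambda^+$, $M$ is a $(\lambda,\alpha)$-limit model if there is an increasing continuous chain $\{M_i : i<\alpha\}$ of modules of cardinality $\lambda$ (continuous: $M_i=\bigcup_{j<i}M_j$ for limit $i<\alpha$) such that $M_{i+1}$ is universal over $M_i$ for each $i<\alpha$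 and $M=\bigcup_{i<\alpha}M_i$. $M$ is a $\lambda$-limit model if it is a $(\lambda,\alpha)$-limit model for some limit ordinal $\alpha<\lambda^+$. $(R\text{-Mod}, \subseteq_R)$ is stable in $\lambda$ if there exists a $\lambda$-limit model. "Exactly $\kappa$ non-isomorphic $\lambda$-limit models" means that the set of isomorphism classes of $\lambda$-limit models has cardinality $\kappa$. *)

theory Defs
  imports "HOL-Algebra.Module" "HOL-Algebra.Ideal"
begin

unbundle cardinal_syntax

section \<open>Ordinals and alephs\<close>

text \<open>
  As in the library, ordinals are well-orders and cardinals are cardinal orders
  (\<^const>\<open>card_order_on\<close>), both up to order isomorphism. In particular a cardinal is
  also an ordinal, namely an initial one.
\<close>

text \<open>The order type of \<open>r\<close> plus one: a new top element \<^const>\<open>None\<close> is added.\<close>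

definition ord_succ :: "'k rel \<Rightarrow> 'k option rel" where
  "ord_succ r = {(Some x, Some y) |x y. (x, y) \<in> r} \<union> {(a, None) |a. a \<in> Some ` Field r \<union> {None}}"

definition limit_order :: "'o rel \<Rightarrow> bool" where
  "limit_order r \<longleftrightarrow> Well_order r \<and> Field r \<noteq> {} \<and> (\<forall>i\<in>Field r. aboveS r i \<noteq> {})"

text \<open>
  \<open>is_aleph r c\<close>: the cardinal \<open>c\<close> is \<open>\<aleph>\<^sub>\<alpha>\<close>, where \<open>\<alpha>\<close> is the order type of \<open>r\<close>. The function
  \<open>\<alpha> \<mapsto> \<aleph>\<^sub>\<alpha>\<close> enumerates the infinite cardinals in increasing order, so \<open>\<aleph>\<^sub>\<alpha>\<close> is the infinite
  cardinal below which the infinite cardinals have order type \<open>\<alpha>\<close>. The ordinals below \<open>c\<close> are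
  given by the elements \<open>a\<close> of its field, through the initial segments \<open>Restr c (underS c a)\<close>,
  and this segment is an infinite initial ordinal iff it is \<open>Cinfinite\<close>. (A relation and not a
  function because \<open>\<aleph>\<^sub>\<alpha>\<close> need not fit into any type fixed in advance.)
\<close>

definition is_aleph :: "'k rel \<Rightarrow> 'c rel \<Rightarrow> bool" where
  "is_aleph r c \<longleftrightarrow> Cinfinite c \<and>
     r =o Restr c {a \<in> Field c. Cinfinite (Restr c (underS c a))}"

section \<open>Left ideals\<close>

text \<open>\<^const>\<open>ideal\<close> of the library means two-sided ideal.\<close>

definition left_ideal :: "'r set \<Rightarrow> ('r, 'x) ring_scheme \<Rightarrow> bool" where
  "left_ideal I R \<longleftrightarrow> additive_subgroup I R \<and> (\<forall>r\<in>carrier R. \<forall>a\<in>I. r \<otimes>\<^bsub>R\<^esub> a \<in> I)"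

definition gen_left_ideal :: "('r, 'x) ring_scheme \<Rightarrow> 'r set \<Rightarrow> 'r set" where
  "gen_left_ideal R S = \<Inter>{I. left_ideal I R \<and> S \<subseteq> I}"

definition lt_generated :: "'c rel \<Rightarrow> ('r, 'x) ring_scheme \<Rightarrow> 'r set \<Rightarrow> bool" where
  "lt_generated \<mu> R I \<longleftrightarrow> (\<exists>S \<subseteq> carrier R. |S| <o \<mu> \<and> I = gen_left_ideal R S)"

definition left_lt_noetherian :: "'c rel \<Rightarrow> ('r, 'x) ring_scheme \<Rightarrow> bool" where
  "left_lt_noetherian \<mu> R \<longleftrightarrow> (\<forall>I. left_ideal I R \<longrightarrow> lt_generated \<mu> R I)"

section \<open>Left modules\<close>

text \<open>
  The axioms of the library locale \<^locale>\<open>module\<close>, whose scalar rings are commutative, over an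
  arbitrary ring. The ring multiplication and unit fields of the record \<open>M\<close> are irrelevant.
\<close>

locale left_module = R?: ring R + M?: abelian_group M
  for R :: "('r, 'x) ring_scheme" (structure) and M :: "('r, 'm, 'y) module_scheme" (structure) +
  assumes smult_closed:
      "\<lbrakk>a \<in> carrier R; x \<in> carrier M\<rbrakk> \<Longrightarrow> a \<odot>\<^bsub>M\<^esub> x \<in> carrier M"
    and smult_l_distr:
      "\<lbrakk>a \<in> carrier R; b \<in> carrier R; x \<in> carrier M\<rbrakk> \<Longrightarrow>
        (a \<oplus> b) \<odot>\<^bsub>M\<^esub> x = a \<odot>\<^bsub>M\<^esub> x \<oplus>\<^bsub>M\<^esub> b \<odot>\<^bsub>M\<^esub> x"
    and smult_r_distr:
      "\<lbrakk>a \<in> carrier R; x \<in> carrier M; y \<in> carrier M\<rbrakk> \<Longrightarrow>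
        a \<odot>\<^bsub>M\<^esub> (x \<oplus>\<^bsub>M\<^esub> y) = a \<odot>\<^bsub>M\<^esub> x \<oplus>\<^bsub>M\<^esub> a \<odot>\<^bsub>M\<^esub> y"
    and smult_assoc1:
      "\<lbrakk>a \<in> carrier R; b \<in> carrier R; x \<in> carrier M\<rbrakk> \<Longrightarrow>
        (a \<otimes> b) \<odot>\<^bsub>M\<^esub> x = a \<odot>\<^bsub>M\<^esub> (b \<odot>\<^bsub>M\<^esub> x)"
    and smult_one:
      "x \<in> carrier M \<Longrightarrow> \<one> \<odot>\<^bsub>M\<^esub> x = x"

text \<open>\<open>N \<subseteq>\<^sub>R M\<close>, for modules with their own structure.\<close>

definition submod_of ::
  "('r, 'x) ring_scheme \<Rightarrow> ('r, 'm) module \<Rightarrow> ('r, 'm) module \<Rightarrow> bool" where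
  "submod_of R N M \<longleftrightarrow> left_module R N \<and> left_module R M \<and> carrier N \<subseteq> carrier M \<and>
     (\<forall>x\<in>carrier N. \<forall>y\<in>carrier N. x \<oplus>\<^bsub>N\<^esub> y = x \<oplus>\<^bsub>M\<^esub> y) \<and>
     (\<forall>r\<in>carrier R. \<forall>x\<in>carrier N. r \<odot>\<^bsub>N\<^esub> x = r \<odot>\<^bsub>M\<^esub> x)"

definition mod_hom ::
  "('r, 'x) ring_scheme \<Rightarrow> ('r, 'm) module \<Rightarrow> ('r, 'm) module \<Rightarrow> ('m \<Rightarrow> 'm) set" where
  "mod_hom R M N = {h. h \<in> carrier M \<rightarrow> carrier N \<and>
     (\<forall>x\<in>carrier M. \<forall>y\<in>carrier M. h (x \<oplus>\<^bsub>M\<^esub> y) = h x \<oplus>\<^bsub>N\<^esub> h y) \<and>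
     (\<forall>r\<in>carrier R. \<forall>x\<in>carrier M. h (r \<odot>\<^bsub>M\<^esub> x) = r \<odot>\<^bsub>N\<^esub> h x)}"

definition mod_embeddings ::
  "('r, 'x) ring_scheme \<Rightarrow> ('r, 'm) module \<Rightarrow> ('r, 'm) module \<Rightarrow> ('m \<Rightarrow> 'm) set" where
  "mod_embeddings R M N = {h \<in> mod_hom R M N. inj_on h (carrier M)}"

definition mod_isomorphic ::
  "('r, 'x) ring_scheme \<Rightarrow> ('r, 'm) module \<Rightarrow> ('r, 'm) module \<Rightarrow> bool" where
  "mod_isomorphic R M N \<longleftrightarrow> (\<exists>h \<in> mod_hom R M N. bij_betw h (carrier M) (carrier N))"

section \<open>Limit models\<close>

text \<open>
  All modules below have their carrier inside one type \<open>'m\<close>, which plays the role of the universe.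
  This agrees with the usual notions for modules of cardinality \<open>lam\<close> as soon as
  \<open>lam < |UNIV :: 'm set|\<close>: then every module of cardinality \<open>lam\<close> has a copy in \<open>'m\<close>, and, because
  the complement of such a module is larger than \<open>lam\<close>, every extension of cardinality \<open>lam\<close> of a
  module in \<open>'m\<close> has a copy in \<open>'m\<close> over that module.
\<close>

definition universal_over ::
  "('r, 'x) ring_scheme \<Rightarrow> ('r, 'm) module \<Rightarrow> ('r, 'm) module \<Rightarrow> bool" where
  "universal_over R M N \<longleftrightarrow> |carrier M| =o |carrier N| \<and> submod_of R N M \<and>
     (\<forall>N' :: ('r, 'm) module. |carrier N'| =o |carrier M| \<and> submod_of R N N' \<longrightarrow>
        (\<exists>f \<in> mod_embeddings R N' M. \<forall>x\<in>carrier N. f x = x))"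

text \<open>
  The chain is indexed by the field of the well-order \<open>\<alpha>\<close>; \<open>wo_rel.suc \<alpha> {i}\<close> is the index \<open>i + 1\<close>,
  and an index \<open>i\<close> is a limit iff its initial segment has limit order type.
\<close>

definition is_ord_limit_model ::
  "('r, 'x) ring_scheme \<Rightarrow> 'l rel \<Rightarrow> 'o rel \<Rightarrow> ('r, 'm) module \<Rightarrow> bool" where
  "is_ord_limit_model R lam \<alpha> M \<longleftrightarrow> limit_order \<alpha> \<and> \<alpha> <o cardSuc lam \<and>
     (\<exists>C :: 'o \<Rightarrow> ('r, 'm) module.
        (\<forall>i\<in>Field \<alpha>. left_module R (C i) \<and> |carrier (C i)| =o lam) \<and>
        (\<forall>(i, j)\<in>\<alpha>. submod_of R (C i) (C j)) \<and>
        (\<forall>i\<in>Field \<alpha>. limit_order (Restr \<alpha> (underS \<alpha> i)) \<longrightarrow>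
           carrier (C i) = (\<Union>j\<in>underS \<alpha> i. carrier (C j))) \<and>
        (\<forall>i\<in>Field \<alpha>. universal_over R (C (wo_rel.suc \<alpha> {i})) (C i)) \<and>
        (\<forall>i\<in>Field \<alpha>. submod_of R (C i) M) \<and>
        carrier M = (\<Union>i\<in>Field \<alpha>. carrier (C i)))"

text \<open>
  Every ordinal below \<open>lam\<^sup>+\<close> is the order type of a well-order on a subset of the field of \<open>lam\<close>, so it is
  enough that \<open>\<alpha>\<close> ranges over well-orders in the type of \<open>lam\<close>.
\<close>

definition is_limit_model ::
  "('r, 'x) ring_scheme \<Rightarrow> 'l rel \<Rightarrow> ('r, 'm) module \<Rightarrow> bool" where
  "is_limit_model R lam M \<longleftrightarrow> (\<exists>\<alpha> :: 'l rel. is_ord_limit_model R lam \<alpha> M)"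

definition stable_in :: "'m itself \<Rightarrow> ('r, 'x) ring_scheme \<Rightarrow> 'l rel \<Rightarrow> bool" where
  "stable_in _ R lam \<longleftrightarrow> (\<exists>M :: ('r, 'm) module. is_limit_model R lam M)"

definition limit_model_classes ::
  "('r, 'x) ring_scheme \<Rightarrow> 'l rel \<Rightarrow> ('r, 'm) module set set" where
  "limit_model_classes R lam = {M. is_limit_model R lam M} //
     {(M, N). is_limit_model R lam M \<and> is_limit_model R lam N \<and> mod_isomorphic R M N}"

end

theory Submission
  imports Defs
begin

text \<open>
  A limit model is the union of a directed family of submodules (a tower) in which every member has a
  universal extension; only the cofinality \<open>\<mu>\<close> of the chain matters, and a back-and-forth argument
  shows that two towers with the same \<open>\<mu>\<close> have isomorphic unions. Homomorphisms out of a left ideal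
  generated by fewer than \<open>\<mu>\<close> elements land in a member of the tower, hence extend to \<open>R\<close>, by the
  universal extension of that member and a pushout. Conversely, if some left ideal is not
  \<open>(<\<mu>)\<close>-generated, then a left ideal generated by \<open>\<mu>\<close> elements carries a homomorphism that does not
  extend to \<open>R\<close>. So different regular cofinalities up to \<open>\<aleph>\<^sub>\<kappa>\<close> give non-isomorphic limit models, and there
  are \<open>\<kappa>\<close> successor cardinals among them.

  From cofinality \<open>\<aleph>\<^sub>\<kappa>\<^sub>+\<^sub>1\<close> on, the limit models are injective by Baer's criterion. If \<open>B\<close> is injective,
  every extension of \<open>N \<oplus> B\<close> splits off \<open>B\<close>, so adding \<open>B\<close> to every member of a tower gives a tower with
  the same \<open>\<mu>\<close>. Hence \<open>A \<cong> A \<oplus> B \<cong> B\<close> for any two injective limit models, and they form a single class.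
\<close>

subsection \<open>Well-orders\<close>

text \<open>The recurring construction is a pushout, and what matters is that it creates no
  accidental coincidences: when a partial homomorphism \<open>H\<close> into \<open>Y\<close> is
  extended into a universal extension of \<open>Y\<close>, values in \<open>Y\<close> occur only at
  the pairs of \<open>H\<close>. In the back-and-forth this keeps the extended map injective; in the
  non-extension argument it lets a new element avoid a whole member of the tower. Partial
  homomorphisms are submodules of products, so that unions of chains and inverses are immediate.

  A tower keeps neither an index order nor continuity, because families such as
  \<open>N \<oplus> B\<close> should inherit the definition at once.

  The infinite cardinals below \<open>\<aleph>\<^sub>\<kappa>\<^sub>+\<^sub>1\<close> have order
  type \<kappa> + 1, and the infinite cardinal \<kappa> absorbs both the extra point and the class
  of the injective limit models. For the lower bound, \<open>\<aleph>\<^sub>\<beta>\<close> with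
  \<beta> < \<kappa> may be singular and then is no cofinality, so it is replaced by its successor,
  which is regular and still at most \<open>\<aleph>\<^sub>\<kappa>\<close>.\<close>

lemma Well_orderD:
  assumes "Well_order r"
  shows "\<And>i. i \<in> Field r \<Longrightarrow> (i, i) \<in> r"
    and "\<And>i j k. (i, j) \<in> r \<Longrightarrow> (j, k) \<in> r \<Longrightarrow> (i, k) \<in> r"
    and "\<And>i j. (i, j) \<in> r \<Longrightarrow> (j, i) \<in> r \<Longrightarrow> i = j"
    and "\<And>i j. i \<in> Field r \<Longrightarrow> j \<in> Field r \<Longrightarrow> (i, j) \<in> r \<or> (j, i) \<in> r"
proof -
  have r: "Refl r" "trans r" "antisym r" "Total r"
    using assms by (auto simp: well_order_on_def linear_order_on_def partial_order_on_def preorder_on_def)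
  show 1: "(i, i) \<in> r" if "i \<in> Field r" for i using r(1) that by (auto simp: refl_on_def)
  show "(i, k) \<in> r" if "(i, j) \<in> r" "(j, k) \<in> r" for i j k using transD[OF r(2) that] .
  show "i = j" if "(i, j) \<in> r" "(j, i) \<in> r" for i j using antisymD[OF r(3) that] .
  show "(i, j) \<in> r \<or> (j, i) \<in> r" if "i \<in> Field r" "j \<in> Field r" for i j
    using r(4) 1 that by (cases "i = j") (auto simp: total_on_def)
qed

text \<open>Transfinite recursion in which each step only asserts existence: \<open>adm\<close> says
  that \<open>Q f i\<close> depends on \<open>f\<close> only below \<open>i\<close>, and the step
  may assume \<open>Q\<close> at all earlier indices. The back-and-forth, the increasing left
  ideals, the compatible ring actions and the continuous chains are all built this way.\<close>

lemma well_order_choice: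
  assumes r: "Well_order r"
    and adm: "\<And>i f g x. i \<in> Field r \<Longrightarrow> (\<And>j. j \<in> underS r i \<Longrightarrow> f j = g j) \<Longrightarrow> Q f i x \<Longrightarrow> Q g i x"
    and ex: "\<And>i f. i \<in> Field r \<Longrightarrow> (\<And>j. j \<in> underS r i \<Longrightarrow> Q f j (f j)) \<Longrightarrow> \<exists>x. Q f i x"
  obtains f where "\<And>i. i \<in> Field r \<Longrightarrow> Q f i (f i)"
proof -
  have wf: "wf (r - Id)" using r by (simp add: well_order_on_def)
  have us: "(j, i) \<in> r - Id \<longleftrightarrow> j \<in> underS r i" for i j by (auto simp: underS_def)
  have uF: "j \<in> Field r" if "j \<in> underS r i" for i j using that by (auto simp: underS_def Field_def)
  have "\<exists>f. \<forall>i. i \<in> Field r \<longrightarrow> Q f i (f i)"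
  proof (rule dependent_wf_choice[OF wf, where P = "\<lambda>f i x. i \<in> Field r \<longrightarrow> Q f i x"])
    fix f g :: "'a \<Rightarrow> 'b" and i x
    assume eq: "\<And>j. (j, i) \<in> r - Id \<Longrightarrow> f j = g j"
    then have "f j = g j" if "j \<in> underS r i" for j using us that by blast
    then show "(i \<in> Field r \<longrightarrow> Q f i x) = (i \<in> Field r \<longrightarrow> Q g i x)"
      using adm[of i f g x] adm[of i g f x] by metis
  next
    fix i and f :: "'a \<Rightarrow> 'b"
    assume "\<And>j. (j, i) \<in> r - Id \<Longrightarrow> j \<in> Field r \<longrightarrow> Q f j (f j)"
    then have "Q f j (f j)" if "j \<in> underS r i" for j using us uF that by blast
    then show "\<exists>x. i \<in> Field r \<longrightarrow> Q f i x" using ex[of i f] by blast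
  qed
  then show thesis using that by blast
qed

lemma finite_ordLess_Cinfinite: "finite A \<Longrightarrow> Cinfinite r \<Longrightarrow> |A| <o r"
  by (rule Cfinite_ordLess_Cinfinite) (simp_all add: cfinite_def card_of_Card_order Field_card_of card_of_card_order_on)

subsection \<open>Left modules\<close>

lemma left_moduleI:
  fixes R (structure) and M (structure)
  assumes "ring R" "\<zero>\<^bsub>M\<^esub> \<in> carrier M"
    and "\<And>x y. \<lbrakk>x \<in> carrier M; y \<in> carrier M\<rbrakk> \<Longrightarrow> x \<oplus>\<^bsub>M\<^esub> y \<in> carrier M"
    and "\<And>x y z. \<lbrakk>x \<in> carrier M; y \<in> carrier M; z \<in> carrier M\<rbrakk> \<Longrightarrow>
      (x \<oplus>\<^bsub>M\<^esub> y) \<oplus>\<^bsub>M\<^esub> z = x \<oplus>\<^bsub>M\<^esub> (y \<oplus>\<^bsub>M\<^esub> z)"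
    and "\<And>x y. \<lbrakk>x \<in> carrier M; y \<in> carrier M\<rbrakk> \<Longrightarrow> x \<oplus>\<^bsub>M\<^esub> y = y \<oplus>\<^bsub>M\<^esub> x"
    and "\<And>x. x \<in> carrier M \<Longrightarrow> \<zero>\<^bsub>M\<^esub> \<oplus>\<^bsub>M\<^esub> x = x"
    and "\<And>x. x \<in> carrier M \<Longrightarrow> \<exists>y\<in>carrier M. y \<oplus>\<^bsub>M\<^esub> x = \<zero>\<^bsub>M\<^esub>"
    and "\<And>a x. \<lbrakk>a \<in> carrier R; x \<in> carrier M\<rbrakk> \<Longrightarrow> a \<odot>\<^bsub>M\<^esub> x \<in> carrier M"
    and "\<And>a b x. \<lbrakk>a \<in> carrier R; b \<in> carrier R; x \<in> carrier M\<rbrakk> \<Longrightarrow>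
        (a \<oplus> b) \<odot>\<^bsub>M\<^esub> x = a \<odot>\<^bsub>M\<^esub> x \<oplus>\<^bsub>M\<^esub> b \<odot>\<^bsub>M\<^esub> x"
    and "\<And>a x y. \<lbrakk>a \<in> carrier R; x \<in> carrier M; y \<in> carrier M\<rbrakk> \<Longrightarrow>
        a \<odot>\<^bsub>M\<^esub> (x \<oplus>\<^bsub>M\<^esub> y) = a \<odot>\<^bsub>M\<^esub> x \<oplus>\<^bsub>M\<^esub> a \<odot>\<^bsub>M\<^esub> y"
    and "\<And>a b x. \<lbrakk>a \<in> carrier R; b \<in> carrier R; x \<in> carrier M\<rbrakk> \<Longrightarrow>
        (a \<otimes> b) \<odot>\<^bsub>M\<^esub> x = a \<odot>\<^bsub>M\<^esub> (b \<odot>\<^bsub>M\<^esub> x)"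
    and "\<And>x. x \<in> carrier M \<Longrightarrow> \<one> \<odot>\<^bsub>M\<^esub> x = x"
  shows "left_module R M"
  by (intro left_module.intro left_module_axioms.intro abelian_groupI assms)

context left_module
begin

lemma smult_zero_left [simp]:
  assumes "x \<in> carrier M" shows "\<zero>\<^bsub>R\<^esub> \<odot>\<^bsub>M\<^esub> x = \<zero>\<^bsub>M\<^esub>"
proof -
  have "\<zero>\<^bsub>R\<^esub> \<odot>\<^bsub>M\<^esub> x \<oplus>\<^bsub>M\<^esub> \<zero>\<^bsub>R\<^esub> \<odot>\<^bsub>M\<^esub> x = \<zero>\<^bsub>R\<^esub> \<odot>\<^bsub>M\<^esub> x"
    using smult_l_distr[of "\<zero>\<^bsub>R\<^esub>" "\<zero>\<^bsub>R\<^esub>" x] assms by simp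
  then show ?thesis
    using smult_closed[of "\<zero>\<^bsub>R\<^esub>" x] assms by (simp add: M.add.r_cancel_one')
qed

lemma smult_zero_right [simp]:
  assumes "a \<in> carrier R" shows "a \<odot>\<^bsub>M\<^esub> \<zero>\<^bsub>M\<^esub> = \<zero>\<^bsub>M\<^esub>"
proof -
  have "a \<odot>\<^bsub>M\<^esub> \<zero>\<^bsub>M\<^esub> \<oplus>\<^bsub>M\<^esub> a \<odot>\<^bsub>M\<^esub> \<zero>\<^bsub>M\<^esub> = a \<odot>\<^bsub>M\<^esub> \<zero>\<^bsub>M\<^esub>"
    using smult_r_distr[of a "\<zero>\<^bsub>M\<^esub>" "\<zero>\<^bsub>M\<^esub>"] assms by simp
  then show ?thesis
    using smult_closed[of a "\<zero>\<^bsub>M\<^esub>"] assms by (simp add: M.add.r_cancel_one')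
qed

lemma uminus_zero [simp]: "\<ominus>\<^bsub>M\<^esub> \<zero>\<^bsub>M\<^esub> = \<zero>\<^bsub>M\<^esub>"
  using M.r_neg[OF M.zero_closed] by simp

lemma smult_minus_one:
  assumes "x \<in> carrier M" shows "(\<ominus>\<^bsub>R\<^esub> \<one>\<^bsub>R\<^esub>) \<odot>\<^bsub>M\<^esub> x = \<ominus>\<^bsub>M\<^esub> x"
proof -
  have "(\<ominus>\<^bsub>R\<^esub> \<one>\<^bsub>R\<^esub>) \<odot>\<^bsub>M\<^esub> x \<oplus>\<^bsub>M\<^esub> x = \<zero>\<^bsub>M\<^esub>"
    using smult_l_distr[of "\<ominus>\<^bsub>R\<^esub> \<one>\<^bsub>R\<^esub>" "\<one>\<^bsub>R\<^esub>" x] assms by (simp add: smult_one R.l_neg)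
  then show ?thesis
    using smult_closed[of "\<ominus>\<^bsub>R\<^esub> \<one>\<^bsub>R\<^esub>" x] assms M.minus_equality by (metis R.add.inv_closed R.one_closed)
qed

lemma smult_minus_right:
  assumes "a \<in> carrier R" "x \<in> carrier M" shows "a \<odot>\<^bsub>M\<^esub> (\<ominus>\<^bsub>M\<^esub> x) = \<ominus>\<^bsub>M\<^esub> (a \<odot>\<^bsub>M\<^esub> x)"
proof -
  have "a \<odot>\<^bsub>M\<^esub> (\<ominus>\<^bsub>M\<^esub> x) \<oplus>\<^bsub>M\<^esub> a \<odot>\<^bsub>M\<^esub> x = \<zero>\<^bsub>M\<^esub>"
    using smult_r_distr[of a "\<ominus>\<^bsub>M\<^esub> x" x] assms by (simp add: M.l_neg)
  then show ?thesis
    using M.minus_equality assms smult_closed by (metis M.add.inv_closed)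
qed

end

subsection \<open>Homomorphisms and submodules\<close>

text \<open>\<open>mod_hom\<close> relates modules over a single element type. The ring as a module,
  products and quotients have other element types, so source and target need separate ones.\<close>

definition mod_lin ::
  "('r, 'x) ring_scheme \<Rightarrow> ('r, 'a) module \<Rightarrow> ('r, 'b) module \<Rightarrow> ('a \<Rightarrow> 'b) \<Rightarrow> bool" where
  "mod_lin R X Y f \<longleftrightarrow> f \<in> carrier X \<rightarrow> carrier Y \<and>
     (\<forall>x\<in>carrier X. \<forall>y\<in>carrier X. f (x \<oplus>\<^bsub>X\<^esub> y) = f x \<oplus>\<^bsub>Y\<^esub> f y) \<and>
     (\<forall>r\<in>carrier R. \<forall>x\<in>carrier X. f (r \<odot>\<^bsub>X\<^esub> x) = r \<odot>\<^bsub>Y\<^esub> f x)"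

text \<open>Closure under negation is not listed because it follows by multiplying with -1.\<close>

definition submod_on :: "('r, 'x) ring_scheme \<Rightarrow> ('r, 'a) module \<Rightarrow> 'a set \<Rightarrow> bool" where
  "submod_on R X S \<longleftrightarrow> S \<subseteq> carrier X \<and> \<zero>\<^bsub>X\<^esub> \<in> S \<and> (\<forall>x\<in>S. \<forall>y\<in>S. x \<oplus>\<^bsub>X\<^esub> y \<in> S) \<and>
     (\<forall>r\<in>carrier R. \<forall>x\<in>S. r \<odot>\<^bsub>X\<^esub> x \<in> S)"

lemma mod_lin_iff_mod_hom: "mod_lin R X Y f \<longleftrightarrow> f \<in> mod_hom R X Y"
  by (simp add: mod_lin_def mod_hom_def)

lemma mod_linI:
  assumes "\<And>x. x \<in> carrier X \<Longrightarrow> f x \<in> carrier Y"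
    and "\<And>x y. \<lbrakk>x \<in> carrier X; y \<in> carrier X\<rbrakk> \<Longrightarrow> f (x \<oplus>\<^bsub>X\<^esub> y) = f x \<oplus>\<^bsub>Y\<^esub> f y"
    and "\<And>r x. \<lbrakk>r \<in> carrier R; x \<in> carrier X\<rbrakk> \<Longrightarrow> f (r \<odot>\<^bsub>X\<^esub> x) = r \<odot>\<^bsub>Y\<^esub> f x"
  shows "mod_lin R X Y f"
  using assms by (simp add: mod_lin_def)

lemma mod_linD:
  assumes "mod_lin R X Y f"
  shows "\<And>x. x \<in> carrier X \<Longrightarrow> f x \<in> carrier Y"
    and "\<And>x y. \<lbrakk>x \<in> carrier X; y \<in> carrier X\<rbrakk> \<Longrightarrow> f (x \<oplus>\<^bsub>X\<^esub> y) = f x \<oplus>\<^bsub>Y\<^esub> f y"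
    and "\<And>r x. \<lbrakk>r \<in> carrier R; x \<in> carrier X\<rbrakk> \<Longrightarrow> f (r \<odot>\<^bsub>X\<^esub> x) = r \<odot>\<^bsub>Y\<^esub> f x"
  using assms by (auto simp: mod_lin_def)

lemma mod_lin_comp:
  assumes "mod_lin R X Y f" "mod_lin R Y Z g"
  shows "mod_lin R X Z (\<lambda>x. g (f x))"
  by (rule mod_linI) (simp_all add: mod_linD[OF assms(1)] mod_linD[OF assms(2)])

lemma mod_lin_zero:
  assumes "left_module R X" "left_module R Y" "mod_lin R X Y f"
  shows "f \<zero>\<^bsub>X\<^esub> = \<zero>\<^bsub>Y\<^esub>"
proof -
  interpret X: left_module R X by fact
  interpret Y: left_module R Y by fact
  have "f (\<zero>\<^bsub>R\<^esub> \<odot>\<^bsub>X\<^esub> \<zero>\<^bsub>X\<^esub>) = \<zero>\<^bsub>R\<^esub> \<odot>\<^bsub>Y\<^esub> f \<zero>\<^bsub>X\<^esub>"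
    using mod_linD(3)[OF assms(3)] by blast
  then show ?thesis using mod_linD(1)[OF assms(3)] by simp
qed

lemma mod_lin_uminus:
  assumes "left_module R X" "left_module R Y" "mod_lin R X Y f" "x \<in> carrier X"
  shows "f (\<ominus>\<^bsub>X\<^esub> x) = \<ominus>\<^bsub>Y\<^esub> f x"
proof -
  interpret X: left_module R X by fact
  interpret Y: left_module R Y by fact
  have "f ((\<ominus>\<^bsub>R\<^esub> \<one>\<^bsub>R\<^esub>) \<odot>\<^bsub>X\<^esub> x) = (\<ominus>\<^bsub>R\<^esub> \<one>\<^bsub>R\<^esub>) \<odot>\<^bsub>Y\<^esub> f x"
    using mod_linD(3)[OF assms(3)] assms(4) by simp
  then show ?thesis
    using mod_linD(1)[OF assms(3) assms(4)] assms(4) by (simp add: X.smult_minus_one Y.smult_minus_one)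
qed

lemma mod_lin_minus:
  assumes "left_module R X" "left_module R Y" "mod_lin R X Y f" "x \<in> carrier X" "y \<in> carrier X"
  shows "f (x \<ominus>\<^bsub>X\<^esub> y) = f x \<ominus>\<^bsub>Y\<^esub> f y"
proof -
  interpret X: left_module R X by fact
  interpret Y: left_module R Y by fact
  show ?thesis using assms(4,5)
    by (simp add: a_minus_def mod_linD(2)[OF assms(3)] mod_lin_uminus[OF assms(1-3)])
qed

lemma (in left_module) minus_eq_zero_iff:
  assumes "x \<in> carrier M" "y \<in> carrier M" shows "x \<ominus>\<^bsub>M\<^esub> y = \<zero>\<^bsub>M\<^esub> \<longleftrightarrow> x = y"
proof
  assume *: "x \<ominus>\<^bsub>M\<^esub> y = \<zero>\<^bsub>M\<^esub>"
  have "(x \<ominus>\<^bsub>M\<^esub> y) \<oplus>\<^bsub>M\<^esub> y = x" using assms by (simp add: a_minus_def M.add.m_assoc M.l_neg)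
  then show "x = y" using * assms by simp
qed (use assms in \<open>simp add: a_minus_def M.r_neg\<close>)

lemma mod_lin_inj_on:
  assumes "left_module R X" "left_module R Y" "mod_lin R X Y f"
    and ker: "\<And>x. x \<in> carrier X \<Longrightarrow> f x = \<zero>\<^bsub>Y\<^esub> \<Longrightarrow> x = \<zero>\<^bsub>X\<^esub>"
  shows "inj_on f (carrier X)"
proof (rule inj_onI)
  fix x y assume xy: "x \<in> carrier X" "y \<in> carrier X" and eq: "f x = f y"
  interpret X: left_module R X by fact
  interpret Y: left_module R Y by fact
  have "f (x \<ominus>\<^bsub>X\<^esub> y) = \<zero>\<^bsub>Y\<^esub>"
    using eq xy mod_lin_minus[OF assms(1-3)] mod_linD(1)[OF assms(3)] Y.minus_eq_zero_iff by simp
  then have "x \<ominus>\<^bsub>X\<^esub> y = \<zero>\<^bsub>X\<^esub>" using ker xy by simp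
  then show "x = y" using X.minus_eq_zero_iff xy by blast
qed

lemma mod_lin_inv_into:
  assumes X: "left_module R X" and f: "mod_lin R X Y f" and bij: "bij_betw f (carrier X) (carrier Y)"
  shows "mod_lin R Y X (inv_into (carrier X) f)"
proof -
  interpret X: left_module R X by fact
  let ?g = "inv_into (carrier X) f"
  have g: "?g y \<in> carrier X" "f (?g y) = y" if "y \<in> carrier Y" for y
    using that bij by (auto simp: bij_betw_def f_inv_into_f inv_into_into)
  have gf: "?g (f x) = x" if "x \<in> carrier X" for x
    using that bij by (simp add: bij_betw_def)
  show ?thesis
  proof (rule mod_linI)
    fix x y assume xy: "x \<in> carrier Y" "y \<in> carrier Y"
    then have "f (?g x \<oplus>\<^bsub>X\<^esub> ?g y) = x \<oplus>\<^bsub>Y\<^esub> y" using g mod_linD(2)[OF f] by simp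
    then show "?g (x \<oplus>\<^bsub>Y\<^esub> y) = ?g x \<oplus>\<^bsub>X\<^esub> ?g y"
      using gf[of "?g x \<oplus>\<^bsub>X\<^esub> ?g y"] g(1) xy by simp
  next
    fix r y assume ry: "r \<in> carrier R" "y \<in> carrier Y"
    then have "f (r \<odot>\<^bsub>X\<^esub> ?g y) = r \<odot>\<^bsub>Y\<^esub> y" using g mod_linD(3)[OF f] by simp
    then show "?g (r \<odot>\<^bsub>Y\<^esub> y) = r \<odot>\<^bsub>X\<^esub> ?g y"
      using gf[of "r \<odot>\<^bsub>X\<^esub> ?g y"] g(1) ry X.smult_closed by simp
  qed (use g in simp)
qed

lemma submod_onD:
  assumes "submod_on R X S"
  shows "S \<subseteq> carrier X" "\<And>x. x \<in> S \<Longrightarrow> x \<in> carrier X" "\<zero>\<^bsub>X\<^esub> \<in> S"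
    "\<And>x y. x \<in> S \<Longrightarrow> y \<in> S \<Longrightarrow> x \<oplus>\<^bsub>X\<^esub> y \<in> S" "\<And>r x. r \<in> carrier R \<Longrightarrow> x \<in> S \<Longrightarrow> r \<odot>\<^bsub>X\<^esub> x \<in> S"
  using assms by (auto simp: submod_on_def)

lemma submod_onI:
  assumes "\<And>x. x \<in> S \<Longrightarrow> x \<in> carrier X" "\<zero>\<^bsub>X\<^esub> \<in> S"
    "\<And>x y. x \<in> S \<Longrightarrow> y \<in> S \<Longrightarrow> x \<oplus>\<^bsub>X\<^esub> y \<in> S" "\<And>r x. r \<in> carrier R \<Longrightarrow> x \<in> S \<Longrightarrow> r \<odot>\<^bsub>X\<^esub> x \<in> S"
  shows "submod_on R X S"
  using assms by (auto simp: submod_on_def)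

lemma submod_on_uminus:
  assumes "left_module R X" "submod_on R X S" "x \<in> S"
  shows "\<ominus>\<^bsub>X\<^esub> x \<in> S"
proof -
  interpret X: left_module R X by fact
  have "(\<ominus>\<^bsub>R\<^esub> \<one>\<^bsub>R\<^esub>) \<odot>\<^bsub>X\<^esub> x \<in> S" using submod_onD(5)[OF assms(2) _ assms(3)] by simp
  then show ?thesis using X.smult_minus_one submod_onD(2)[OF assms(2,3)] by simp
qed

lemma submod_on_minus:
  assumes "left_module R X" "submod_on R X S" "x \<in> S" "y \<in> S"
  shows "x \<ominus>\<^bsub>X\<^esub> y \<in> S"
  unfolding a_minus_def using submod_onD(4)[OF assms(2,3)] submod_on_uminus[OF assms(1,2,4)] by blast

lemma submod_on_add_iff:
  assumes X: "left_module R X" and S: "submod_on R X S" and "x \<in> carrier X" "y \<in> S"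
  shows "x \<oplus>\<^bsub>X\<^esub> y \<in> S \<longleftrightarrow> x \<in> S"
proof -
  interpret X: left_module R X by fact
  have y: "y \<in> carrier X" using assms submod_onD(2) by metis
  have 1: "(x \<oplus>\<^bsub>X\<^esub> y) \<ominus>\<^bsub>X\<^esub> y = x"
    using assms y by (simp add: a_minus_def X.M.add.m_assoc X.M.r_neg)
  show "x \<oplus>\<^bsub>X\<^esub> y \<in> S \<longleftrightarrow> x \<in> S"
    using submod_onD(4)[OF S _ assms(4)] submod_on_minus[OF X S _ assms(4)] 1 by metis
qed

lemma left_module_submod_on:
  assumes "left_module R X" "submod_on R X S"
  shows "left_module R (X\<lparr>carrier := S\<rparr>)"
proof -
  interpret X: left_module R X by fact
  note S = submod_onD[OF assms(2)]
  have ex: "\<exists>y\<in>S. x \<oplus>\<^bsub>X\<^esub> y = \<zero>\<^bsub>X\<^esub>" if "x \<in> S" for x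
    using submod_on_uminus[OF assms that] X.M.r_neg S(2)[OF that] by blast
  show ?thesis
    by (intro left_moduleI)
      (simp_all add: S ex X.R.ring_axioms X.M.add.m_ac X.smult_l_distr X.smult_r_distr
        X.smult_assoc1 X.smult_one)
qed

lemma submod_of_submod_on:
  assumes "left_module R X" "submod_on R X S"
  shows "submod_of R (X\<lparr>carrier := S\<rparr>) X"
  using left_module_submod_on[OF assms] assms submod_onD(1)[OF assms(2)] by (auto simp: submod_of_def)

lemma submod_ofD:
  assumes "submod_of R N M"
  shows "left_module R N" "left_module R M" "carrier N \<subseteq> carrier M"
    "\<And>x. x \<in> carrier N \<Longrightarrow> x \<in> carrier M"
    "\<And>x y. x \<in> carrier N \<Longrightarrow> y \<in> carrier N \<Longrightarrow> x \<oplus>\<^bsub>N\<^esub> y = x \<oplus>\<^bsub>M\<^esub> y"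
    "\<And>r x. r \<in> carrier R \<Longrightarrow> x \<in> carrier N \<Longrightarrow> r \<odot>\<^bsub>N\<^esub> x = r \<odot>\<^bsub>M\<^esub> x"
  using assms by (auto simp: submod_of_def)

lemma submod_of_lin:
  assumes "submod_of R N M" shows "mod_lin R N M (\<lambda>x. x)"
  using submod_ofD[OF assms] by (intro mod_linI) auto

lemma submod_of_zero:
  assumes "submod_of R N M" shows "\<zero>\<^bsub>N\<^esub> = \<zero>\<^bsub>M\<^esub>"
  using mod_lin_zero[OF submod_ofD(1,2)[OF assms] submod_of_lin[OF assms]] .

lemma submod_of_refl: "left_module R M \<Longrightarrow> submod_of R M M"
  by (simp add: submod_of_def)

lemma submod_of_trans:
  assumes "submod_of R M N" "submod_of R N K" shows "submod_of R M K"
  using submod_ofD[OF assms(1)] submod_ofD[OF assms(2)] by (simp add: submod_of_def subset_trans)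

lemma submod_of_sandwich:
  assumes "submod_of R M K" "submod_of R N K" "carrier M \<subseteq> carrier N"
  shows "submod_of R M N"
proof -
  have "x \<in> carrier N" if "x \<in> carrier M" for x using assms(3) that by blast
  then show ?thesis
    using submod_ofD[OF assms(1)] submod_ofD[OF assms(2)] assms(3) by (simp add: submod_of_def)
qed

lemma submod_on_carrier:
  assumes "submod_of R N M" shows "submod_on R M (carrier N)"
proof -
  interpret N: left_module R N using submod_ofD(1)[OF assms] .
  note D = submod_ofD[OF assms]
  show ?thesis
  proof (rule submod_onI)
    show "\<zero>\<^bsub>M\<^esub> \<in> carrier N" using submod_of_zero[OF assms] N.M.zero_closed by simp
    show "x \<oplus>\<^bsub>M\<^esub> y \<in> carrier N" if "x \<in> carrier N" "y \<in> carrier N" for x y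
      using D(5)[OF that] N.M.add.m_closed[OF that] by simp
    show "r \<odot>\<^bsub>M\<^esub> x \<in> carrier N" if "r \<in> carrier R" "x \<in> carrier N" for r x
      using D(6)[OF that] N.smult_closed[OF that] by simp
  qed (use D in auto)
qed

lemma mod_lin_restrict:
  assumes "submod_of R N M" "mod_lin R M K f" shows "mod_lin R N K f"
  using mod_lin_comp[OF submod_of_lin[OF assms(1)] assms(2)] .

subsection \<open>Constructions\<close>

definition reg_mod :: "('r, 'x) ring_scheme \<Rightarrow> ('r, 'r) module" where
  "reg_mod R = \<lparr>carrier = carrier R, mult = undefined, one = undefined, zero = \<zero>\<^bsub>R\<^esub>,
     add = add R, smult = mult R\<rparr>"

lemma reg_mod_simps [simp]:
  "carrier (reg_mod R) = carrier R" "\<zero>\<^bsub>reg_mod R\<^esub> = \<zero>\<^bsub>R\<^esub>"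
  "x \<oplus>\<^bsub>reg_mod R\<^esub> y = x \<oplus>\<^bsub>R\<^esub> y" "r \<odot>\<^bsub>reg_mod R\<^esub> x = r \<otimes>\<^bsub>R\<^esub> x"
  by (simp_all add: reg_mod_def)

lemma left_module_reg_mod:
  assumes "ring R" shows "left_module R (reg_mod R)"
proof -
  interpret ring R by fact
  show ?thesis
    by (rule left_moduleI) (use l_neg a_inv_closed in \<open>auto simp: assms add.m_ac l_distr r_distr m_assoc\<close>)
qed

definition prod_mod :: "('r, 'a) module \<Rightarrow> ('r, 'b) module \<Rightarrow> ('r, 'a \<times> 'b) module" where
  "prod_mod X Y = \<lparr>carrier = carrier X \<times> carrier Y, mult = undefined, one = undefined,
     zero = (\<zero>\<^bsub>X\<^esub>, \<zero>\<^bsub>Y\<^esub>), add = (\<lambda>(x, y) (x', y'). (x \<oplus>\<^bsub>X\<^esub> x', y \<oplus>\<^bsub>Y\<^esub> y')),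
     smult = (\<lambda>r (x, y). (r \<odot>\<^bsub>X\<^esub> x, r \<odot>\<^bsub>Y\<^esub> y))\<rparr>"

lemma prod_mod_simps [simp]:
  "carrier (prod_mod X Y) = carrier X \<times> carrier Y" "\<zero>\<^bsub>prod_mod X Y\<^esub> = (\<zero>\<^bsub>X\<^esub>, \<zero>\<^bsub>Y\<^esub>)"
  "(x, y) \<oplus>\<^bsub>prod_mod X Y\<^esub> (x', y') = (x \<oplus>\<^bsub>X\<^esub> x', y \<oplus>\<^bsub>Y\<^esub> y')"
  "r \<odot>\<^bsub>prod_mod X Y\<^esub> (x, y) = (r \<odot>\<^bsub>X\<^esub> x, r \<odot>\<^bsub>Y\<^esub> y)"
  by (simp_all add: prod_mod_def)

lemma left_module_prod_mod:
  assumes "left_module R X" "left_module R Y" shows "left_module R (prod_mod X Y)"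
proof -
  interpret X: left_module R X by fact
  interpret Y: left_module R Y by fact
  have "\<exists>y\<in>carrier (prod_mod X Y). y \<oplus>\<^bsub>prod_mod X Y\<^esub> x = \<zero>\<^bsub>prod_mod X Y\<^esub>"
    if "x \<in> carrier (prod_mod X Y)" for x
    by (rule bexI[of _ "(\<ominus>\<^bsub>X\<^esub> fst x, \<ominus>\<^bsub>Y\<^esub> snd x)"]) (use that in \<open>auto simp: X.M.l_neg Y.M.l_neg\<close>)
  then show ?thesis
    by (intro left_moduleI)
      (auto simp: X.R.ring_axioms X.M.add.m_ac Y.M.add.m_ac
        X.smult_l_distr Y.smult_l_distr X.smult_r_distr Y.smult_r_distr X.smult_assoc1 Y.smult_assoc1
        X.smult_one Y.smult_one X.smult_closed Y.smult_closed)
qed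

lemma prod_mod_minus:
  assumes "left_module R X" "left_module R Y" "x \<in> carrier X" "x' \<in> carrier X" "y \<in> carrier Y" "y' \<in> carrier Y"
  shows "(x, y) \<ominus>\<^bsub>prod_mod X Y\<^esub> (x', y') = (x \<ominus>\<^bsub>X\<^esub> x', y \<ominus>\<^bsub>Y\<^esub> y')"
proof -
  interpret X: left_module R X by fact
  interpret Y: left_module R Y by fact
  interpret P: left_module R "prod_mod X Y" by (rule left_module_prod_mod) fact+
  have "(\<ominus>\<^bsub>R\<^esub> \<one>\<^bsub>R\<^esub>) \<odot>\<^bsub>prod_mod X Y\<^esub> (x', y') = \<ominus>\<^bsub>prod_mod X Y\<^esub> (x', y')"
    using assms by (intro P.smult_minus_one) simp
  then have "\<ominus>\<^bsub>prod_mod X Y\<^esub> (x', y') = (\<ominus>\<^bsub>X\<^esub> x', \<ominus>\<^bsub>Y\<^esub> y')"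
    using assms by (simp add: X.smult_minus_one Y.smult_minus_one)
  then show ?thesis by (simp add: a_minus_def)
qed

text \<open>Both transport of structure along an injection and quotients are instances.\<close>

lemma pushforward_module:
  fixes X :: "('r, 'a) module" and q :: "'a \<Rightarrow> 'b"
  assumes X: "left_module R X"
    and add: "\<And>x x' y y'. \<lbrakk>x \<in> carrier X; x' \<in> carrier X; y \<in> carrier X; y' \<in> carrier X; q x = q x'; q y = q y'\<rbrakk>
      \<Longrightarrow> q (x \<oplus>\<^bsub>X\<^esub> y) = q (x' \<oplus>\<^bsub>X\<^esub> y')"
    and smult: "\<And>r x x'. \<lbrakk>r \<in> carrier R; x \<in> carrier X; x' \<in> carrier X; q x = q x'\<rbrakk>
      \<Longrightarrow> q (r \<odot>\<^bsub>X\<^esub> x) = q (r \<odot>\<^bsub>X\<^esub> x')"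
  obtains Q :: "('r, 'b) module"
  where "left_module R Q" "carrier Q = q ` carrier X" "mod_lin R X Q q"
proof -
  interpret X: left_module R X by fact
  \<comment> \<open>A representative of each value of \<open>q\<close>; the hypotheses
    \<open>add\<close> and \<open>smult\<close> make the operations below independent of this
    choice.\<close>
  define i where "i = inv_into (carrier X) q"
  have i: "i (q x) \<in> carrier X" "q (i (q x)) = q x" if "x \<in> carrier X" for x
    using that by (auto simp: i_def f_inv_into_f inv_into_into)
  define Q :: "('r, 'b) module" where
    "Q = \<lparr>carrier = q ` carrier X, mult = undefined, one = undefined, zero = q \<zero>\<^bsub>X\<^esub>,
      add = (\<lambda>a b. q (i a \<oplus>\<^bsub>X\<^esub> i b)), smult = (\<lambda>r a. q (r \<odot>\<^bsub>X\<^esub> i a))\<rparr>"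
  have Qadd: "q x \<oplus>\<^bsub>Q\<^esub> q y = q (x \<oplus>\<^bsub>X\<^esub> y)" if "x \<in> carrier X" "y \<in> carrier X" for x y
    using that i by (auto simp: Q_def intro!: add)
  have Qsm: "r \<odot>\<^bsub>Q\<^esub> q x = q (r \<odot>\<^bsub>X\<^esub> x)" if "r \<in> carrier R" "x \<in> carrier X" for r x
    using that i by (auto simp: Q_def intro!: smult)
  have Qc: "carrier Q = q ` carrier X" and Qz: "\<zero>\<^bsub>Q\<^esub> = q \<zero>\<^bsub>X\<^esub>" by (simp_all add: Q_def)
  have "left_module R Q"
  proof (rule left_moduleI)
    fix x assume "x \<in> carrier Q"
    then obtain x' where x': "x' \<in> carrier X" "x = q x'" by (auto simp: Qc)
    show "\<exists>y\<in>carrier Q. y \<oplus>\<^bsub>Q\<^esub> x = \<zero>\<^bsub>Q\<^esub>"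
      by (rule bexI[of _ "q (\<ominus>\<^bsub>X\<^esub> x')"]) (use x' in \<open>auto simp: Qc Qz Qadd X.M.l_neg\<close>)
  qed (auto simp: Qc Qz Qadd Qsm X.R.ring_axioms X.M.add.m_ac X.smult_closed X.smult_l_distr
      X.smult_r_distr X.smult_assoc1 X.smult_one)
  moreover have "mod_lin R X Q q"
    by (rule mod_linI) (auto simp: Qc Qadd Qsm)
  ultimately show thesis using that Qc by blast
qed

lemma quotient_module:
  fixes X :: "('r, 'a) module"
  assumes X: "left_module R X" and S: "submod_on R X S"
  obtains Q :: "('r, 'a set) module" and q
  where "left_module R Q" "carrier Q = q ` carrier X" "mod_lin R X Q q"
    "\<And>x y. x \<in> carrier X \<Longrightarrow> y \<in> carrier X \<Longrightarrow> q x = q y \<longleftrightarrow> x \<ominus>\<^bsub>X\<^esub> y \<in> S"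
proof -
  interpret X: left_module R X by fact
  \<comment> \<open>This is the coset of \<open>x\<close> modulo \<open>S\<close>.\<close>
  define q where "q x = {y \<in> carrier X. x \<ominus>\<^bsub>X\<^esub> y \<in> S}" for x
  have q: "q x = q y \<longleftrightarrow> x \<ominus>\<^bsub>X\<^esub> y \<in> S" if "x \<in> carrier X" "y \<in> carrier X" for x y
  proof
    assume "q x = q y"
    moreover have "y \<in> q y" using that submod_onD(3)[OF S] by (simp add: q_def X.M.r_neg a_minus_def)
    ultimately show "x \<ominus>\<^bsub>X\<^esub> y \<in> S" by (auto simp: q_def)
  next
    assume xy: "x \<ominus>\<^bsub>X\<^esub> y \<in> S"
    have "x \<ominus>\<^bsub>X\<^esub> z \<in> S \<longleftrightarrow> y \<ominus>\<^bsub>X\<^esub> z \<in> S" if "z \<in> carrier X" for z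
    proof -
      have *: "(y \<oplus>\<^bsub>X\<^esub> \<ominus>\<^bsub>X\<^esub> z) \<oplus>\<^bsub>X\<^esub> (x \<oplus>\<^bsub>X\<^esub> \<ominus>\<^bsub>X\<^esub> y) = (x \<oplus>\<^bsub>X\<^esub> \<ominus>\<^bsub>X\<^esub> z) \<oplus>\<^bsub>X\<^esub> (y \<oplus>\<^bsub>X\<^esub> \<ominus>\<^bsub>X\<^esub> y)"
        using that \<open>x \<in> carrier X\<close> \<open>y \<in> carrier X\<close> by (simp add: X.M.add.m_ac)
      have "x \<ominus>\<^bsub>X\<^esub> z = (y \<ominus>\<^bsub>X\<^esub> z) \<oplus>\<^bsub>X\<^esub> (x \<ominus>\<^bsub>X\<^esub> y)"
        using that \<open>x \<in> carrier X\<close> \<open>y \<in> carrier X\<close>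
        by (simp add: a_minus_def * X.M.r_neg)
      then show ?thesis
        using submod_on_add_iff[OF X S _ xy, of "y \<ominus>\<^bsub>X\<^esub> z"] that \<open>y \<in> carrier X\<close> by simp
    qed
    then show "q x = q y" by (auto simp: q_def)
  qed
  have 1: "q (x \<oplus>\<^bsub>X\<^esub> y) = q (x' \<oplus>\<^bsub>X\<^esub> y')"
    if "x \<in> carrier X" "x' \<in> carrier X" "y \<in> carrier X" "y' \<in> carrier X" "q x = q x'" "q y = q y'" for x x' y y'
  proof -
    have "(x \<oplus>\<^bsub>X\<^esub> y) \<ominus>\<^bsub>X\<^esub> (x' \<oplus>\<^bsub>X\<^esub> y') = (x \<ominus>\<^bsub>X\<^esub> x') \<oplus>\<^bsub>X\<^esub> (y \<ominus>\<^bsub>X\<^esub> y')"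
      using that by (simp add: a_minus_def X.M.minus_add X.M.add.m_ac)
    then show ?thesis using that submod_onD(4)[OF S] by (simp add: q)
  qed
  have 2: "q (r \<odot>\<^bsub>X\<^esub> x) = q (r \<odot>\<^bsub>X\<^esub> x')"
    if "r \<in> carrier R" "x \<in> carrier X" "x' \<in> carrier X" "q x = q x'" for r x x'
  proof -
    have "r \<odot>\<^bsub>X\<^esub> x \<ominus>\<^bsub>X\<^esub> r \<odot>\<^bsub>X\<^esub> x' = r \<odot>\<^bsub>X\<^esub> (x \<ominus>\<^bsub>X\<^esub> x')"
      using that by (simp add: a_minus_def X.smult_r_distr X.smult_minus_right)
    then show ?thesis using that submod_onD(5)[OF S] by (simp add: q X.smult_closed)
  qed
  obtain Q :: "('r, 'a set) module" where "left_module R Q" "carrier Q = q ` carrier X" "mod_lin R X Q q"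
    using pushforward_module[of R X q, OF X 1 2] by blast
  then show thesis using that q by blast
qed

section \<open>Copies and pushouts inside a fixed universe of elements\<close>

locale module_universe =
  fixes R :: "('r, 'x) ring_scheme" and lam :: "'l rel" and U :: "'m itself"
  assumes ring: "ring R" and Cinf_lam: "Cinfinite lam" and card_R: "|carrier R| \<le>o lam"
    and lam_less: "lam <o |UNIV :: 'm set|"
begin

lemma Card_lam: "Card_order lam"
  using Cinf_lam by blast

lemma Well_lam: "Well_order lam"
  using card_order_on_well_order_on[OF Card_lam] .

lemma card_prod_le:
  assumes "|A| \<le>o lam" "|B| \<le>o lam" shows "|A \<times> B| \<le>o lam"
  using card_of_Times_ordLeq_infinite_Field[of lam A B] Cinf_lam assms by (auto simp: cinfinite_def)

text \<open>Since \<open>N\<close> has at most \<open>lam\<close> elements and \<open>lam\<close> is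
  smaller than the universe, the complement of \<open>N\<close> still has room for all of
  \<open>K\<close>. So \<open>K\<close> can be renamed with the image of \<open>N\<close> getting
  its own elements back.\<close>

lemma copy_over:
  fixes N :: "('r, 'm) module" and K :: "('r, 'b) module"
  assumes N: "left_module R N" and K: "left_module R K"
    and e: "mod_lin R N K e" "inj_on e (carrier N)" and cK: "|carrier K| \<le>o lam"
  obtains K' :: "('r, 'm) module" and \<phi>
  where "submod_of R N K'" "mod_lin R K' K \<phi>" "bij_betw \<phi> (carrier K') (carrier K)"
    "\<And>x. x \<in> carrier N \<Longrightarrow> \<phi> x = e x"
proof -
  interpret N: left_module R N by fact
  interpret K: left_module R K by fact
  have eK: "e x \<in> carrier K" if "x \<in> carrier N" for x using mod_linD(1)[OF e(1) that] .
  have cN: "|carrier N| \<le>o lam"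
    by (rule ordLeq_transitive[OF card_of_ordLeqI[OF e(2)] cK]) (rule eK)
  have "\<not> |UNIV - carrier N| \<le>o lam"
  proof
    assume "|UNIV - carrier N| \<le>o lam"
    then have "|carrier N \<union> (UNIV - carrier N)| \<le>o lam" using cN Cinf_lam by (intro Un_Cinfinite_bound)
    then show False using lam_less not_ordLess_ordLeq by auto
  qed
  then have "lam \<le>o |UNIV - carrier N|"
    using ordLeq_total[OF Well_lam card_of_Well_order] by blast
  then have "|carrier K - e ` carrier N| \<le>o |UNIV - carrier N|"
    using ordLeq_transitive[OF ordLeq_transitive[OF card_of_mono1[OF Diff_subset] cK]] by blast
  then obtain \<iota> where \<iota>: "inj_on \<iota> (carrier K - e ` carrier N)" "\<iota> ` (carrier K - e ` carrier N) \<subseteq> UNIV - carrier N"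
    using card_of_ordLeq[of "carrier K - e ` carrier N" "UNIV - carrier N"] by blast
  \<comment> \<open>Elements of the image of \<open>N\<close> return to \<open>N\<close>, the others
    go injectively outside \<open>N\<close>; the two cases cannot collide.\<close>
  define \<psi> where "\<psi> y = (if y \<in> e ` carrier N then inv_into (carrier N) e y else \<iota> y)" for y
  have \<psi>e: "\<psi> (e x) = x" if "x \<in> carrier N" for x using that e(2) by (auto simp: \<psi>_def)
  have inj: "inj_on \<psi> (carrier K)"
  proof (rule inj_onI)
    fix y z assume yz: "y \<in> carrier K" "z \<in> carrier K" "\<psi> y = \<psi> z"
    have in1: "\<psi> u \<in> carrier N \<longleftrightarrow> u \<in> e ` carrier N" if "u \<in> carrier K" for u
      using \<iota>(2) that \<psi>e by (auto simp: \<psi>_def)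
    show "y = z"
    proof (cases "y \<in> e ` carrier N")
      case True
      then have "z \<in> e ` carrier N" using in1 yz by metis
      then show ?thesis using True \<psi>e yz(3) by auto
    next
      case False
      then have "z \<notin> e ` carrier N" using in1 yz by metis
      then show ?thesis using False yz \<iota>(1) by (auto simp: \<psi>_def dest: inj_onD)
    qed
  qed
  obtain Q :: "('r, 'm) module" where Q: "left_module R Q" "carrier Q = \<psi> ` carrier K" "mod_lin R K Q \<psi>"
  proof (rule pushforward_module[OF K, of \<psi>])
    show "\<psi> (x \<oplus>\<^bsub>K\<^esub> y) = \<psi> (x' \<oplus>\<^bsub>K\<^esub> y')"
      if "x \<in> carrier K" "x' \<in> carrier K" "y \<in> carrier K" "y' \<in> carrier K" "\<psi> x = \<psi> x'" "\<psi> y = \<psi> y'" for x x' y y'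
      using inj_onD[OF inj that(5)] inj_onD[OF inj that(6)] that by simp
    show "\<psi> (r \<odot>\<^bsub>K\<^esub> x) = \<psi> (r \<odot>\<^bsub>K\<^esub> x')"
      if "r \<in> carrier R" "x \<in> carrier K" "x' \<in> carrier K" "\<psi> x = \<psi> x'" for r x x'
      using inj_onD[OF inj that(4)] that by simp
  qed
  have bij: "bij_betw \<psi> (carrier K) (carrier Q)" using inj Q(2) by (simp add: bij_betw_def)
  have "submod_of R N Q"
    unfolding submod_of_def
  proof (intro conjI ballI)
    show "carrier N \<subseteq> carrier Q" using eK \<psi>e Q(2) by force
    fix x y assume xy: "x \<in> carrier N" "y \<in> carrier N"
    have "\<psi> (e (x \<oplus>\<^bsub>N\<^esub> y)) = \<psi> (e x) \<oplus>\<^bsub>Q\<^esub> \<psi> (e y)"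
      using mod_linD(2)[OF e(1) xy] mod_linD(2)[OF Q(3) eK[OF xy(1)] eK[OF xy(2)]] by simp
    then show "x \<oplus>\<^bsub>N\<^esub> y = x \<oplus>\<^bsub>Q\<^esub> y" using xy by (simp add: \<psi>e)
  next
    fix r x assume rx: "r \<in> carrier R" "x \<in> carrier N"
    have "\<psi> (e (r \<odot>\<^bsub>N\<^esub> x)) = r \<odot>\<^bsub>Q\<^esub> \<psi> (e x)"
      using mod_linD(3)[OF e(1) rx] mod_linD(3)[OF Q(3) rx(1) eK[OF rx(2)]] by simp
    then show "r \<odot>\<^bsub>N\<^esub> x = r \<odot>\<^bsub>Q\<^esub> x" using rx N.smult_closed by (simp add: \<psi>e)
  qed fact+
  moreover have "inv_into (carrier K) \<psi> x = e x" if "x \<in> carrier N" for x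
    using inv_into_f_f[OF inj eK[OF that]] \<psi>e[OF that] by simp
  ultimately show thesis
    using that[of Q "inv_into (carrier K) \<psi>"] mod_lin_inv_into[OF K Q(3) bij] bij_betw_inv_into[OF bij] by blast
qed

text \<open>\<open>universal_over\<close> concerns only modules in \<open>'m\<close> that literally
  contain \<open>N\<close> and have the cardinality of \<open>M\<close>. A copy of \<open>K\<close>
  over \<open>N\<close> meets these demands: its size is forced by \<open>N\<close> from below and
  by \<open>lam\<close> from above, which is why an upper bound on \<open>K\<close> is
  enough.\<close>

lemma universal_over_embed:
  fixes M N :: "('r, 'm) module" and K :: "('r, 'b) module"
  assumes univ: "universal_over R M N" and cM: "|carrier M| =o lam"
    and K: "left_module R K" and e: "mod_lin R N K e" "inj_on e (carrier N)" and cK: "|carrier K| \<le>o lam"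
  obtains f where "mod_lin R K M f" "inj_on f (carrier K)" "\<And>x. x \<in> carrier N \<Longrightarrow> f (e x) = x"
proof -
  have NM: "submod_of R N M" and cMN: "|carrier M| =o |carrier N|"
    using univ by (auto simp: universal_over_def)
  obtain K' :: "('r, 'm) module" and \<phi> where K': "submod_of R N K'" "mod_lin R K' K \<phi>"
    "bij_betw \<phi> (carrier K') (carrier K)" "\<And>x. x \<in> carrier N \<Longrightarrow> \<phi> x = e x"
    using copy_over[OF submod_ofD(1)[OF NM] K e cK] by blast
  have "|carrier K'| =o |carrier K|" using K'(3) card_of_ordIsoI by blast
  then have "|carrier K'| \<le>o |carrier M|"
    by (rule ordIso_ordLeq_trans[OF _ ordLeq_ordIso_trans[OF cK ordIso_symmetric[OF cM]]])
  moreover have "|carrier M| \<le>o |carrier K'|"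
    by (rule ordIso_ordLeq_trans[OF cMN card_of_mono1[OF submod_ofD(3)[OF K'(1)]]])
  ultimately have "|carrier K'| =o |carrier M|" by (simp add: ordIso_iff_ordLeq)
  then obtain h where h: "h \<in> mod_embeddings R K' M" "\<And>x. x \<in> carrier N \<Longrightarrow> h x = x"
    using univ K'(1) unfolding universal_over_def by blast
  then have hl: "mod_lin R K' M h" "inj_on h (carrier K')"
    by (auto simp: mod_embeddings_def mod_lin_iff_mod_hom)
  let ?g = "inv_into (carrier K') \<phi>"
  have gl: "mod_lin R K K' ?g" using mod_lin_inv_into[OF _ K'(2,3)] submod_ofD(2)[OF K'(1)] by blast
  have gb: "bij_betw ?g (carrier K) (carrier K')" using bij_betw_inv_into[OF K'(3)] .
  show thesis
  proof (rule that)
    show "mod_lin R K M (\<lambda>x. h (?g x))" using mod_lin_comp[OF gl hl(1)] .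
    show "inj_on (\<lambda>x. h (?g x)) (carrier K)"
      using comp_inj_on[of ?g "carrier K" h] gb hl(2) by (simp add: bij_betw_def comp_def)
    show "h (?g (e x)) = x" if "x \<in> carrier N" for x
    proof -
      have "?g (\<phi> x) = x"
        using inv_into_f_f[of \<phi> "carrier K'" x] K'(3) submod_ofD(4)[OF K'(1) that] by (simp add: bij_betw_def)
      then show ?thesis using K'(4)[OF that] h(2)[OF that] by simp
    qed
  qed
qed

text \<open>The witness is the pushout of \<open>X\<close> and \<open>Y\<close> along the graph \<open>H\<close>, embedded into \<open>Y'\<close> over \<open>Y\<close>.\<close>

lemma universal_over_extend:
  fixes Y Y' :: "('r, 'm) module" and X :: "('r, 'b) module"
  assumes univ: "universal_over R Y' Y" and cY': "|carrier Y'| =o lam"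
    and X: "left_module R X" and cX: "|carrier X| \<le>o lam"
    and H: "submod_on R (prod_mod X Y) H" and func: "\<And>y. (\<zero>\<^bsub>X\<^esub>, y) \<in> H \<Longrightarrow> y = \<zero>\<^bsub>Y\<^esub>"
  obtains g where "mod_lin R X Y' g"
    "\<And>x y. x \<in> carrier X \<Longrightarrow> y \<in> carrier Y \<Longrightarrow> g x = y \<longleftrightarrow> (x, y) \<in> H"
proof -
  have YY': "submod_of R Y Y'" using univ by (auto simp: universal_over_def)
  have Y: "left_module R Y" using submod_ofD(1)[OF YY'] .
  interpret X: left_module R X by fact
  interpret Y: left_module R Y by fact
  let ?P = "prod_mod X Y"
  have P: "left_module R ?P" using left_module_prod_mod[OF X Y] .
  \<comment> \<open>The pushout is the product modulo \<open>H'\<close>. The sign makes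
    \<open>(x, 0)\<close> and \<open>(0, y)\<close> equal in the quotient exactly if
    \<open>(x, y)\<close> is in \<open>H\<close>.\<close>
  define H' where "H' = {(x, y). y \<in> carrier Y \<and> (x, \<ominus>\<^bsub>Y\<^esub> y) \<in> H}"
  have H': "submod_on R ?P H'"
  proof (rule submod_onI)
    fix p q assume "p \<in> H'" "q \<in> H'"
    then obtain x y x' y' where *: "p = (x, y)" "q = (x', y')" "y \<in> carrier Y" "y' \<in> carrier Y"
      "(x, \<ominus>\<^bsub>Y\<^esub> y) \<in> H" "(x', \<ominus>\<^bsub>Y\<^esub> y') \<in> H" by (auto simp: H'_def)
    show "p \<oplus>\<^bsub>?P\<^esub> q \<in> H'" using submod_onD(4)[OF H *(5,6)] * by (simp add: H'_def Y.M.minus_add)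
  next
    fix r p assume "r \<in> carrier R" "p \<in> H'"
    then show "r \<odot>\<^bsub>?P\<^esub> p \<in> H'" using submod_onD(5)[OF H, of r]
      by (fastforce simp: H'_def Y.smult_closed Y.smult_minus_right)
  next
    show "\<zero>\<^bsub>?P\<^esub> \<in> H'" using submod_onD(3)[OF H] by (simp add: H'_def)
  qed (use submod_onD(2)[OF H] in \<open>auto simp: H'_def\<close>)
  obtain Q :: "('r, ('b \<times> 'm) set) module" and q where Q: "left_module R Q" "carrier Q = q ` carrier ?P"
    "mod_lin R ?P Q q" and qeq: "\<And>x y. x \<in> carrier ?P \<Longrightarrow> y \<in> carrier ?P \<Longrightarrow> q x = q y \<longleftrightarrow> x \<ominus>\<^bsub>?P\<^esub> y \<in> H'"
    using quotient_module[OF P H'] by blast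
  define u v where "u x = q (x, \<zero>\<^bsub>Y\<^esub>)" and "v y = q (\<zero>\<^bsub>X\<^esub>, y)" for x y
  have ul: "mod_lin R X Q u" and vl: "mod_lin R Y Q v"
    unfolding u_def v_def by (intro mod_lin_comp[OF _ Q(3)] mod_linI; simp)+
  have uv: "u x = v y \<longleftrightarrow> (x, y) \<in> H" if "x \<in> carrier X" "y \<in> carrier Y" for x y
    using that by (simp add: u_def v_def qeq prod_mod_minus[OF X Y] H'_def) (simp add: a_minus_def)
  \<comment> \<open>By \<open>func\<close>, the zero of \<open>X\<close> is related to zero only, so
    gluing along \<open>H\<close> identifies no two elements of \<open>Y\<close>; this is what
    allows the universality of \<open>Y'\<close> to be applied to the quotient.\<close>
  have "inj_on v (carrier Y)"
  proof (rule mod_lin_inj_on[OF Y Q(1) vl])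
    fix y assume y: "y \<in> carrier Y" "v y = \<zero>\<^bsub>Q\<^esub>"
    then have "u \<zero>\<^bsub>X\<^esub> = v y" using mod_lin_zero[OF X Q(1) ul] by simp
    then show "y = \<zero>\<^bsub>Y\<^esub>" using uv[of "\<zero>\<^bsub>X\<^esub>" y] y func by simp
  qed
  moreover have "|carrier Q| \<le>o lam"
  proof -
    have "|carrier Y| \<le>o lam"
      using ordLeq_ordIso_trans[OF card_of_mono1[OF submod_ofD(3)[OF YY']] cY'] .
    then have "|carrier ?P| \<le>o lam" using card_prod_le cX by simp
    then show ?thesis unfolding Q(2) by (rule ordLeq_transitive[OF card_of_image])
  qed
  ultimately obtain f where f: "mod_lin R Q Y' f" "inj_on f (carrier Q)" "\<And>y. y \<in> carrier Y \<Longrightarrow> f (v y) = y"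
    using universal_over_embed[OF univ cY' Q(1) vl] by blast
  show thesis
  proof (rule that[of "\<lambda>x. f (u x)"])
    show "mod_lin R X Y' (\<lambda>x. f (u x))" using mod_lin_comp[OF ul f(1)] .
    fix x y assume xy: "x \<in> carrier X" "y \<in> carrier Y"
    have "f (u x) = y \<longleftrightarrow> f (u x) = f (v y)" using f(3) xy by simp
    also have "\<dots> \<longleftrightarrow> u x = v y"
      using inj_on_eq_iff[OF f(2)] mod_linD(1)[OF ul xy(1)] mod_linD(1)[OF vl xy(2)] by blast
    finally show "f (u x) = y \<longleftrightarrow> (x, y) \<in> H" using uv xy by simp
  qed
qed

end

subsection \<open>Homomorphisms as graphs\<close>

lemma submod_on_mono_module:
  assumes "submod_of R X' X" "submod_on R X' S" shows "submod_on R X S"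
  using submod_onD[OF assms(2)] submod_ofD[OF assms(1)] submod_of_zero[OF assms(1)]
  by (intro submod_onI) metis+

lemma submod_on_restrict_module:
  assumes "submod_of R X' X" "submod_on R X S" "S \<subseteq> carrier X'" shows "submod_on R X' S"
proof (rule submod_onI)
  have S: "x \<in> carrier X'" if "x \<in> S" for x using assms(3) that by blast
  show "x \<oplus>\<^bsub>X'\<^esub> y \<in> S" if "x \<in> S" "y \<in> S" for x y
    using submod_ofD(5)[OF assms(1) S[OF that(1)] S[OF that(2)]] submod_onD(4)[OF assms(2) that] by simp
  show "r \<odot>\<^bsub>X'\<^esub> x \<in> S" if "r \<in> carrier R" "x \<in> S" for r x
    using submod_ofD(6)[OF assms(1) that(1) S[OF that(2)]] submod_onD(5)[OF assms(2) that] by simp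
qed (use assms submod_onD(3)[OF assms(2)] submod_of_zero[OF assms(1)] in auto)

lemma submod_of_prod_mod:
  assumes "submod_of R M' M" "submod_of R N' N"
  shows "submod_of R (prod_mod M' N') (prod_mod M N)"
  unfolding submod_of_def
  using submod_ofD[OF assms(1)] submod_ofD[OF assms(2)]
  by (auto simp: left_module_prod_mod)

lemma submod_on_Union_chain:
  assumes "\<C> \<noteq> {}" "\<And>S. S \<in> \<C> \<Longrightarrow> submod_on R X S" "\<And>S T. S \<in> \<C> \<Longrightarrow> T \<in> \<C> \<Longrightarrow> S \<subseteq> T \<or> T \<subseteq> S"
  shows "submod_on R X (\<Union>\<C>)"
proof (rule submod_onI)
  fix x y assume "x \<in> \<Union>\<C>" "y \<in> \<Union>\<C>"
  then obtain S T where ST: "S \<in> \<C>" "x \<in> S" "T \<in> \<C>" "y \<in> T" by blast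
  then obtain V where "V \<in> \<C>" "x \<in> V" "y \<in> V" using assms(3)[OF ST(1,3)] by blast
  then show "x \<oplus>\<^bsub>X\<^esub> y \<in> \<Union>\<C>" using submod_onD(4)[OF assms(2)] by blast
next
  fix r x assume "r \<in> carrier R" "x \<in> \<Union>\<C>"
  then show "r \<odot>\<^bsub>X\<^esub> x \<in> \<Union>\<C>" using submod_onD(5)[OF assms(2)] by blast
next
  show "\<zero>\<^bsub>X\<^esub> \<in> \<Union>\<C>" using submod_onD(3)[OF assms(2)] assms(1) by blast
  show "x \<in> carrier X" if "x \<in> \<Union>\<C>" for x using submod_onD(2)[OF assms(2)] that by blast
qed

lemma submod_on_zero:
  assumes "left_module R X" shows "submod_on R X {\<zero>\<^bsub>X\<^esub>}"
proof -
  interpret X: left_module R X by fact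
  show ?thesis by (rule submod_onI) auto
qed

lemma graph_submod_on:
  assumes "left_module R X" "left_module R Y" "mod_lin R X Y g"
  shows "submod_on R (prod_mod X Y) ((\<lambda>x. (x, g x)) ` carrier X)"
proof -
  interpret X: left_module R X by fact
  note g = mod_linD[OF assms(3)]
  show ?thesis
    by (rule submod_onI) (auto simp: g X.smult_closed image_iff mod_lin_zero[OF assms])
qed

text \<open>A condition over zero is enough for a submodule of a product: two values at the same
  point differ by a value at zero. In this form it is inherited by unions at once.\<close>

definition functional :: "('r, 'a) module \<Rightarrow> ('r, 'b) module \<Rightarrow> ('a \<times> 'b) set \<Rightarrow> bool" where
  "functional X Y H \<longleftrightarrow> (\<forall>y. (\<zero>\<^bsub>X\<^esub>, y) \<in> H \<longrightarrow> y = \<zero>\<^bsub>Y\<^esub>)"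

lemma functional_zeroD: "functional X Y H \<Longrightarrow> (\<zero>\<^bsub>X\<^esub>, y) \<in> H \<Longrightarrow> y = \<zero>\<^bsub>Y\<^esub>"
  unfolding functional_def by blast

lemma functionalD:
  assumes X: "left_module R X" and Y: "left_module R Y" and H: "submod_on R (prod_mod X Y) H"
    and f: "functional X Y H" and xy: "(x, y) \<in> H" "(x, y') \<in> H"
  shows "y = y'"
proof -
  interpret X: left_module R X by fact
  interpret Y: left_module R Y by fact
  have c: "x \<in> carrier X" "y \<in> carrier Y" "y' \<in> carrier Y" using submod_onD(2)[OF H] xy by auto
  have "(x, y) \<ominus>\<^bsub>prod_mod X Y\<^esub> (x, y') \<in> H" using submod_on_minus[OF left_module_prod_mod[OF X Y] H xy] .
  then have "(\<zero>\<^bsub>X\<^esub>, y \<ominus>\<^bsub>Y\<^esub> y') \<in> H"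
    using prod_mod_minus[OF X Y c(1) c(1) c(2,3)] X.minus_eq_zero_iff[OF c(1) c(1)] by simp
  then show ?thesis using functional_zeroD[OF f] Y.minus_eq_zero_iff[OF c(2,3)] by blast
qed

lemma functional_obtains_lin:
  assumes X: "left_module R X" and Y: "left_module R Y" and H: "submod_on R (prod_mod X Y) H"
    and f: "functional X Y H" and dom: "carrier X \<subseteq> Domain H"
  obtains g where "mod_lin R X Y g" "\<And>x y. x \<in> carrier X \<Longrightarrow> (x, y) \<in> H \<longleftrightarrow> y = g x"
proof -
  interpret X: left_module R X by fact
  have "\<forall>x\<in>carrier X. \<exists>y. (x, y) \<in> H" using dom by blast
  then obtain g where g: "\<And>x. x \<in> carrier X \<Longrightarrow> (x, g x) \<in> H" using bchoice by metis
  note uniq = functionalD[OF X Y H f]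
  have "mod_lin R X Y g"
  proof (rule mod_linI)
    fix x y assume xy: "x \<in> carrier X" "y \<in> carrier X"
    have "(x \<oplus>\<^bsub>X\<^esub> y, g x \<oplus>\<^bsub>Y\<^esub> g y) \<in> H" using submod_onD(4)[OF H g[OF xy(1)] g[OF xy(2)]] by simp
    then show "g (x \<oplus>\<^bsub>X\<^esub> y) = g x \<oplus>\<^bsub>Y\<^esub> g y" using uniq g xy by blast
  next
    fix r x assume rx: "r \<in> carrier R" "x \<in> carrier X"
    have "(r \<odot>\<^bsub>X\<^esub> x, r \<odot>\<^bsub>Y\<^esub> g x) \<in> H" using submod_onD(5)[OF H rx(1) g[OF rx(2)]] by simp
    then show "g (r \<odot>\<^bsub>X\<^esub> x) = r \<odot>\<^bsub>Y\<^esub> g x" using uniq g rx X.smult_closed by blast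
  qed (use submod_onD(2)[OF H g] in auto)
  then show thesis using that g uniq by blast
qed

lemma submod_on_prod_swap:
  assumes "submod_on R (prod_mod X Y) H" shows "submod_on R (prod_mod Y X) (H\<inverse>)"
proof (rule submod_onI)
  fix p q assume "p \<in> H\<inverse>" "q \<in> H\<inverse>"
  then show "p \<oplus>\<^bsub>prod_mod Y X\<^esub> q \<in> H\<inverse>"
    using submod_onD(4)[OF assms, of "(snd p, fst p)" "(snd q, fst q)"] by (cases p; cases q) auto
next
  fix r p assume "r \<in> carrier R" "p \<in> H\<inverse>"
  then show "r \<odot>\<^bsub>prod_mod Y X\<^esub> p \<in> H\<inverse>"
    using submod_onD(5)[OF assms, of r "(snd p, fst p)"] by (cases p) auto
qed (use submod_onD(2,3)[OF assms] in auto)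

subsection \<open>Towers\<close>

context module_universe
begin

text \<open>The last two clauses hold the cofinality: fewer than \<open>\<mu>\<close> members have
  an upper bound in \<open>F\<close>, while at most \<open>\<mu>\<close> members cover
  \<open>M\<close>. Bounds are stated for carriers only, since submodules of \<open>M\<close> with
  nested carriers are submodules of each other.\<close>

definition tower :: "'c rel \<Rightarrow> ('r, 'm) module set \<Rightarrow> ('r, 'm) module \<Rightarrow> bool" where
  "tower \<mu> F M \<longleftrightarrow> left_module R M \<and> Cinfinite \<mu> \<and> \<mu> \<le>o lam \<and>
    (\<forall>N\<in>F. submod_of R N M \<and> |carrier N| =o lam \<and> (\<exists>N'\<in>F. universal_over R N' N)) \<and>
    (\<forall>X\<subseteq>F. |X| <o \<mu> \<longrightarrow> (\<exists>N\<in>F. \<forall>K\<in>X. carrier K \<subseteq> carrier N)) \<and>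
    (\<exists>A\<subseteq>F. |A| \<le>o \<mu> \<and> carrier M = (\<Union>N\<in>A. carrier N))"

lemma towerD:
  assumes "tower \<mu> F M"
  shows "left_module R M" "Cinfinite \<mu>" "\<mu> \<le>o lam"
    "\<And>N. N \<in> F \<Longrightarrow> submod_of R N M" "\<And>N. N \<in> F \<Longrightarrow> |carrier N| =o lam"
    "\<And>N. N \<in> F \<Longrightarrow> \<exists>N'\<in>F. universal_over R N' N"
    "\<And>X. X \<subseteq> F \<Longrightarrow> |X| <o \<mu> \<Longrightarrow> \<exists>N\<in>F. \<forall>K\<in>X. carrier K \<subseteq> carrier N"
    "\<exists>A\<subseteq>F. |A| \<le>o \<mu> \<and> carrier M = (\<Union>N\<in>A. carrier N)"
  using assms unfolding tower_def by blast+

lemma tower_card: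
  assumes "tower \<mu> F M" shows "|carrier M| \<le>o lam"
proof -
  obtain A where A: "A \<subseteq> F" "|A| \<le>o \<mu>" "carrier M = (\<Union>N\<in>A. carrier N)" using towerD(8)[OF assms] by blast
  have "|A| \<le>o lam" using ordLeq_transitive[OF A(2) towerD(3)[OF assms]] .
  moreover have "\<forall>N\<in>A. |carrier N| \<le>o lam" using towerD(5)[OF assms] A(1) ordIso_imp_ordLeq by blast
  ultimately show ?thesis unfolding A(3) by (rule UNION_Cinfinite_bound) (rule Cinf_lam)
qed

lemma tower_bounded:
  assumes t: "tower \<mu> F M" and I: "|I| <o \<mu>" and S: "\<And>i. i \<in> I \<Longrightarrow> \<exists>N\<in>F. S i \<subseteq> carrier N"
  obtains N where "N \<in> F" "\<And>i. i \<in> I \<Longrightarrow> S i \<subseteq> carrier N"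
proof -
  obtain c where c: "\<And>i. i \<in> I \<Longrightarrow> c i \<in> F \<and> S i \<subseteq> carrier (c i)" using S by metis
  have "|c ` I| <o \<mu>" by (rule ordLeq_ordLess_trans[OF card_of_image I])
  then obtain N where "N \<in> F" "\<forall>K\<in>c ` I. carrier K \<subseteq> carrier N"
    using towerD(7)[OF t, of "c ` I"] c by blast
  then show thesis using that[of N] c by blast
qed

lemma tower_element:
  assumes t: "tower \<mu> F M" and "x \<in> carrier M" obtains N where "N \<in> F" "x \<in> carrier N"
  using towerD(8)[OF t] assms(2) by blast

lemma tower_directed:
  assumes t: "tower \<mu> F M" and "N1 \<in> F" "N2 \<in> F"
  obtains N where "N \<in> F" "carrier N1 \<subseteq> carrier N" "carrier N2 \<subseteq> carrier N"
proof -
  have "|{N1, N2}| <o \<mu>" by (rule finite_ordLess_Cinfinite[OF _ towerD(2)[OF t]]) simp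
  then obtain N where "N \<in> F" "\<And>K. K \<in> {N1, N2} \<Longrightarrow> carrier K \<subseteq> carrier N"
    using tower_bounded[OF t, of "{N1, N2}" carrier] assms by blast
  then show thesis using that by simp
qed

lemma tower_ordIso:
  assumes "tower \<mu> F M" "\<mu> =o \<mu>'" shows "tower \<mu>' F M"
proof -
  have "Cinfinite \<mu>'" using Cinfinite_cong[OF assms(2) towerD(2)[OF assms(1)]] .
  moreover have "\<mu>' \<le>o lam" using ordIso_ordLeq_trans[OF ordIso_symmetric[OF assms(2)] towerD(3)[OF assms(1)]] .
  moreover have "|X| <o \<mu>" if "|X| <o \<mu>'" for X :: "('r, 'm) module set"
    using ordLess_ordIso_trans[OF that ordIso_symmetric[OF assms(2)]] .
  moreover have "|X| \<le>o \<mu>'" if "|X| \<le>o \<mu>" for X :: "('r, 'm) module set"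
    using ordLeq_ordIso_trans[OF that assms(2)] .
  ultimately show ?thesis using assms(1) unfolding tower_def by meson
qed

lemma tower_nonempty:
  assumes "tower \<mu> F M" shows "F \<noteq> {}"
proof -
  have "|{} :: ('r, 'm) module set| <o \<mu>" by (rule finite_ordLess_Cinfinite[OF _ towerD(2)[OF assms]]) simp
  then show ?thesis using towerD(7)[OF assms, of "{}"] by blast
qed

subsection \<open>Uniqueness of towers with a given cofinality\<close>

text \<open>With functionality in both directions this is an isomorphism between a submodule of
  \<open>M\<close> and a submodule of \<open>N\<close>. The symmetric form lets the back step be the
  forth step applied to the converse.\<close>

definition partial_iso :: "('r, 'm) module \<Rightarrow> ('r, 'm) module \<Rightarrow> ('m \<times> 'm) set \<Rightarrow> bool" where
  "partial_iso M N H \<longleftrightarrow> submod_on R (prod_mod M N) H \<and> functional M N H \<and> functional N M (H\<inverse>)"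

lemma partial_iso_converse: "partial_iso M N H \<Longrightarrow> partial_iso N M (H\<inverse>)"
  by (simp add: partial_iso_def submod_on_prod_swap)

text \<open>The bound on the range is what makes an extension possible: its target is a universal
  extension of a member that contains the range.\<close>

definition bounded_in :: "('r, 'm) module set \<Rightarrow> ('r, 'm) module set \<Rightarrow> ('m \<times> 'm) set \<Rightarrow> bool" where
  "bounded_in F G H \<longleftrightarrow> (\<exists>N\<in>F. Domain H \<subseteq> carrier N) \<and> (\<exists>K\<in>G. Range H \<subseteq> carrier K)"

text \<open>The domain grows to a member \<open>N2\<close> above \<open>N0\<close> and
  \<open>Domain H\<close>, the range into a universal extension \<open>K'\<close> of a member
  containing \<open>Range H\<close>. The extension \<open>g\<close> takes values in that member only
  along \<open>H\<close>; for the value zero this says that \<open>g\<close> has trivial kernel, so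
  its graph is again a partial isomorphism.\<close>

lemma partial_iso_extend:
  assumes tM: "tower \<mu> F M" and tN: "tower \<nu> G N" and H: "partial_iso M N H" "bounded_in F G H" and N0: "N0 \<in> F"
  obtains H' where "H \<subseteq> H'" "partial_iso M N H'" "bounded_in F G H'" "carrier N0 \<subseteq> Domain H'"
proof -
  have func: "functional M N H" "functional N M (H\<inverse>)" using H(1) by (auto simp: partial_iso_def)
  obtain N1 K where N1: "N1 \<in> F" "Domain H \<subseteq> carrier N1" and K: "K \<in> G" "Range H \<subseteq> carrier K"
    using H(2) by (auto simp: bounded_in_def)
  obtain N2 where N2: "N2 \<in> F" "carrier N0 \<subseteq> carrier N2" "carrier N1 \<subseteq> carrier N2"
    using tower_directed[OF tM N0 N1(1)] by blast
  obtain K' where K': "K' \<in> G" "universal_over R K' K" using towerD(6)[OF tN K(1)] by blast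
  note s2 = towerD(4)[OF tM N2(1)] and sK = towerD(4)[OF tN K(1)] and sK' = towerD(4)[OF tN K'(1)]
  note m2 = submod_ofD(1)[OF s2]
  interpret N2: left_module R N2 by fact
  have HNK: "submod_on R (prod_mod N2 K) H"
  proof (rule submod_on_restrict_module[OF submod_of_prod_mod[OF s2 sK]])
    show "submod_on R (prod_mod M N) H" using H(1) by (simp add: partial_iso_def)
    show "H \<subseteq> carrier (prod_mod N2 K)" using N1(2) N2(3) K(2) by auto
  qed
  obtain g where g: "mod_lin R N2 K' g" "\<And>x y. x \<in> carrier N2 \<Longrightarrow> y \<in> carrier K \<Longrightarrow> g x = y \<longleftrightarrow> (x, y) \<in> H"
  proof (rule universal_over_extend[OF K'(2) towerD(5)[OF tN K'(1)] m2 _ HNK])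
    show "|carrier N2| \<le>o lam" using towerD(5)[OF tM N2(1)] ordIso_imp_ordLeq by blast
    show "y = \<zero>\<^bsub>K\<^esub>" if "(\<zero>\<^bsub>N2\<^esub>, y) \<in> H" for y
    proof -
      have "(\<zero>\<^bsub>M\<^esub>, y) \<in> H" using that submod_of_zero[OF s2] by simp
      then have "y = \<zero>\<^bsub>N\<^esub>" by (rule functional_zeroD[OF func(1)])
      then show ?thesis using submod_of_zero[OF sK] by simp
    qed
  qed (use that in blast)
  define H' where "H' = (\<lambda>x. (x, g x)) ` carrier N2"
  have zN2: "\<zero>\<^bsub>N2\<^esub> = \<zero>\<^bsub>M\<^esub>" and zK: "\<zero>\<^bsub>K\<^esub> = \<zero>\<^bsub>N\<^esub>" and zK': "\<zero>\<^bsub>K'\<^esub> = \<zero>\<^bsub>N\<^esub>"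
    by (rule submod_of_zero[OF s2], rule submod_of_zero[OF sK], rule submod_of_zero[OF sK'])
  have zK_in: "\<zero>\<^bsub>N\<^esub> \<in> carrier K" using submod_onD(3)[OF submod_on_carrier[OF sK]] .
  show thesis
  proof (rule that)
    show "H \<subseteq> H'"
    proof (rule subrelI)
      fix x y assume xy: "(x, y) \<in> H"
      then have "x \<in> carrier N2" "y \<in> carrier K" using submod_onD(2)[OF HNK xy] by auto
      then show "(x, y) \<in> H'" using g(2)[of x y] xy by (auto simp: H'_def)
    qed
    have "submod_on R (prod_mod M N) H'"
      using submod_on_mono_module[OF submod_of_prod_mod[OF s2 sK'] graph_submod_on[OF m2 submod_ofD(1)[OF sK'] g(1)]]
      by (simp add: H'_def)
    moreover have "functional M N H'"
      using mod_lin_zero[OF m2 submod_ofD(1)[OF sK'] g(1)] by (auto simp: functional_def H'_def zN2 zK')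
    moreover have "functional N M (H'\<inverse>)"
    proof -
      have "x = \<zero>\<^bsub>M\<^esub>" if x: "x \<in> carrier N2" "g x = \<zero>\<^bsub>N\<^esub>" for x
      proof -
        have "(x, \<zero>\<^bsub>N\<^esub>) \<in> H" using g(2)[OF x(1) zK_in] x(2) by simp
        then show ?thesis using functional_zeroD[OF func(2)] by blast
      qed
      then show ?thesis by (auto simp: functional_def H'_def)
    qed
    ultimately show "partial_iso M N H'" by (simp add: partial_iso_def)
    show "bounded_in F G H'"
      unfolding bounded_in_def using N2(1) K'(1) mod_linD(1)[OF g(1)] by (auto simp: H'_def)
    show "carrier N0 \<subseteq> Domain H'" using N2(2) by (auto simp: H'_def)
  qed
qed

lemma partial_iso_extend_both:
  assumes tM: "tower \<mu> F M" and tN: "tower \<nu> G N" and H: "partial_iso M N H" "bounded_in F G H"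
    and N0: "N0 \<in> F" and K0: "K0 \<in> G"
  shows "\<exists>H'. H \<subseteq> H' \<and> partial_iso M N H' \<and> bounded_in F G H' \<and> carrier N0 \<subseteq> Domain H' \<and> carrier K0 \<subseteq> Range H'"
proof -
  obtain H1 where H1: "H \<subseteq> H1" "partial_iso M N H1" "bounded_in F G H1" "carrier N0 \<subseteq> Domain H1"
    using partial_iso_extend[OF tM tN H N0] by blast
  have "bounded_in G F (H1\<inverse>)" using H1(3) by (simp add: bounded_in_def)
  then obtain H2 where H2: "H1\<inverse> \<subseteq> H2" "partial_iso N M H2" "bounded_in G F H2" "carrier K0 \<subseteq> Domain H2"
    using partial_iso_extend[OF tN tM partial_iso_converse[OF H1(2)] _ K0] by blast
  have "H1 \<subseteq> H2\<inverse>" using H2(1) by auto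
  moreover from this have "Domain H1 \<subseteq> Range H2" by auto
  moreover have "bounded_in F G (H2\<inverse>)" using H2(3) by (simp add: bounded_in_def)
  ultimately show ?thesis
    using partial_iso_converse[OF H2(2)] H1(1,4) H2(4) by (intro exI[of _ "H2\<inverse>"]) auto
qed

lemma partial_iso_Union_chain:
  assumes "\<C> \<noteq> {}" "\<And>H. H \<in> \<C> \<Longrightarrow> partial_iso M N H" "\<And>S T. S \<in> \<C> \<Longrightarrow> T \<in> \<C> \<Longrightarrow> S \<subseteq> T \<or> T \<subseteq> S"
  shows "partial_iso M N (\<Union>\<C>)"
proof -
  have "submod_on R (prod_mod M N) (\<Union>\<C>)"
    by (rule submod_on_Union_chain) (use assms in \<open>auto simp: partial_iso_def\<close>)
  then show ?thesis using assms(2) by (auto simp: partial_iso_def functional_def)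
qed

lemma partial_iso_total:
  assumes M: "left_module R M" and N: "left_module R N" and H: "partial_iso M N H"
    and dom: "carrier M \<subseteq> Domain H" and ran: "carrier N \<subseteq> Range H"
  shows "mod_isomorphic R M N"
proof -
  have H': "submod_on R (prod_mod M N) H" "functional M N H" "functional N M (H\<inverse>)" using H by (auto simp: partial_iso_def)
  obtain g where g: "mod_lin R M N g" "\<And>x y. x \<in> carrier M \<Longrightarrow> (x, y) \<in> H \<longleftrightarrow> y = g x"
    using functional_obtains_lin[OF M N H'(1,2) dom] by blast
  have "inj_on g (carrier M)"
  proof (rule mod_lin_inj_on[OF M N g(1)])
    fix x assume "x \<in> carrier M" "g x = \<zero>\<^bsub>N\<^esub>"
    then have "(x, \<zero>\<^bsub>N\<^esub>) \<in> H" using g(2) by auto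
    then show "x = \<zero>\<^bsub>M\<^esub>" using functional_zeroD[OF H'(3)] by blast
  qed
  moreover have "g ` carrier M = carrier N"
  proof
    show "g ` carrier M \<subseteq> carrier N" using mod_linD(1)[OF g(1)] by blast
    show "carrier N \<subseteq> g ` carrier M"
    proof
      fix y assume "y \<in> carrier N"
      then obtain x where xy: "(x, y) \<in> H" using ran by blast
      have "x \<in> carrier M" using submod_onD(2)[OF H'(1) xy] by simp
      then show "y \<in> g ` carrier M" using g(2) xy by blast
    qed
  qed
  ultimately show ?thesis
    using g(1) by (auto simp: mod_isomorphic_def mod_lin_iff_mod_hom bij_betw_def)
qed

text \<open>The cover may have fewer than \<open>\<mu>\<close> members; as it is nonempty it can
  still be enumerated, with repetitions, along \<open>\<mu>\<close>.\<close>

lemma tower_enum: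
  assumes t: "tower \<mu> F M"
  obtains a where "\<And>i. i \<in> Field \<mu> \<Longrightarrow> a i \<in> F" "carrier M = (\<Union>i\<in>Field \<mu>. carrier (a i))"
proof -
  obtain A where A: "A \<subseteq> F" "|A| \<le>o \<mu>" "carrier M = (\<Union>N\<in>A. carrier N)" using towerD(8)[OF t] by blast
  interpret M: left_module R M using towerD(1)[OF t] .
  have "A \<noteq> {}" using A(3) M.M.zero_closed by auto
  moreover have "|A| \<le>o |Field \<mu>|"
    using ordLeq_ordIso_trans[OF A(2) ordIso_symmetric[OF card_of_Field_ordIso]] towerD(2)[OF t] by blast
  ultimately have "\<exists>a. a ` Field \<mu> = A" by (simp add: card_of_ordLeq2)
  then obtain a where "a ` Field \<mu> = A" by blast
  then show thesis using that[of a] A by blast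
qed

text \<open>Back-and-forth of length \<open>\<mu>\<close>. An initial segment has fewer than
  \<open>\<mu>\<close> steps, so by directedness the union of the earlier graphs is bounded in both
  towers and can be extended once more; after \<open>\<mu>\<close> steps the covering members
  \<open>a i\<close> and \<open>b i\<close> are all absorbed. Both towers must have the same
  \<open>\<mu>\<close> for the two counts to fit.\<close>

lemma tower_isomorphic:
  assumes tM: "tower \<mu> F M" and tN: "tower \<mu> G N"
  shows "mod_isomorphic R M N"
proof -
  have M: "left_module R M" and N: "left_module R N" using towerD(1) tM tN by blast+
  interpret N: left_module R N by fact
  obtain a where a: "\<And>i. i \<in> Field \<mu> \<Longrightarrow> a i \<in> F" "carrier M = (\<Union>i\<in>Field \<mu>. carrier (a i))"
    using tower_enum[OF tM] by blast
  obtain b where b: "\<And>i. i \<in> Field \<mu> \<Longrightarrow> b i \<in> G" "carrier N = (\<Union>i\<in>Field \<mu>. carrier (b i))"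
    using tower_enum[OF tN] by blast
  have C\<mu>: "Card_order \<mu>" using towerD(2)[OF tM] by blast
  have W\<mu>: "Well_order \<mu>" using card_order_on_well_order_on[OF C\<mu>] .
  \<comment> \<open>The zero isomorphism is put into every stage, so that the union of the earlier
    stages is nonempty already at the least index.\<close>
  define Z where "Z = {(\<zero>\<^bsub>M\<^esub>, \<zero>\<^bsub>N\<^esub>)}"
  have Z: "partial_iso M N Z"
    using submod_on_zero[OF left_module_prod_mod[OF M N]] by (auto simp: partial_iso_def Z_def functional_def)
  define Q where "Q f i H \<longleftrightarrow> partial_iso M N H \<and> bounded_in F G H \<and> (\<forall>j\<in>underS \<mu> i. f j \<subseteq> H) \<and> Z \<subseteq> H \<and>
    carrier (a i) \<subseteq> Domain H \<and> carrier (b i) \<subseteq> Range H" for f i H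
  have lin: "j \<in> underS \<mu> i \<or> i \<in> underS \<mu> j \<or> i = j" if "i \<in> Field \<mu>" "j \<in> Field \<mu>" for i j
    using Well_orderD(4)[OF W\<mu> that] by (auto simp: underS_def)
  have chain: "f i \<subseteq> f j \<or> f j \<subseteq> f i"
    if "\<And>k. k \<in> I \<Longrightarrow> Q f k (f k)" "I \<subseteq> Field \<mu>" "i \<in> I" "j \<in> I" for f I i j
    using lin[of i j] that unfolding Q_def by blast
  obtain f where f: "\<And>i. i \<in> Field \<mu> \<Longrightarrow> Q f i (f i)"
  proof (rule well_order_choice[OF W\<mu>, of Q])
    show "Q g i H" if "\<And>j. j \<in> underS \<mu> i \<Longrightarrow> f j = g j" "Q f i H" for i f g H
      using that unfolding Q_def by metis
  next
    fix i f assume i: "i \<in> Field \<mu>" and Qf: "\<And>j. j \<in> underS \<mu> i \<Longrightarrow> Q f j (f j)"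
    have uF: "underS \<mu> i \<subseteq> Field \<mu>" by (auto simp: underS_def Field_def)
    have u\<mu>: "|underS \<mu> i| <o \<mu>" using card_of_underS[OF C\<mu> i] .
    define U where "U = \<Union>(insert Z (f ` underS \<mu> i))"
    have "partial_iso M N U"
      unfolding U_def
    proof (rule partial_iso_Union_chain)
      fix S T assume "S \<in> insert Z (f ` underS \<mu> i)" "T \<in> insert Z (f ` underS \<mu> i)"
      then show "S \<subseteq> T \<or> T \<subseteq> S"
        using chain[OF Qf uF] Qf unfolding Q_def by blast
    qed (use Z Qf in \<open>auto simp: Q_def\<close>)
    moreover have "bounded_in F G U"
      unfolding bounded_in_def
    proof
      obtain N0 where N0: "N0 \<in> F" using tower_nonempty[OF tM] by blast
      obtain N1 where N1: "N1 \<in> F" "\<And>j. j \<in> underS \<mu> i \<Longrightarrow> Domain (f j) \<subseteq> carrier N1"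
        using tower_bounded[OF tM u\<mu>, of "\<lambda>j. Domain (f j)"] Qf unfolding Q_def bounded_in_def by blast
      moreover have "\<zero>\<^bsub>M\<^esub> \<in> carrier N1"
        using submod_onD(3)[OF submod_on_carrier[OF towerD(4)[OF tM N1(1)]]] .
      ultimately show "\<exists>N\<in>F. Domain U \<subseteq> carrier N" by (fastforce simp: U_def Z_def)
      obtain K1 where K1: "K1 \<in> G" "\<And>j. j \<in> underS \<mu> i \<Longrightarrow> Range (f j) \<subseteq> carrier K1"
        using tower_bounded[OF tN u\<mu>, of "\<lambda>j. Range (f j)"] Qf unfolding Q_def bounded_in_def by blast
      moreover have "\<zero>\<^bsub>N\<^esub> \<in> carrier K1"
        using submod_onD(3)[OF submod_on_carrier[OF towerD(4)[OF tN K1(1)]]] .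
      ultimately show "\<exists>K\<in>G. Range U \<subseteq> carrier K" by (fastforce simp: U_def Z_def)
    qed
    ultimately obtain H where "U \<subseteq> H" "partial_iso M N H" "bounded_in F G H" "carrier (a i) \<subseteq> Domain H"
      "carrier (b i) \<subseteq> Range H"
      using partial_iso_extend_both[OF tM tN _ _ a(1)[OF i] b(1)[OF i]] by blast
    then show "\<exists>H. Q f i H" unfolding Q_def U_def by blast
  qed (use that in blast)
  have fab: "carrier (a i) \<subseteq> Domain (f i)" "carrier (b i) \<subseteq> Range (f i)" if "i \<in> Field \<mu>" for i
    using f[OF that] by (auto simp: Q_def)
  have ne: "Field \<mu> \<noteq> {}" using towerD(2)[OF tM] by (auto simp: cinfinite_def)
  have "partial_iso M N (\<Union>(f ` Field \<mu>))"
  proof (rule partial_iso_Union_chain)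
    show "S \<subseteq> T \<or> T \<subseteq> S" if "S \<in> f ` Field \<mu>" "T \<in> f ` Field \<mu>" for S T
      using chain[OF f subset_refl] that by blast
  qed (use ne f in \<open>auto simp: Q_def\<close>)
  moreover have "carrier M \<subseteq> Domain (\<Union>(f ` Field \<mu>))"
  proof
    fix x assume "x \<in> carrier M"
    then obtain i where "i \<in> Field \<mu>" "x \<in> carrier (a i)" using a(2) by auto
    then show "x \<in> Domain (\<Union>(f ` Field \<mu>))" using subsetD[OF fab(1)] by blast
  qed
  moreover have "carrier N \<subseteq> Range (\<Union>(f ` Field \<mu>))"
  proof
    fix x assume "x \<in> carrier N"
    then obtain i where "i \<in> Field \<mu>" "x \<in> carrier (b i)" using b(2) by auto
    then show "x \<in> Range (\<Union>(f ` Field \<mu>))" using subsetD[OF fab(2)] by blast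
  qed
  ultimately show ?thesis using partial_iso_total[OF M N] by blast
qed

end

subsection \<open>Left ideals and extension of homomorphisms\<close>

lemma left_ideal_iff_submod_on:
  assumes "ring R" shows "left_ideal I R \<longleftrightarrow> submod_on R (reg_mod R) I"
proof -
  interpret ring R by fact
  show ?thesis
  proof
    assume "left_ideal I R"
    then have sg: "subgroup I (add_monoid R)" and sm: "\<And>r a. r \<in> carrier R \<Longrightarrow> a \<in> I \<Longrightarrow> r \<otimes>\<^bsub>R\<^esub> a \<in> I"
      by (auto simp: left_ideal_def additive_subgroup_def)
    show "submod_on R (reg_mod R) I"
      using subgroup.subset[OF sg] subgroup.m_closed[OF sg] subgroup.one_closed[OF sg] sm
      by (intro submod_onI) auto
  next
    assume I: "submod_on R (reg_mod R) I"
    have "\<ominus>\<^bsub>R\<^esub> x \<in> I" if "x \<in> I" for x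
    proof -
      have "(\<ominus>\<^bsub>R\<^esub> \<one>\<^bsub>R\<^esub>) \<otimes>\<^bsub>R\<^esub> x \<in> I" using submod_onD(5)[OF I _ that, of "\<ominus>\<^bsub>R\<^esub> \<one>\<^bsub>R\<^esub>"] by simp
      then show ?thesis using submod_onD(2)[OF I that] by (simp add: l_minus)
    qed
    then have "subgroup I (add_monoid R)"
      using submod_onD[OF I] by (intro subgroup.intro) (auto simp: a_inv_def)
    then show "left_ideal I R"
      using submod_onD(5)[OF I] by (auto simp: left_ideal_def additive_subgroup_def)
  qed
qed

lemma gen_left_ideal_least:
  assumes "ring R" "submod_on R (reg_mod R) I" "S \<subseteq> I" shows "gen_left_ideal R S \<subseteq> I"
  using assms left_ideal_iff_submod_on[OF assms(1)] by (auto simp: gen_left_ideal_def)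

lemma gen_left_ideal_superset: "S \<subseteq> gen_left_ideal R S"
  by (auto simp: gen_left_ideal_def)

lemma gen_left_ideal_mono: "S \<subseteq> T \<Longrightarrow> gen_left_ideal R S \<subseteq> gen_left_ideal R T"
  by (auto simp: gen_left_ideal_def)

lemma submod_on_gen_left_ideal:
  assumes R: "ring R" and S: "S \<subseteq> carrier R" shows "submod_on R (reg_mod R) (gen_left_ideal R S)"
proof -
  interpret ring R by fact
  have c: "submod_on R (reg_mod R) (carrier R)" by (rule submod_onI) auto
  have in_gen: "x \<in> gen_left_ideal R S \<longleftrightarrow> (\<forall>I. submod_on R (reg_mod R) I \<and> S \<subseteq> I \<longrightarrow> x \<in> I)" for x
    using left_ideal_iff_submod_on[OF R] by (auto simp: gen_left_ideal_def)
  show ?thesis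
  proof (rule submod_onI)
    show "x \<in> carrier (reg_mod R)" if "x \<in> gen_left_ideal R S" for x
      using gen_left_ideal_least[OF R c S] that by auto
    have *: "x \<in> I" if "x \<in> gen_left_ideal R S" "submod_on R (reg_mod R) I \<and> S \<subseteq> I" for x I
      using that in_gen by blast
    show "\<zero>\<^bsub>reg_mod R\<^esub> \<in> gen_left_ideal R S"
      unfolding in_gen using submod_onD(3)[of R "reg_mod R"] by blast
    show "x \<oplus>\<^bsub>reg_mod R\<^esub> y \<in> gen_left_ideal R S" if "x \<in> gen_left_ideal R S" "y \<in> gen_left_ideal R S" for x y
      unfolding in_gen
    proof (intro allI impI)
      fix I assume I: "submod_on R (reg_mod R) I \<and> S \<subseteq> I"
      show "x \<oplus>\<^bsub>reg_mod R\<^esub> y \<in> I"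
        by (rule submod_onD(4)[OF conjunct1[OF I] *[OF that(1) I] *[OF that(2) I]])
    qed
    show "r \<odot>\<^bsub>reg_mod R\<^esub> x \<in> gen_left_ideal R S" if "r \<in> carrier R" "x \<in> gen_left_ideal R S" for r x
      unfolding in_gen
    proof (intro allI impI)
      fix I assume I: "submod_on R (reg_mod R) I \<and> S \<subseteq> I"
      show "r \<odot>\<^bsub>reg_mod R\<^esub> x \<in> I" by (rule submod_onD(5)[OF conjunct1[OF I] that(1) *[OF that(2) I]])
    qed
  qed
qed

text \<open>Baer's criterion serves as the definition: \<open>H\<close> is the graph of a
  homomorphism from a left ideal, its \<open>Domain\<close>, and \<open>m\<close> is the value at 1
  of an extension to the ring. This avoids quantifying over modules of arbitrary element
  types.\<close>

definition baer_injective :: "('r, 'x) ring_scheme \<Rightarrow> ('r, 'a) module \<Rightarrow> bool" where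
  "baer_injective R M \<longleftrightarrow> (\<forall>H. submod_on R (prod_mod (reg_mod R) M) H \<longrightarrow> functional (reg_mod R) M H \<longrightarrow>
     (\<exists>m\<in>carrier M. \<forall>(r, y)\<in>H. y = r \<odot>\<^bsub>M\<^esub> m))"

text \<open>To choose a value for \<open>x\<close>, consider the left ideal of all \<open>r\<close>
  with \<open>r x\<close> in the domain of \<open>G\<close>. On it \<open>L\<close> is the
  homomorphism that sends \<open>r\<close> to the value of \<open>G\<close> at \<open>r x\<close>,
  so an \<open>m\<close> that realises \<open>L\<close> is compatible with \<open>G\<close>, and
  \<open>G\<close> plus the multiples of \<open>(x, m)\<close> stays functional.\<close>

lemma baer_extension_step:
  fixes K :: "('r, 'b) module" and M :: "('r, 'a) module"
  assumes K: "left_module R K" and M: "left_module R M" and inj: "baer_injective R M"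
    and G: "submod_on R (prod_mod K M) G" "functional K M G" and x: "x \<in> carrier K"
  obtains G' where "G \<subseteq> G'" "submod_on R (prod_mod K M) G'" "functional K M G'" "x \<in> Domain G'"
proof -
  interpret K: left_module R K by fact
  interpret M: left_module R M by fact
  note P = left_module_prod_mod[OF K M]
  define L where "L = {(r, y). r \<in> carrier R \<and> (r \<odot>\<^bsub>K\<^esub> x, y) \<in> G}"
  have L: "submod_on R (prod_mod (reg_mod R) M) L"
  proof (rule submod_onI)
    fix p q assume "p \<in> L" "q \<in> L"
    then obtain r y r' y' where *: "p = (r, y)" "q = (r', y')" "r \<in> carrier R" "r' \<in> carrier R"
      "(r \<odot>\<^bsub>K\<^esub> x, y) \<in> G" "(r' \<odot>\<^bsub>K\<^esub> x, y') \<in> G" by (auto simp: L_def)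
    show "p \<oplus>\<^bsub>prod_mod (reg_mod R) M\<^esub> q \<in> L"
      using submod_onD(4)[OF G(1) *(5,6)] * x by (simp add: L_def K.smult_l_distr)
  next
    fix r p assume r: "r \<in> carrier R" and "p \<in> L"
    then obtain r' y where *: "p = (r', y)" "r' \<in> carrier R" "(r' \<odot>\<^bsub>K\<^esub> x, y) \<in> G" by (auto simp: L_def)
    show "r \<odot>\<^bsub>prod_mod (reg_mod R) M\<^esub> p \<in> L"
      using submod_onD(5)[OF G(1) r *(3)] * r x by (simp add: L_def K.smult_assoc1)
  next
    show "\<zero>\<^bsub>prod_mod (reg_mod R) M\<^esub> \<in> L" using submod_onD(3)[OF G(1)] x by (simp add: L_def)
    show "p \<in> carrier (prod_mod (reg_mod R) M)" if "p \<in> L" for p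
      using that submod_onD(2)[OF G(1)] by (auto simp: L_def)
  qed
  have "functional (reg_mod R) M L"
    using functional_zeroD[OF G(2)] x by (auto simp: functional_def L_def)
  then obtain m where m: "m \<in> carrier M" "\<And>r y. (r, y) \<in> L \<Longrightarrow> y = r \<odot>\<^bsub>M\<^esub> m"
    using inj L unfolding baer_injective_def by blast
  define G' where "G' = {(d \<oplus>\<^bsub>K\<^esub> r \<odot>\<^bsub>K\<^esub> x, e \<oplus>\<^bsub>M\<^esub> r \<odot>\<^bsub>M\<^esub> m) |d e r. (d, e) \<in> G \<and> r \<in> carrier R}"
  have G'I: "(d \<oplus>\<^bsub>K\<^esub> r \<odot>\<^bsub>K\<^esub> x, e \<oplus>\<^bsub>M\<^esub> r \<odot>\<^bsub>M\<^esub> m) \<in> G'" if "(d, e) \<in> G" "r \<in> carrier R" for d e r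
    using that by (auto simp: G'_def)
  have Gc: "d \<in> carrier K" "e \<in> carrier M" if "(d, e) \<in> G" for d e using submod_onD(2)[OF G(1) that] by auto
  have zG: "(\<zero>\<^bsub>K\<^esub>, \<zero>\<^bsub>M\<^esub>) \<in> G" using submod_onD(3)[OF G(1)] by simp
  show thesis
  proof (rule that)
    show "G \<subseteq> G'"
    proof (rule subrelI)
      fix d e assume de: "(d, e) \<in> G"
      show "(d, e) \<in> G'" using G'I[OF de K.R.zero_closed] Gc[OF de] x m(1) by simp
    qed
    show "x \<in> Domain G'" using G'I[OF zG K.R.one_closed] x by (auto simp: K.smult_one)
    show "submod_on R (prod_mod K M) G'"
    proof (rule submod_onI)
      fix p assume "p \<in> G'"
      then show "p \<in> carrier (prod_mod K M)" using Gc x m(1) by (auto simp: G'_def K.smult_closed M.smult_closed)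
    next
      show "\<zero>\<^bsub>prod_mod K M\<^esub> \<in> G'" using G'I[OF zG K.R.zero_closed] x m(1) by simp
    next
      fix p q assume "p \<in> G'" "q \<in> G'"
      then obtain d e r d' e' r' where *: "(d, e) \<in> G" "r \<in> carrier R" "(d', e') \<in> G" "r' \<in> carrier R"
        "p = (d \<oplus>\<^bsub>K\<^esub> r \<odot>\<^bsub>K\<^esub> x, e \<oplus>\<^bsub>M\<^esub> r \<odot>\<^bsub>M\<^esub> m)" "q = (d' \<oplus>\<^bsub>K\<^esub> r' \<odot>\<^bsub>K\<^esub> x, e' \<oplus>\<^bsub>M\<^esub> r' \<odot>\<^bsub>M\<^esub> m)"
        by (auto simp: G'_def)
      have "(d \<oplus>\<^bsub>K\<^esub> d', e \<oplus>\<^bsub>M\<^esub> e') \<in> G" using submod_onD(4)[OF G(1) *(1,3)] by simp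
      from G'I[OF this K.R.add.m_closed[OF *(2,4)]] show "p \<oplus>\<^bsub>prod_mod K M\<^esub> q \<in> G'"
        using * Gc[OF *(1)] Gc[OF *(3)] x m(1)
        by (simp add: K.smult_l_distr M.smult_l_distr K.smult_closed M.smult_closed K.M.add.m_ac M.M.add.m_ac)
    next
      fix a p assume a: "a \<in> carrier R" and "p \<in> G'"
      then obtain d e r where *: "(d, e) \<in> G" "r \<in> carrier R"
        "p = (d \<oplus>\<^bsub>K\<^esub> r \<odot>\<^bsub>K\<^esub> x, e \<oplus>\<^bsub>M\<^esub> r \<odot>\<^bsub>M\<^esub> m)"
        by (auto simp: G'_def)
      have "(a \<odot>\<^bsub>K\<^esub> d, a \<odot>\<^bsub>M\<^esub> e) \<in> G" using submod_onD(5)[OF G(1) a *(1)] by simp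
      from G'I[OF this K.R.m_closed[OF a *(2)]] show "a \<odot>\<^bsub>prod_mod K M\<^esub> p \<in> G'"
        using * Gc[OF *(1)] x m(1) a
        by (simp add: K.smult_r_distr M.smult_r_distr K.smult_closed M.smult_closed K.smult_assoc1 M.smult_assoc1)
    qed
    show "functional K M G'"
      unfolding functional_def
    proof (intro allI impI)
      fix y assume "(\<zero>\<^bsub>K\<^esub>, y) \<in> G'"
      then obtain d e r where *: "(d, e) \<in> G" "r \<in> carrier R" "\<zero>\<^bsub>K\<^esub> = d \<oplus>\<^bsub>K\<^esub> r \<odot>\<^bsub>K\<^esub> x" "y = e \<oplus>\<^bsub>M\<^esub> r \<odot>\<^bsub>M\<^esub> m"
        by (auto simp: G'_def)
      note c = Gc[OF *(1)] K.smult_closed[OF *(2) x] M.smult_closed[OF *(2) m(1)]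
      have neg: "(\<ominus>\<^bsub>K\<^esub> d, \<ominus>\<^bsub>M\<^esub> e) \<in> G"
        using submod_onD(5)[OF G(1) _ *(1), of "\<ominus>\<^bsub>R\<^esub> \<one>\<^bsub>R\<^esub>"] c by (simp add: K.smult_minus_one M.smult_minus_one)
      have "r \<odot>\<^bsub>K\<^esub> x \<oplus>\<^bsub>K\<^esub> d = \<zero>\<^bsub>K\<^esub>" using *(3) c K.M.add.m_comm by simp
      then have "r \<odot>\<^bsub>K\<^esub> x = \<ominus>\<^bsub>K\<^esub> d" using K.M.minus_equality[of "r \<odot>\<^bsub>K\<^esub> x" d] c by simp
      then have "(r, \<ominus>\<^bsub>M\<^esub> e) \<in> L" using neg *(2) by (simp add: L_def)
      then have "\<ominus>\<^bsub>M\<^esub> e = r \<odot>\<^bsub>M\<^esub> m" using m(2) by blast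
      then show "y = \<zero>\<^bsub>M\<^esub>" using *(4) c M.M.r_neg by metis
    qed
  qed
qed

text \<open>Zorn's lemma over the functional submodules above \<open>H\<close>; a maximal one is
  defined everywhere by the one-element step.\<close>

lemma baer_injective_extend:
  fixes K :: "('r, 'b) module" and M :: "('r, 'a) module"
  assumes K: "left_module R K" and M: "left_module R M" and inj: "baer_injective R M"
    and H: "submod_on R (prod_mod K M) H" "functional K M H"
  obtains g where "mod_lin R K M g" "\<And>x y. (x, y) \<in> H \<Longrightarrow> g x = y"
proof -
  define \<A> where "\<A> = {G. H \<subseteq> G \<and> submod_on R (prod_mod K M) G \<and> functional K M G}"
  have "\<exists>G\<in>\<A>. \<forall>X\<in>\<A>. G \<subseteq> X \<longrightarrow> X = G"
  proof (rule subset_Zorn_nonempty)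
    show "\<A> \<noteq> {}" using H by (auto simp: \<A>_def)
    fix \<C> assume ne: "\<C> \<noteq> {}" and ch: "subset.chain \<A> \<C>"
    have sub: "\<C> \<subseteq> \<A>" and lin: "\<And>S T. S \<in> \<C> \<Longrightarrow> T \<in> \<C> \<Longrightarrow> S \<subseteq> T \<or> T \<subseteq> S"
      using ch by (auto simp: subset.chain_def)
    have "submod_on R (prod_mod K M) (\<Union>\<C>)"
      by (rule submod_on_Union_chain[OF ne _ lin]) (use sub in \<open>auto simp: \<A>_def\<close>)
    moreover have "functional K M (\<Union>\<C>)" using sub by (auto simp: \<A>_def functional_def)
    moreover have "H \<subseteq> \<Union>\<C>" using ne sub by (auto simp: \<A>_def)
    ultimately show "\<Union>\<C> \<in> \<A>" by (simp add: \<A>_def)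
  qed
  then obtain G where "G \<in> \<A>" and max: "\<And>X. X \<in> \<A> \<Longrightarrow> G \<subseteq> X \<Longrightarrow> X = G" by blast
  then have G: "H \<subseteq> G" "submod_on R (prod_mod K M) G" "functional K M G" by (auto simp: \<A>_def)
  have "carrier K \<subseteq> Domain G"
  proof
    fix x assume "x \<in> carrier K"
    then obtain G' where G': "G \<subseteq> G'" "submod_on R (prod_mod K M) G'" "functional K M G'" "x \<in> Domain G'"
      using baer_extension_step[OF K M inj G(2,3)] by blast
    then have "G' \<in> \<A>" using G(1) by (auto simp: \<A>_def)
    then show "x \<in> Domain G" using max[OF _ G'(1)] G'(4) by simp
  qed
  then obtain g where g: "mod_lin R K M g" "\<And>x y. x \<in> carrier K \<Longrightarrow> (x, y) \<in> G \<longleftrightarrow> y = g x"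
    using functional_obtains_lin[OF K M G(2,3)] by blast
  show thesis
  proof (rule that[OF g(1)])
    fix x y assume "(x, y) \<in> H"
    then have "(x, y) \<in> G" "x \<in> carrier K" using G(1) submod_onD(2)[OF H(1)] by auto
    then show "g x = y" using g(2)[of x y] by simp
  qed
qed

context module_universe
begin

text \<open>A homomorphism on the ring is multiplication by its value \<open>m\<close> at 1. The
  second conclusion is the exactness of the pushout: multiples of \<open>m\<close> reach
  \<open>N\<close> only where \<open>H\<close> requires it. The diagonal argument for non-extendable
  homomorphisms depends on it.\<close>

lemma tower_graph_extend:
  assumes t: "tower \<mu> F M" and N: "N \<in> F" and H: "submod_on R (prod_mod (reg_mod R) M) H"
    "functional (reg_mod R) M H" "Range H \<subseteq> carrier N"
  shows "\<exists>m\<in>carrier M. (\<forall>(r, y)\<in>H. y = r \<odot>\<^bsub>M\<^esub> m) \<and>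
    (\<forall>r\<in>carrier R. r \<odot>\<^bsub>M\<^esub> m \<in> carrier N \<longrightarrow> (r, r \<odot>\<^bsub>M\<^esub> m) \<in> H)"
proof -
  interpret R: ring R by (rule ring)
  obtain N' where N': "N' \<in> F" "universal_over R N' N" using towerD(6)[OF t N] by blast
  note sN = towerD(4)[OF t N] and sN' = towerD(4)[OF t N'(1)]
  have RR: "left_module R (reg_mod R)" using left_module_reg_mod[OF ring] .
  have HN: "submod_on R (prod_mod (reg_mod R) N) H"
  proof (rule submod_on_restrict_module[OF submod_of_prod_mod[OF submod_of_refl[OF RR] sN] H(1)])
    show "H \<subseteq> carrier (prod_mod (reg_mod R) N)"
    proof (rule subrelI)
      fix r y assume "(r, y) \<in> H"
      then show "(r, y) \<in> carrier (prod_mod (reg_mod R) N)" using H(3) submod_onD(2)[OF H(1)] by auto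
    qed
  qed
  obtain g where g: "mod_lin R (reg_mod R) N' g"
    "\<And>r y. r \<in> carrier R \<Longrightarrow> y \<in> carrier N \<Longrightarrow> g r = y \<longleftrightarrow> (r, y) \<in> H"
  proof (rule universal_over_extend[OF N'(2) towerD(5)[OF t N'(1)] RR _ HN])
    show "|carrier (reg_mod R)| \<le>o lam" using card_R by simp
    show "y = \<zero>\<^bsub>N\<^esub>" if "(\<zero>\<^bsub>reg_mod R\<^esub>, y) \<in> H" for y
      using functional_zeroD[OF H(2) that] submod_of_zero[OF sN] by simp
  qed (use that in auto)
  have g1: "g \<one>\<^bsub>R\<^esub> \<in> carrier N'" using mod_linD(1)[OF g(1)] by simp
  have gr: "g r = r \<odot>\<^bsub>M\<^esub> g \<one>\<^bsub>R\<^esub>" if "r \<in> carrier R" for r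
    using mod_linD(3)[OF g(1) that, of "\<one>\<^bsub>R\<^esub>"] submod_ofD(6)[OF sN' that g1] that by simp
  show ?thesis
  proof (intro bexI[of _ "g \<one>\<^bsub>R\<^esub>"] conjI ballI impI)
    show "g \<one>\<^bsub>R\<^esub> \<in> carrier M" using submod_ofD(4)[OF sN' g1] .
    show "case p of (r, y) \<Rightarrow> y = r \<odot>\<^bsub>M\<^esub> g \<one>\<^bsub>R\<^esub>" if p: "p \<in> H" for p
    proof (cases p)
      case (Pair r y)
      then have ry: "(r, y) \<in> H" using p by simp
      then have "r \<in> carrier R" "y \<in> carrier N" using submod_onD(2)[OF HN ry] by auto
      then show ?thesis using g(2)[of r y] gr[of r] ry Pair by simp
    qed
    show "(r, r \<odot>\<^bsub>M\<^esub> g \<one>\<^bsub>R\<^esub>) \<in> H" if "r \<in> carrier R" "r \<odot>\<^bsub>M\<^esub> g \<one>\<^bsub>R\<^esub> \<in> carrier N" for r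
      using g(2)[of r "r \<odot>\<^bsub>M\<^esub> g \<one>\<^bsub>R\<^esub>"] gr[of r] that by simp
  qed
qed

text \<open>The values at fewer than \<open>\<mu>\<close> generators lie in one member
  \<open>N\<close>. The elements with a value in \<open>N\<close> form a left ideal \<open>J\<close>
  containing the generators, so all values lie in \<open>N\<close> and the extension happens over
  this single member.\<close>

lemma tower_extend_lt_generated:
  assumes t: "tower \<mu> F M" and H: "submod_on R (prod_mod (reg_mod R) M) H" "functional (reg_mod R) M H"
    and S: "S \<subseteq> carrier R" "|S| <o \<mu>" and dom: "Domain H = gen_left_ideal R S"
  shows "\<exists>m\<in>carrier M. \<forall>(r, y)\<in>H. y = r \<odot>\<^bsub>M\<^esub> m"
proof -
  have RR: "left_module R (reg_mod R)" using left_module_reg_mod[OF ring] .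
  have M: "left_module R M" using towerD(1)[OF t] .
  have "\<forall>s\<in>S. \<exists>y. (s, y) \<in> H" using dom gen_left_ideal_superset[of S R] by blast
  from bchoice[OF this] obtain y where y: "\<And>s. s \<in> S \<Longrightarrow> (s, y s) \<in> H" by blast
  have "\<exists>N\<in>F. {y s} \<subseteq> carrier N" if s: "s \<in> S" for s
  proof -
    have "y s \<in> carrier M" using submod_onD(2)[OF H(1) y[OF s]] by simp
    then obtain N where "N \<in> F" "y s \<in> carrier N" using tower_element[OF t] by blast
    then show ?thesis by blast
  qed
  then obtain N where N: "N \<in> F" "\<And>s. s \<in> S \<Longrightarrow> {y s} \<subseteq> carrier N"
    using tower_bounded[OF t S(2), of "\<lambda>s. {y s}"] by blast
  note cN = submod_onD[OF submod_on_carrier[OF towerD(4)[OF t N(1)]]]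
  define J where "J = {r. \<exists>y\<in>carrier N. (r, y) \<in> H}"
  have "submod_on R (reg_mod R) J"
  proof (rule submod_onI)
    fix r r' assume "r \<in> J" "r' \<in> J"
    then obtain u v where *: "u \<in> carrier N" "v \<in> carrier N" "(r, u) \<in> H" "(r', v) \<in> H" by (auto simp: J_def)
    show "r \<oplus>\<^bsub>reg_mod R\<^esub> r' \<in> J" using submod_onD(4)[OF H(1) *(3,4)] cN(4)[OF *(1,2)] by (auto simp: J_def)
  next
    fix a r assume a: "a \<in> carrier R" and "r \<in> J"
    then obtain u where *: "u \<in> carrier N" "(r, u) \<in> H" by (auto simp: J_def)
    show "a \<odot>\<^bsub>reg_mod R\<^esub> r \<in> J" using submod_onD(5)[OF H(1) a *(2)] cN(5)[OF a *(1)] by (auto simp: J_def)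
  next
    show "\<zero>\<^bsub>reg_mod R\<^esub> \<in> J" using submod_onD(3)[OF H(1)] cN(3) by (auto simp: J_def)
    show "r \<in> carrier (reg_mod R)" if "r \<in> J" for r using that submod_onD(2)[OF H(1)] by (auto simp: J_def)
  qed
  moreover have "S \<subseteq> J" using y N(2) by (auto simp: J_def)
  ultimately have dJ: "Domain H \<subseteq> J" unfolding dom by (rule gen_left_ideal_least[OF ring])
  have ran: "Range H \<subseteq> carrier N"
  proof
    fix v assume "v \<in> Range H"
    then obtain r where rv: "(r, v) \<in> H" by blast
    then have "r \<in> J" using dJ by blast
    then obtain u where "u \<in> carrier N" "(r, u) \<in> H" by (auto simp: J_def)
    then show "v \<in> carrier N" using functionalD[OF RR M H rv] by metis
  qed
  show ?thesis
    using tower_graph_extend[OF t N(1) H ran] by blast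
qed

lemma tower_baer_injective:
  assumes t: "tower \<mu> F M" and noeth: "left_lt_noetherian \<gamma> R" and le: "\<gamma> \<le>o \<mu>"
  shows "baer_injective R M"
  unfolding baer_injective_def
proof (intro allI impI)
  fix H assume H: "submod_on R (prod_mod (reg_mod R) M) H" "functional (reg_mod R) M H"
  have "submod_on R (reg_mod R) (Domain H)"
  proof (rule submod_onI)
    fix r r' assume "r \<in> Domain H" "r' \<in> Domain H"
    then obtain u v where "(r, u) \<in> H" "(r', v) \<in> H" by blast
    from submod_onD(4)[OF H(1) this] show "r \<oplus>\<^bsub>reg_mod R\<^esub> r' \<in> Domain H" by auto
  next
    fix a r assume a: "a \<in> carrier R" and "r \<in> Domain H"
    then obtain u where "(r, u) \<in> H" by blast
    from submod_onD(5)[OF H(1) a this] show "a \<odot>\<^bsub>reg_mod R\<^esub> r \<in> Domain H" by auto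
  next
    show "\<zero>\<^bsub>reg_mod R\<^esub> \<in> Domain H" using submod_onD(3)[OF H(1)] by auto
    show "r \<in> carrier (reg_mod R)" if "r \<in> Domain H" for r using that submod_onD(2)[OF H(1)] by auto
  qed
  then have "left_ideal (Domain H) R" using left_ideal_iff_submod_on[OF ring] by blast
  then have "lt_generated \<gamma> R (Domain H)" using noeth by (simp add: left_lt_noetherian_def)
  then obtain S where S: "S \<subseteq> carrier R" "|S| <o \<gamma>" "Domain H = gen_left_ideal R S"
    unfolding lt_generated_def by blast
  show "\<exists>m\<in>carrier M. \<forall>(r, y)\<in>H. y = r \<odot>\<^bsub>M\<^esub> m"
    using tower_extend_lt_generated[OF t H S(1) ordLess_ordLeq_trans[OF S(2) le] S(3)] .
qed

end

section \<open>A homomorphism from a left ideal that does not extend\<close>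

context module_universe
begin

text \<open>
  Along a strictly increasing chain of left ideals \<open>K i\<close> inside \<open>I\<close>, elements \<open>a i\<close> are chosen that
  act compatibly on the ideals, so that \<open>r \<mapsto> r \<odot> a i\<close> on \<open>K i\<close> is a well defined homomorphism on the
  union; no element of the \<open>i\<close>-th member of the covering family may act like \<open>a i\<close> on \<open>K i\<close>.
\<close>

lemma tower_non_extendable:
  assumes t: "tower \<mu> F M" and I: "left_ideal I R" "\<not> lt_generated \<mu> R I"
  obtains H S where "submod_on R (prod_mod (reg_mod R) M) H" "functional (reg_mod R) M H"
    "S \<subseteq> carrier R" "|S| \<le>o \<mu>" "Domain H = gen_left_ideal R S"
    "\<not> (\<exists>m\<in>carrier M. \<forall>(r, y)\<in>H. y = r \<odot>\<^bsub>M\<^esub> m)"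
proof -
  interpret R: ring R by (rule ring)
  have RR: "left_module R (reg_mod R)" using left_module_reg_mod[OF ring] .
  have M: "left_module R M" using towerD(1)[OF t] .
  interpret M: left_module R M by fact
  have C\<mu>: "Card_order \<mu>" using towerD(2)[OF t] by blast
  have W\<mu>: "Well_order \<mu>" using card_order_on_well_order_on[OF C\<mu>] .
  have ne: "Field \<mu> \<noteq> {}" using towerD(2)[OF t] by (auto simp: cinfinite_def)
  note refl = Well_orderD(1)[OF W\<mu>] and trans = Well_orderD(2)[OF W\<mu>]
    and antisym = Well_orderD(3)[OF W\<mu>] and lin = Well_orderD(4)[OF W\<mu>]
  have uF: "j \<in> Field \<mu>" if "j \<in> underS \<mu> i" for i j using that by (auto simp: underS_def Field_def)
  have uc: "|underS \<mu> i| <o \<mu>" if "i \<in> Field \<mu>" for i using card_of_underS[OF C\<mu> that] .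
  have Isub: "submod_on R (reg_mod R) I" using I(1) left_ideal_iff_submod_on[OF ring] by blast
  have IR: "I \<subseteq> carrier R" using submod_onD(1)[OF Isub] by simp

  \<comment> \<open>No set of fewer than \<open>\<mu>\<close> elements generates \<open>I\<close>,
    so at each stage some element of \<open>I\<close> is left over; this makes the ideals
    \<open>K i\<close> strictly increasing.\<close>
  obtain s where s: "\<And>i. i \<in> Field \<mu> \<Longrightarrow> s i \<in> I \<and> s i \<notin> gen_left_ideal R (s ` underS \<mu> i)"
  proof (rule well_order_choice[OF W\<mu>, of "\<lambda>s i x. x \<in> I \<and> x \<notin> gen_left_ideal R (s ` underS \<mu> i)"])
    fix i and f g :: "_ \<Rightarrow> 'r" and x
    assume "\<And>j. j \<in> underS \<mu> i \<Longrightarrow> f j = g j" and 1: "x \<in> I \<and> x \<notin> gen_left_ideal R (f ` underS \<mu> i)"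
    then have "f ` underS \<mu> i = g ` underS \<mu> i" by auto
    then show "x \<in> I \<and> x \<notin> gen_left_ideal R (g ` underS \<mu> i)" using 1 by simp
  next
    fix i and f :: "_ \<Rightarrow> 'r" assume i: "i \<in> Field \<mu>"
      and "\<And>j. j \<in> underS \<mu> i \<Longrightarrow> f j \<in> I \<and> f j \<notin> gen_left_ideal R (f ` underS \<mu> j)"
    then have sub: "f ` underS \<mu> i \<subseteq> I" by auto
    have "|f ` underS \<mu> i| <o \<mu>" by (rule ordLeq_ordLess_trans[OF card_of_image uc[OF i]])
    moreover have "f ` underS \<mu> i \<subseteq> carrier R" using sub IR by blast
    ultimately have "I \<noteq> gen_left_ideal R (f ` underS \<mu> i)"
      using I(2) unfolding lt_generated_def by blast
    then show "\<exists>x. x \<in> I \<and> x \<notin> gen_left_ideal R (f ` underS \<mu> i)"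
      using gen_left_ideal_least[OF ring Isub sub] by blast
  qed (use that in blast)
  have sR: "s i \<in> carrier R" if "i \<in> Field \<mu>" for i using s[OF that] IR by blast

  \<comment> \<open>Generators up to and including \<open>i\<close>: \<open>K i\<close> contains
    \<open>s i\<close>, the point at which \<open>a i\<close> is separated from \<open>b i\<close>,
    while no earlier \<open>K j\<close> does.\<close>
  define K where "K i = gen_left_ideal R (s ` {j. (j, i) \<in> \<mu>})" for i
  have Ksub: "submod_on R (reg_mod R) (K i)" for i
    unfolding K_def by (rule submod_on_gen_left_ideal[OF ring]) (auto intro!: sR simp: Field_def)
  have Kmono: "K i \<subseteq> K j" if "(i, j) \<in> \<mu>" for i j
    unfolding K_def by (rule gen_left_ideal_mono) (use that trans in blast)
  have sK: "s i \<in> K i" if "i \<in> Field \<mu>" for i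
    unfolding K_def using gen_left_ideal_superset[of "s ` {j. (j, i) \<in> \<mu>}" R] refl[OF that] by blast
  have KR: "r \<in> carrier R" if "r \<in> K i" for r i using submod_onD(2)[OF Ksub that] by simp
  have snK: "s i \<notin> K j" if "i \<in> Field \<mu>" "j \<in> underS \<mu> i" for i j
  proof -
    have "{k. (k, j) \<in> \<mu>} \<subseteq> underS \<mu> i"
      using that trans antisym by (auto simp: underS_def)
    then have "K j \<subseteq> gen_left_ideal R (s ` underS \<mu> i)"
      unfolding K_def by (intro gen_left_ideal_mono image_mono)
    then show ?thesis using s[OF that(1)] by blast
  qed
  \<comment> \<open>The partial graph in each step contains the pair of zeros even when there is no
    earlier index, so \<open>s i\<close> also has to be nonzero.\<close>
  have sn0: "s i \<noteq> \<zero>\<^bsub>R\<^esub>" if "i \<in> Field \<mu>" for i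
  proof -
    have "s ` underS \<mu> i \<subseteq> carrier R" using sR uF by blast
    then have "\<zero>\<^bsub>reg_mod R\<^esub> \<in> gen_left_ideal R (s ` underS \<mu> i)"
      by (rule submod_onD(3)[OF submod_on_gen_left_ideal[OF ring]])
    then show ?thesis using s[OF that] by auto
  qed

  obtain b where b: "\<And>i. i \<in> Field \<mu> \<Longrightarrow> b i \<in> F" "carrier M = (\<Union>i\<in>Field \<mu>. carrier (b i))"
    using tower_enum[OF t] by blast
  define gr where "gr a i = (\<lambda>r. (r, r \<odot>\<^bsub>M\<^esub> a i)) ` K i" for a :: "_ \<Rightarrow> 'm" and i
  have gr_sub: "submod_on R (prod_mod (reg_mod R) M) (gr a i)" if "a i \<in> carrier M" for a i
    unfolding gr_def
    by (rule submod_onI) (use submod_onD[OF Ksub[of i]] that in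
      \<open>auto simp: M.smult_closed M.smult_l_distr M.smult_assoc1 image_iff KR\<close>)
  have gr_fun: "functional (reg_mod R) M (gr a i)" if "a i \<in> carrier M" for a i
    using that by (auto simp: functional_def gr_def)
  \<comment> \<open>The diagonal condition: \<open>x\<close> prolongs the earlier actions and
    differs at \<open>s i\<close> from every element of \<open>b i\<close>. As the
    \<open>b i\<close> cover \<open>M\<close>, no element of \<open>M\<close> can act like
    \<open>a i\<close> on \<open>K i\<close> for all \<open>i\<close>.\<close>
  define Q where "Q a i x \<longleftrightarrow> x \<in> carrier M \<and> (\<forall>j\<in>underS \<mu> i. \<forall>r\<in>K j. r \<odot>\<^bsub>M\<^esub> x = r \<odot>\<^bsub>M\<^esub> a j) \<and>
    \<not> (\<exists>m\<in>carrier (b i). s i \<odot>\<^bsub>M\<^esub> x = s i \<odot>\<^bsub>M\<^esub> m)" for a i x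
  have gr_mono: "gr a j \<subseteq> gr a k" if "j \<in> underS \<mu> k" "Q a k (a k)" for a j k
  proof -
    have "r \<in> K k \<and> r \<odot>\<^bsub>M\<^esub> a k = r \<odot>\<^bsub>M\<^esub> a j" if "r \<in> K j" for r
      using \<open>Q a k (a k)\<close> \<open>j \<in> underS \<mu> k\<close> that Kmono[of j k] by (auto simp: Q_def underS_def)
    then show ?thesis by (fastforce simp: gr_def)
  qed
  have gr_chain: "gr a j \<subseteq> gr a k \<or> gr a k \<subseteq> gr a j"
    if "\<And>i. i \<in> J \<Longrightarrow> Q a i (a i)" "J \<subseteq> Field \<mu>" "j \<in> J" "k \<in> J" for a J j k
    using lin[of j k] gr_mono[of j k a] gr_mono[of k j a] that by (cases "j = k") (auto simp: underS_def)

  obtain a where a: "\<And>i. i \<in> Field \<mu> \<Longrightarrow> Q a i (a i)"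
  proof (rule well_order_choice[OF W\<mu>, of Q])
    show "Q g i x" if "\<And>j. j \<in> underS \<mu> i \<Longrightarrow> f j = g j" "Q f i x" for i f g x
      using that(2) that(1)[symmetric] by (simp add: Q_def)
  next
    fix i a assume i: "i \<in> Field \<mu>" and Qa: "\<And>j. j \<in> underS \<mu> i \<Longrightarrow> Q a j (a j)"
    have aM: "a j \<in> carrier M" if "j \<in> underS \<mu> i" for j using Qa[OF that] by (simp add: Q_def)
    define Z where "Z = {(\<zero>\<^bsub>R\<^esub>, \<zero>\<^bsub>M\<^esub>)}"
    define H where "H = \<Union>(insert Z (gr a ` underS \<mu> i))"
    have Zgr: "Z \<subseteq> gr a j" if "j \<in> underS \<mu> i" for j
      using submod_onD(3)[OF gr_sub[of a j, OF aM[OF that]]] by (simp add: Z_def)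
    have H1: "submod_on R (prod_mod (reg_mod R) M) H"
      unfolding H_def
    proof (rule submod_on_Union_chain)
      show "submod_on R (prod_mod (reg_mod R) M) S" if "S \<in> insert Z (gr a ` underS \<mu> i)" for S
        using that gr_sub[OF aM] submod_on_zero[OF left_module_prod_mod[OF RR M]] by (auto simp: Z_def)
      show "S \<subseteq> T \<or> T \<subseteq> S" if "S \<in> insert Z (gr a ` underS \<mu> i)" "T \<in> insert Z (gr a ` underS \<mu> i)" for S T
        using that gr_chain[of "underS \<mu> i" a, OF Qa] uF Zgr by blast
    qed simp
    have H2: "functional (reg_mod R) M H"
      using gr_fun[OF aM] by (auto simp: H_def functional_def Z_def)
    have "\<exists>N\<in>F. {a j} \<subseteq> carrier N" if j: "j \<in> underS \<mu> i" for j
    proof -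
      obtain N where "N \<in> F" "a j \<in> carrier N" using tower_element[OF t aM[OF j]] by blast
      then show ?thesis by blast
    qed
    then obtain N0 where N0: "N0 \<in> F" "\<And>j. j \<in> underS \<mu> i \<Longrightarrow> {a j} \<subseteq> carrier N0"
      using tower_bounded[OF t uc[OF i], of "\<lambda>j. {a j}"] by blast
    \<comment> \<open>\<open>N\<close> contains the \<open>a j\<close>, hence the range of
      \<open>H\<close>, and also \<open>b i\<close>: leaving \<open>N\<close> at \<open>s i\<close>
      then means differing from every element of \<open>b i\<close> there.\<close>
    obtain N where N: "N \<in> F" "carrier N0 \<subseteq> carrier N" "carrier (b i) \<subseteq> carrier N"
      using tower_directed[OF t N0(1) b(1)[OF i]] by blast
    note cN = submod_onD[OF submod_on_carrier[OF towerD(4)[OF t N(1)]]]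
    have "r \<odot>\<^bsub>M\<^esub> a j \<in> carrier N" if "j \<in> underS \<mu> i" "r \<in> K j" for j r
      using cN(5)[OF KR[OF that(2)]] N0(2)[OF that(1)] N(2) by blast
    then have H3: "Range H \<subseteq> carrier N" using cN(3) by (auto simp: H_def Z_def gr_def)
    obtain x where x: "x \<in> carrier M" "\<forall>(r, y)\<in>H. y = r \<odot>\<^bsub>M\<^esub> x"
      "\<forall>r\<in>carrier R. r \<odot>\<^bsub>M\<^esub> x \<in> carrier N \<longrightarrow> (r, r \<odot>\<^bsub>M\<^esub> x) \<in> H"
      using tower_graph_extend[OF t N(1) H1 H2 H3] by blast
    have "r \<odot>\<^bsub>M\<^esub> x = r \<odot>\<^bsub>M\<^esub> a j" if "j \<in> underS \<mu> i" "r \<in> K j" for j r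
    proof -
      have "(r, r \<odot>\<^bsub>M\<^esub> a j) \<in> H" using that by (auto simp: H_def gr_def)
      then show ?thesis using x(2) by fastforce
    qed
    \<comment> \<open>Agreement with an element of \<open>b i\<close> would put \<open>s i\<close>
      times \<open>x\<close> into \<open>N\<close>, so by exactness \<open>s i\<close> would be zero
      or lie in an earlier \<open>K j\<close>.\<close>
    moreover have "False" if m: "m \<in> carrier (b i)" "s i \<odot>\<^bsub>M\<^esub> x = s i \<odot>\<^bsub>M\<^esub> m" for m
    proof -
      have "s i \<odot>\<^bsub>M\<^esub> m \<in> carrier N" using cN(5)[OF sR[OF i]] m(1) N(3) by blast
      then have "(s i, s i \<odot>\<^bsub>M\<^esub> m) \<in> H" using bspec[OF x(3) sR[OF i]] m(2) by simp
      then show False using snK[OF i] sn0[OF i] by (auto simp: H_def Z_def gr_def)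
    qed
    ultimately show "\<exists>x. Q a i x" using x(1) unfolding Q_def by blast
  qed (use that in blast)
  have aM: "a i \<in> carrier M" if "i \<in> Field \<mu>" for i using a[OF that] by (simp add: Q_def)

  define H where "H = \<Union>(gr a ` Field \<mu>)"
  have H1: "submod_on R (prod_mod (reg_mod R) M) H"
    unfolding H_def
  proof (rule submod_on_Union_chain)
    show "submod_on R (prod_mod (reg_mod R) M) S" if "S \<in> gr a ` Field \<mu>" for S
      using that gr_sub[OF aM] by auto
    show "S \<subseteq> T \<or> T \<subseteq> S" if "S \<in> gr a ` Field \<mu>" "T \<in> gr a ` Field \<mu>" for S T
      using that gr_chain[of "Field \<mu>" a, OF a] by blast
  qed (use ne in simp)
  have H2: "functional (reg_mod R) M H"
    using gr_fun[OF aM] by (auto simp: H_def functional_def)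
  have sF: "s ` Field \<mu> \<subseteq> carrier R" using sR by blast
  have domH: "Domain H = \<Union>(K ` Field \<mu>)" by (auto simp: H_def gr_def)
  have "Domain H = gen_left_ideal R (s ` Field \<mu>)"
  proof
    have "K i \<subseteq> gen_left_ideal R (s ` Field \<mu>)" for i
      unfolding K_def by (intro gen_left_ideal_mono image_mono) (auto simp: Field_def)
    then show "Domain H \<subseteq> gen_left_ideal R (s ` Field \<mu>)" unfolding domH by blast
    have "submod_on R (reg_mod R) (\<Union>(K ` Field \<mu>))"
    proof (rule submod_on_Union_chain)
      fix S T assume "S \<in> K ` Field \<mu>" "T \<in> K ` Field \<mu>"
      show "S \<subseteq> T \<or> T \<subseteq> S"
      proof -
        obtain i j where "i \<in> Field \<mu>" "j \<in> Field \<mu>" "S = K i" "T = K j" using \<open>S \<in> K ` Field \<mu>\<close> \<open>T \<in> K ` Field \<mu>\<close> by blast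
        then show ?thesis using lin[of i j] Kmono[of i j] Kmono[of j i] by blast
      qed
    qed (use ne Ksub in auto)
    moreover have "s ` Field \<mu> \<subseteq> \<Union>(K ` Field \<mu>)" using sK by blast
    ultimately show "gen_left_ideal R (s ` Field \<mu>) \<subseteq> Domain H"
      unfolding domH by (rule gen_left_ideal_least[OF ring])
  qed
  moreover have "|s ` Field \<mu>| \<le>o \<mu>"
    by (rule ordLeq_ordIso_trans[OF card_of_image card_of_Field_ordIso[OF C\<mu>]])
  moreover have "\<not> (\<exists>m\<in>carrier M. \<forall>(r, y)\<in>H. y = r \<odot>\<^bsub>M\<^esub> m)"
  proof
    assume "\<exists>m\<in>carrier M. \<forall>(r, y)\<in>H. y = r \<odot>\<^bsub>M\<^esub> m"
    then obtain m where m: "m \<in> carrier M" "\<And>r y. (r, y) \<in> H \<Longrightarrow> y = r \<odot>\<^bsub>M\<^esub> m" by blast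
    then obtain i where i: "i \<in> Field \<mu>" "m \<in> carrier (b i)" using b(2) by auto
    have "(s i, s i \<odot>\<^bsub>M\<^esub> a i) \<in> H" using i sK[OF i(1)] by (auto simp: H_def gr_def)
    then have "s i \<odot>\<^bsub>M\<^esub> a i = s i \<odot>\<^bsub>M\<^esub> m" by (rule m(2))
    then show False using a[OF i(1)] i(2) by (auto simp: Q_def)
  qed
  ultimately show thesis using that[OF H1 H2 sF] by blast
qed

section \<open>Isomorphism of modules and different cofinalities\<close>

lemma mod_isomorphic_iff:
  "mod_isomorphic R M N \<longleftrightarrow> (\<exists>h. mod_lin R M N h \<and> bij_betw h (carrier M) (carrier N))"
  by (auto simp: mod_isomorphic_def mod_lin_iff_mod_hom)

lemma mod_isomorphic_sym:
  assumes "left_module R M" "mod_isomorphic R M N" shows "mod_isomorphic R N M"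
proof -
  obtain h where h: "mod_lin R M N h" "bij_betw h (carrier M) (carrier N)"
    using assms(2) mod_isomorphic_iff by blast
  show ?thesis
    unfolding mod_isomorphic_iff using mod_lin_inv_into[OF assms(1) h] bij_betw_inv_into[OF h(2)] by blast
qed

lemma mod_isomorphic_trans:
  assumes "mod_isomorphic R M N" "mod_isomorphic R N K" shows "mod_isomorphic R M K"
proof -
  obtain f g where f: "mod_lin R M N f" "bij_betw f (carrier M) (carrier N)"
    and g: "mod_lin R N K g" "bij_betw g (carrier N) (carrier K)"
    using assms mod_isomorphic_iff by blast
  show ?thesis
    unfolding mod_isomorphic_iff
    using mod_lin_comp[OF f(1) g(1)] bij_betw_trans[OF f(2) g(2)] by (auto simp: comp_def)
qed

lemma mod_isomorphic_refl: "mod_isomorphic R M M"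
  by (auto simp: mod_isomorphic_def mod_hom_def intro!: bexI[of _ "\<lambda>x. x"] bij_betwI')

text \<open>The non-extendable homomorphism into \<open>M\<close> has a domain with at most
  \<open>\<mu>\<close> generators. Transported to \<open>N\<close>, where fewer than
  \<open>\<nu>\<close> generators cause no obstruction, it is multiplication by some
  \<open>n\<close>, and the preimage of \<open>n\<close> would realise it in
  \<open>M\<close>.\<close>

lemma tower_not_isomorphic:
  assumes tM: "tower \<mu> F M" and tN: "tower \<nu> G N" and less: "\<mu> <o \<nu>"
    and I: "left_ideal I R" "\<not> lt_generated \<mu> R I"
  shows "\<not> mod_isomorphic R M N"
proof
  assume "mod_isomorphic R M N"
  then obtain f where f: "mod_lin R M N f" "bij_betw f (carrier M) (carrier N)"
    using mod_isomorphic_iff by blast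
  have M: "left_module R M" and N: "left_module R N" using towerD(1)[OF tM] towerD(1)[OF tN] by simp_all
  have RR: "left_module R (reg_mod R)" using left_module_reg_mod[OF ring] .
  interpret M: left_module R M by fact
  obtain H S where H: "submod_on R (prod_mod (reg_mod R) M) H" "functional (reg_mod R) M H"
    and S: "S \<subseteq> carrier R" "|S| \<le>o \<mu>" "Domain H = gen_left_ideal R S"
    and no: "\<not> (\<exists>m\<in>carrier M. \<forall>(r, y)\<in>H. y = r \<odot>\<^bsub>M\<^esub> m)"
    by (rule tower_non_extendable[OF tM I])
  have Hc: "r \<in> carrier R" "y \<in> carrier M" if "(r, y) \<in> H" for r y using submod_onD(2)[OF H(1) that] by auto
  define H' where "H' = (\<lambda>(r, y). (r, f y)) ` H"
  have "submod_on R (prod_mod (reg_mod R) N) H'"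
  proof (rule submod_onI)
    fix p q assume "p \<in> H'" "q \<in> H'"
    then obtain r y r' y' where *: "p = (r, f y)" "q = (r', f y')" "(r, y) \<in> H" "(r', y') \<in> H"
      by (auto simp: H'_def)
    have "(r \<oplus>\<^bsub>R\<^esub> r', y \<oplus>\<^bsub>M\<^esub> y') \<in> H" using submod_onD(4)[OF H(1) *(3,4)] by simp
    then show "p \<oplus>\<^bsub>prod_mod (reg_mod R) N\<^esub> q \<in> H'"
      using mod_linD(2)[OF f(1) Hc(2)[OF *(3)] Hc(2)[OF *(4)]] * by (force simp: H'_def)
  next
    fix c p assume c: "c \<in> carrier R" and "p \<in> H'"
    then obtain r y where *: "p = (r, f y)" "(r, y) \<in> H" by (auto simp: H'_def)
    have "(c \<otimes>\<^bsub>R\<^esub> r, c \<odot>\<^bsub>M\<^esub> y) \<in> H" using submod_onD(5)[OF H(1) c *(2)] by simp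
    then show "c \<odot>\<^bsub>prod_mod (reg_mod R) N\<^esub> p \<in> H'"
      using mod_linD(3)[OF f(1) c Hc(2)[OF *(2)]] * by (force simp: H'_def)
  next
    show "\<zero>\<^bsub>prod_mod (reg_mod R) N\<^esub> \<in> H'"
      using submod_onD(3)[OF H(1)] mod_lin_zero[OF M N f(1)] by (force simp: H'_def)
    show "p \<in> carrier (prod_mod (reg_mod R) N)" if "p \<in> H'" for p
      using that Hc mod_linD(1)[OF f(1)] by (auto simp: H'_def)
  qed
  moreover have "functional (reg_mod R) N H'"
    using functional_zeroD[OF H(2)] mod_lin_zero[OF M N f(1)] by (auto simp: functional_def H'_def)
  moreover have "Domain H' = gen_left_ideal R S" using S(3) by (force simp: H'_def)
  ultimately have "\<exists>n\<in>carrier N. \<forall>(r, y)\<in>H'. y = r \<odot>\<^bsub>N\<^esub> n"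
    using tower_extend_lt_generated[OF tN _ _ S(1) ordLeq_ordLess_trans[OF S(2) less]] by blast
  then obtain n where n: "n \<in> carrier N" "\<And>r y. (r, y) \<in> H' \<Longrightarrow> y = r \<odot>\<^bsub>N\<^esub> n" by blast
  obtain m where m: "m \<in> carrier M" "n = f m" using n(1) f(2) by (auto simp: bij_betw_def)
  have "y = r \<odot>\<^bsub>M\<^esub> m" if ry: "(r, y) \<in> H" for r y
  proof -
    have "f y = f (r \<odot>\<^bsub>M\<^esub> m)"
      using n(2)[of r "f y"] ry m mod_linD(3)[OF f(1) Hc(1)[OF ry] m(1)] by (force simp: H'_def)
    then show ?thesis
      using f(2) Hc[OF ry] m(1) M.smult_closed by (auto simp: bij_betw_def dest: inj_onD)
  qed
  then show False using no m(1) by blast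
qed

end

subsection \<open>Direct sums with injective modules\<close>

lemma submod_on_vimage:
  assumes D: "left_module R D" and A: "left_module R A" and f: "mod_lin R D A f" and S: "submod_on R A S"
  shows "submod_on R D {x \<in> carrier D. f x \<in> S}"
proof -
  interpret D: left_module R D by fact
  show ?thesis
    by (rule submod_onI)
      (auto simp: mod_linD[OF f] mod_lin_zero[OF D A f] D.smult_closed intro: submod_onD[OF S])
qed

lemma mod_lin_into_submod:
  assumes "mod_lin R X Y f" "submod_of R Y' Y" "\<And>x. x \<in> carrier X \<Longrightarrow> f x \<in> carrier Y'"
  shows "mod_lin R X Y' f"
  by (rule mod_linI) (simp_all add: assms(3) mod_linD[OF assms(1)] submod_ofD(5,6)[OF assms(2)])

context module_universe
begin

text \<open>The members of a tower must have carriers in \<open>'m\<close>, so the sum of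
  \<open>N\<close> and \<open>B\<close> is taken as a preimage inside \<open>D\<close> and not as a
  product.\<close>

definition fibre :: "('r, 'm) module \<Rightarrow> ('m \<Rightarrow> 'm) \<Rightarrow> ('r, 'm) module \<Rightarrow> ('r, 'm) module" where
  "fibre D \<alpha> N = D\<lparr>carrier := {x \<in> carrier D. \<alpha> x \<in> carrier N}\<rparr>"

lemma carrier_fibre [simp]: "carrier (fibre D \<alpha> N) = {x \<in> carrier D. \<alpha> x \<in> carrier N}"
  by (simp add: fibre_def)

text \<open>
  If \<open>B\<close> is injective then an extension of \<open>N \<oplus> B\<close> splits as \<open>K \<oplus> B\<close> with \<open>N \<subseteq> K\<close>. Here \<open>N \<oplus> B\<close> is
  the fibre of the first projection \<open>\<alpha>\<close> over \<open>N\<close>, and \<open>\<sigma>\<close> is the inverse of the pair of projections.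
\<close>

lemma universal_over_fibre:
  fixes D A B :: "('r, 'm) module"
  assumes D: "left_module R D" and A: "left_module R A" and B: "left_module R B" and inj: "baer_injective R B"
    and al: "mod_lin R D A \<alpha>" and pi: "mod_lin R D B \<pi>" and si: "mod_lin R (prod_mod A B) D (\<lambda>(a, b). \<sigma> a b)"
    and as: "\<And>a b. a \<in> carrier A \<Longrightarrow> b \<in> carrier B \<Longrightarrow> \<alpha> (\<sigma> a b) = a"
    and ps: "\<And>a b. a \<in> carrier A \<Longrightarrow> b \<in> carrier B \<Longrightarrow> \<pi> (\<sigma> a b) = b"
    and sap: "\<And>x. x \<in> carrier D \<Longrightarrow> \<sigma> (\<alpha> x) (\<pi> x) = x"
    and N: "submod_of R N A" "submod_of R N' A" and univ: "universal_over R N' N"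
    and cN': "|carrier N'| =o lam"
    and cD: "|carrier (fibre D \<alpha> N)| =o lam" "|carrier (fibre D \<alpha> N')| =o lam"
  shows "universal_over R (fibre D \<alpha> N') (fibre D \<alpha> N)"
proof -
  interpret D: left_module R D by fact
  interpret A: left_module R A by fact
  interpret B: left_module R B by fact
  have NN': "submod_of R N N'" using univ by (simp add: universal_over_def)
  have mN: "left_module R N" and mN': "left_module R N'" using submod_ofD(1,2)[OF NN'] by simp_all
  have fib: "submod_of R (fibre D \<alpha> L) D" if "submod_of R L A" for L
    unfolding fibre_def by (rule submod_of_submod_on[OF D submod_on_vimage[OF D A al submod_on_carrier[OF that]]])
  let ?D = "fibre D \<alpha> N" and ?D' = "fibre D \<alpha> N'"
  have sub: "submod_of R ?D ?D'"
    using submod_of_sandwich[OF fib[OF N(1)] fib[OF N(2)]] submod_ofD(3)[OF NN'] by auto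
  have siD: "\<sigma> a b \<in> carrier D" if "a \<in> carrier A" "b \<in> carrier B" for a b
    using mod_linD(1)[OF si, of "(a, b)"] that by simp
  have zA: "\<zero>\<^bsub>A\<^esub> \<in> carrier N" using submod_onD(3)[OF submod_on_carrier[OF N(1)]] .
  have main: "\<exists>f\<in>mod_embeddings R E ?D'. \<forall>x\<in>carrier ?D. f x = x"
    if cE: "|carrier E| =o |carrier ?D'|" and DE: "submod_of R ?D E" for E :: "('r, 'm) module"
  proof -
    have E: "left_module R E" using submod_ofD(2)[OF DE] .
    interpret E: left_module R E by fact
    have cE': "|carrier E| \<le>o lam" using ordIso_imp_ordLeq[OF ordIso_transitive[OF cE cD(2)]] .
    \<comment> \<open>Injectivity of \<open>B\<close> enters through this graph: the projection to
      \<open>B\<close>, defined on the fibre, extends to a homomorphism \<open>q\<close> on all of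
      \<open>E\<close>.\<close>
    define H where "H = (\<lambda>x. (x, \<pi> x)) ` carrier ?D"
    have piD: "mod_lin R ?D B \<pi>" using mod_lin_restrict[OF fib[OF N(1)] pi] .
    have H1: "submod_on R (prod_mod E B) H"
      unfolding H_def
      by (rule submod_on_mono_module[OF submod_of_prod_mod[OF DE submod_of_refl[OF B]]
            graph_submod_on[OF submod_ofD(1)[OF DE] B piD]])
    have H2: "functional E B H"
      using mod_lin_zero[OF submod_ofD(1)[OF DE] B piD] submod_of_zero[OF DE] by (auto simp: functional_def H_def)
    obtain q where q: "mod_lin R E B q" "\<And>x y. (x, y) \<in> H \<Longrightarrow> q x = y"
      by (rule baer_injective_extend[OF E B inj H1 H2]) blast
    have q_pi: "q x = \<pi> x" if "x \<in> carrier ?D" for x using q(2) that by (auto simp: H_def)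

    have s_lin: "mod_lin R B E (\<lambda>b. \<sigma> \<zero>\<^bsub>A\<^esub> b)"
    proof -
      have "mod_lin R B (prod_mod A B) (\<lambda>b. (\<zero>\<^bsub>A\<^esub>, b))" by (rule mod_linI) auto
      from mod_lin_comp[OF this si] have "mod_lin R B D (\<lambda>b. \<sigma> \<zero>\<^bsub>A\<^esub> b)" by simp
      from mod_lin_into_submod[OF this fib[OF N(1)]] have "mod_lin R B ?D (\<lambda>b. \<sigma> \<zero>\<^bsub>A\<^esub> b)"
        using siD as zA by simp
      from mod_lin_comp[OF this submod_of_lin[OF DE]] show ?thesis .
    qed
    have i_lin: "mod_lin R N E (\<lambda>a. \<sigma> a \<zero>\<^bsub>B\<^esub>)"
    proof -
      have "mod_lin R N (prod_mod A B) (\<lambda>a. (a, \<zero>\<^bsub>B\<^esub>))"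
        using submod_ofD[OF N(1)] by (intro mod_linI) auto
      from mod_lin_comp[OF this si] have "mod_lin R N D (\<lambda>a. \<sigma> a \<zero>\<^bsub>B\<^esub>)" by simp
      from mod_lin_into_submod[OF this fib[OF N(1)]] have "mod_lin R N ?D (\<lambda>a. \<sigma> a \<zero>\<^bsub>B\<^esub>)"
        using siD as submod_ofD(4)[OF N(1)] by simp
      from mod_lin_comp[OF this submod_of_lin[OF DE]] show ?thesis .
    qed
    have s_fib: "\<sigma> \<zero>\<^bsub>A\<^esub> b \<in> carrier ?D" if "b \<in> carrier B" for b using siD as zA that by simp
    have i_fib: "\<sigma> a \<zero>\<^bsub>B\<^esub> \<in> carrier ?D" if "a \<in> carrier N" for a
      using siD as submod_ofD(4)[OF N(1)] that by simp
    have qs: "q (\<sigma> \<zero>\<^bsub>A\<^esub> b) = b" if "b \<in> carrier B" for b using q_pi[OF s_fib[OF that]] ps that by simp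
    have qi: "q (\<sigma> a \<zero>\<^bsub>B\<^esub>) = \<zero>\<^bsub>B\<^esub>" if "a \<in> carrier N" for a
      using q_pi[OF i_fib[OF that]] ps submod_ofD(4)[OF N(1)] that by simp

    \<comment> \<open>The kernel of \<open>q\<close> is a complement in \<open>E\<close> of the copy
      of \<open>B\<close> and contains the copy of \<open>N\<close>. A bound on its size is enough,
      since the universality of \<open>N'\<close> is applied to it through
      \<open>universal_over_embed\<close>.\<close>
    define S where "S = {x \<in> carrier E. q x \<in> {\<zero>\<^bsub>B\<^esub>}}"
    define K where "K = E\<lparr>carrier := S\<rparr>"
    have S: "submod_on R E S" unfolding S_def by (rule submod_on_vimage[OF E B q(1) submod_on_zero[OF B]])
    have KE: "submod_of R K E" unfolding K_def by (rule submod_of_submod_on[OF E S])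
    have K: "left_module R K" using submod_ofD(1)[OF KE] .
    have cK: "carrier K = S" by (simp add: K_def)
    have "|carrier K| \<le>o lam"
      unfolding cK by (rule ordLeq_transitive[OF card_of_mono1[OF submod_onD(1)[OF S]] cE'])
    moreover have i_K: "mod_lin R N K (\<lambda>a. \<sigma> a \<zero>\<^bsub>B\<^esub>)"
      by (rule mod_lin_into_submod[OF i_lin KE]) (use mod_linD(1)[OF i_lin] qi cK in \<open>simp add: S_def\<close>)
    moreover have "inj_on (\<lambda>a. \<sigma> a \<zero>\<^bsub>B\<^esub>) (carrier N)"
    proof (rule inj_on_inverseI)
      show "\<alpha> (\<sigma> a \<zero>\<^bsub>B\<^esub>) = a" if "a \<in> carrier N" for a using as submod_ofD(4)[OF N(1) that] by simp
    qed
    ultimately obtain f where f: "mod_lin R K N' f" "inj_on f (carrier K)"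
      "\<And>a. a \<in> carrier N \<Longrightarrow> f (\<sigma> a \<zero>\<^bsub>B\<^esub>) = a"
      using universal_over_embed[OF univ cN' K] by blast

    \<comment> \<open>The projection of \<open>E\<close> to \<open>K\<close> along the copy of
      \<open>B\<close>.\<close>
    define \<kappa> where "\<kappa> x = x \<ominus>\<^bsub>E\<^esub> \<sigma> \<zero>\<^bsub>A\<^esub> (q x)" for x
    have sq_lin: "mod_lin R E E (\<lambda>x. \<sigma> \<zero>\<^bsub>A\<^esub> (q x))" using mod_lin_comp[OF q(1) s_lin] .
    note sq = mod_linD[OF sq_lin]
    have "mod_lin R E E \<kappa>"
    proof (rule mod_linI)
      show "\<kappa> x \<in> carrier E" if "x \<in> carrier E" for x using that sq(1) by (simp add: \<kappa>_def)
      show "\<kappa> (x \<oplus>\<^bsub>E\<^esub> y) = \<kappa> x \<oplus>\<^bsub>E\<^esub> \<kappa> y" if "x \<in> carrier E" "y \<in> carrier E" for x y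
        using that sq(1) by (simp add: \<kappa>_def sq(2) a_minus_def E.M.minus_add E.M.add.m_ac)
      show "\<kappa> (r \<odot>\<^bsub>E\<^esub> x) = r \<odot>\<^bsub>E\<^esub> \<kappa> x" if "r \<in> carrier R" "x \<in> carrier E" for r x
        using that sq(1) by (simp add: \<kappa>_def sq(3) a_minus_def E.smult_r_distr E.smult_minus_right)
    qed
    moreover have "\<kappa> x \<in> carrier K" if x: "x \<in> carrier E" for x
    proof -
      have "q (\<kappa> x) = q x \<ominus>\<^bsub>B\<^esub> q (\<sigma> \<zero>\<^bsub>A\<^esub> (q x))"
        unfolding \<kappa>_def by (rule mod_lin_minus[OF E B q(1) x sq(1)[OF x]])
      also have "\<dots> = \<zero>\<^bsub>B\<^esub>"
        using qs mod_linD(1)[OF q(1) x] by (simp add: a_minus_def B.M.r_neg)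
      finally show ?thesis using x sq(1) by (simp add: cK S_def \<kappa>_def)
    qed
    ultimately have k_lin: "mod_lin R E K \<kappa>" by (rule mod_lin_into_submod[OF _ KE])

    \<comment> \<open>The component in \<open>K\<close> goes into \<open>N'\<close> by
      \<open>f\<close>, the component in \<open>B\<close> is kept.\<close>
    define G where "G x = \<sigma> (f (\<kappa> x)) (q x)" for x
    have fk_lin: "mod_lin R E N' (\<lambda>x. f (\<kappa> x))" using mod_lin_comp[OF k_lin f(1)] .
    have fk_A: "mod_lin R E A (\<lambda>x. f (\<kappa> x))" using mod_lin_comp[OF fk_lin submod_of_lin[OF N(2)]] .
    have "mod_lin R E (prod_mod A B) (\<lambda>x. (f (\<kappa> x), q x))"
      by (rule mod_linI) (simp_all add: mod_linD[OF fk_A] mod_linD[OF q(1)])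
    from mod_lin_comp[OF this si] have G_D: "mod_lin R E D G" by (simp add: G_def[abs_def])
    have G_lin: "mod_lin R E ?D' G"
    proof (rule mod_lin_into_submod[OF G_D fib[OF N(2)]])
      show "G x \<in> carrier ?D'" if "x \<in> carrier E" for x
        using mod_linD(1)[OF G_D that] mod_linD(1)[OF fk_lin that] mod_linD(1)[OF fk_A that] mod_linD(1)[OF q(1) that]
        by (simp add: G_def as)
    qed
    have "inj_on G (carrier E)"
    proof (rule mod_lin_inj_on[OF E submod_ofD(1)[OF fib[OF N(2)]] G_lin])
      fix x assume x: "x \<in> carrier E" and "G x = \<zero>\<^bsub>?D'\<^esub>"
      then have G0: "G x = \<zero>\<^bsub>D\<^esub>" by (simp add: fibre_def)
      have c: "f (\<kappa> x) \<in> carrier A" "q x \<in> carrier B" using mod_linD(1)[OF fk_A x] mod_linD(1)[OF q(1) x] by simp_all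
      have q0: "q x = \<zero>\<^bsub>B\<^esub>"
        using ps[OF c] G0 mod_lin_zero[OF D B pi] by (simp add: G_def)
      have "f (\<kappa> x) = \<zero>\<^bsub>A\<^esub>"
        using as[OF c] G0 mod_lin_zero[OF D A al] by (simp add: G_def)
      then have "f (\<kappa> x) = f \<zero>\<^bsub>K\<^esub>" using mod_lin_zero[OF K mN' f(1)] submod_of_zero[OF N(2)] by simp
      then have "\<kappa> x = \<zero>\<^bsub>K\<^esub>"
        by (rule inj_onD[OF f(2) _ mod_linD(1)[OF k_lin x] submod_onD(3)[OF submod_on_carrier[OF submod_of_refl[OF K]]]])
      then have "x \<ominus>\<^bsub>E\<^esub> \<sigma> \<zero>\<^bsub>A\<^esub> \<zero>\<^bsub>B\<^esub> = \<zero>\<^bsub>E\<^esub>" using submod_of_zero[OF KE] q0 by (simp add: \<kappa>_def)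
      then show "x = \<zero>\<^bsub>E\<^esub>" using mod_lin_zero[OF B E s_lin] x by (simp add: a_minus_def)
    qed
    moreover have "G x = x" if x: "x \<in> carrier ?D" for x
    proof -
      have xD: "x \<in> carrier D" and axN: "\<alpha> x \<in> carrier N" using x by simp_all
      have aA: "\<alpha> x \<in> carrier A" and pB: "\<pi> x \<in> carrier B"
        using mod_linD(1)[OF al xD] mod_linD(1)[OF pi xD] by simp_all
      have "x = \<sigma> (\<alpha> x) \<zero>\<^bsub>B\<^esub> \<oplus>\<^bsub>D\<^esub> \<sigma> \<zero>\<^bsub>A\<^esub> (\<pi> x)"
        using mod_linD(2)[OF si, of "(\<alpha> x, \<zero>\<^bsub>B\<^esub>)" "(\<zero>\<^bsub>A\<^esub>, \<pi> x)"] sap[OF xD] aA pB by simp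
      also have "\<dots> = \<sigma> (\<alpha> x) \<zero>\<^bsub>B\<^esub> \<oplus>\<^bsub>E\<^esub> \<sigma> \<zero>\<^bsub>A\<^esub> (\<pi> x)"
        using submod_ofD(5)[OF fib[OF N(1)] i_fib[OF axN] s_fib[OF pB]]
          submod_ofD(5)[OF DE i_fib[OF axN] s_fib[OF pB]] by simp
      finally have "\<kappa> x = (\<sigma> (\<alpha> x) \<zero>\<^bsub>B\<^esub> \<oplus>\<^bsub>E\<^esub> \<sigma> \<zero>\<^bsub>A\<^esub> (\<pi> x)) \<ominus>\<^bsub>E\<^esub> \<sigma> \<zero>\<^bsub>A\<^esub> (\<pi> x)"
        using q_pi[OF x] by (simp add: \<kappa>_def)
      also have "\<dots> = \<sigma> (\<alpha> x) \<zero>\<^bsub>B\<^esub>"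
        using mod_linD(1)[OF i_lin axN] mod_linD(1)[OF s_lin pB]
        by (simp add: a_minus_def E.M.add.m_assoc E.M.r_neg)
      finally show ?thesis using f(3)[OF axN] q_pi[OF x] sap[OF xD] by (simp add: G_def)
    qed
    ultimately show ?thesis
      using G_lin by (auto simp: mod_embeddings_def mod_lin_iff_mod_hom)
  qed
  have "|carrier ?D'| =o |carrier ?D|" using ordIso_transitive[OF cD(2) ordIso_symmetric[OF cD(1)]] .
  then show ?thesis using main sub unfolding universal_over_def by blast
qed

text \<open>Taking preimages under \<open>\<alpha>\<close> respects bounds and covers, so
  \<open>\<mu>\<close> does not change. A fibre has exactly \<open>lam\<close> elements:
  \<open>a \<mapsto> \<sigma> a 0\<close> embeds \<open>N\<close> into it, and \<open>D\<close>
  bounds it from above.\<close>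

lemma tower_fibre:
  fixes D A B :: "('r, 'm) module"
  assumes t: "tower \<mu> F A" and D: "left_module R D" and B: "left_module R B" and inj: "baer_injective R B"
    and cD: "|carrier D| \<le>o lam"
    and al: "mod_lin R D A \<alpha>" and pi: "mod_lin R D B \<pi>" and si: "mod_lin R (prod_mod A B) D (\<lambda>(a, b). \<sigma> a b)"
    and as: "\<And>a b. a \<in> carrier A \<Longrightarrow> b \<in> carrier B \<Longrightarrow> \<alpha> (\<sigma> a b) = a"
    and ps: "\<And>a b. a \<in> carrier A \<Longrightarrow> b \<in> carrier B \<Longrightarrow> \<pi> (\<sigma> a b) = b"
    and sap: "\<And>x. x \<in> carrier D \<Longrightarrow> \<sigma> (\<alpha> x) (\<pi> x) = x"
  shows "tower \<mu> (fibre D \<alpha> ` F) D"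
proof -
  have A: "left_module R A" using towerD(1)[OF t] .
  interpret B: left_module R B by fact
  have sub: "submod_of R (fibre D \<alpha> N) D" if "N \<in> F" for N
    unfolding fibre_def by (rule submod_of_submod_on[OF D submod_on_vimage[OF D A al submod_on_carrier[OF towerD(4)[OF t that]]]])
  have card: "|carrier (fibre D \<alpha> N)| =o lam" if N: "N \<in> F" for N
  proof -
    have NA: "a \<in> carrier A" if "a \<in> carrier N" for a using submod_ofD(4)[OF towerD(4)[OF t N] that] .
    have inj: "inj_on (\<lambda>a. \<sigma> a \<zero>\<^bsub>B\<^esub>) (carrier N)"
      by (rule inj_on_inverseI[of _ \<alpha>]) (simp add: as NA)
    have "\<sigma> a \<zero>\<^bsub>B\<^esub> \<in> carrier D" if "a \<in> carrier N" for a
      using mod_linD(1)[OF si, of "(a, \<zero>\<^bsub>B\<^esub>)"] NA[OF that] by simp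
    then have "|carrier N| \<le>o |carrier (fibre D \<alpha> N)|"
      by (intro card_of_ordLeqI[OF inj]) (simp add: as NA)
    then have "lam \<le>o |carrier (fibre D \<alpha> N)|"
      by (rule ordIso_ordLeq_trans[OF ordIso_symmetric[OF towerD(5)[OF t N]]])
    moreover have "|carrier (fibre D \<alpha> N)| \<le>o lam"
      by (rule ordLeq_transitive[OF card_of_mono1[OF submod_ofD(3)[OF sub[OF N]]] cD])
    ultimately show ?thesis by (simp add: ordIso_iff_ordLeq)
  qed
  have "\<exists>L\<in>fibre D \<alpha> ` F. universal_over R L (fibre D \<alpha> N)" if N: "N \<in> F" for N
  proof -
    obtain N' where N': "N' \<in> F" "universal_over R N' N" using towerD(6)[OF t N] by blast
    have "universal_over R (fibre D \<alpha> N') (fibre D \<alpha> N)"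
      by (rule universal_over_fibre[OF D A B inj al pi si as ps sap towerD(4)[OF t N] towerD(4)[OF t N'(1)] N'(2)
            towerD(5)[OF t N'(1)] card[OF N] card[OF N'(1)]])
    then show ?thesis using N'(1) by blast
  qed
  moreover have "\<exists>L\<in>fibre D \<alpha> ` F. \<forall>K\<in>X. carrier K \<subseteq> carrier L"
    if X: "X \<subseteq> fibre D \<alpha> ` F" "|X| <o \<mu>" for X
  proof -
    have "\<forall>K\<in>X. \<exists>N. N \<in> F \<and> K = fibre D \<alpha> N" using X(1) by blast
    from bchoice[OF this] obtain n where n: "\<forall>K\<in>X. n K \<in> F \<and> K = fibre D \<alpha> (n K)" by blast
    then obtain L where L: "L \<in> F" "\<And>K. K \<in> X \<Longrightarrow> carrier (n K) \<subseteq> carrier L"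
      using tower_bounded[OF t X(2), of "\<lambda>K. carrier (n K)"] by blast
    have "carrier K \<subseteq> carrier (fibre D \<alpha> L)" if K: "K \<in> X" for K
    proof -
      have "carrier K = carrier (fibre D \<alpha> (n K))" using n K by simp
      then show ?thesis using L(2)[OF K] by auto
    qed
    then show ?thesis using L(1) by blast
  qed
  moreover have "\<exists>A'\<subseteq>fibre D \<alpha> ` F. |A'| \<le>o \<mu> \<and> carrier D = (\<Union>N\<in>A'. carrier N)"
  proof -
    obtain A' where A': "A' \<subseteq> F" "|A'| \<le>o \<mu>" "carrier A = (\<Union>N\<in>A'. carrier N)" using towerD(8)[OF t] by blast
    have "carrier D = (\<Union>N\<in>fibre D \<alpha> ` A'. carrier N)"
      using mod_linD(1)[OF al] A'(3) by auto
    moreover have "|fibre D \<alpha> ` A'| \<le>o \<mu>" by (rule ordLeq_transitive[OF card_of_image A'(2)])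
    moreover have "fibre D \<alpha> ` A' \<subseteq> fibre D \<alpha> ` F" using A'(1) by (rule image_mono)
    ultimately show ?thesis by (intro exI[of _ "fibre D \<alpha> ` A'"] conjI)
  qed
  moreover have "\<forall>L\<in>fibre D \<alpha> ` F. submod_of R L D \<and> |carrier L| =o lam" using sub card by blast
  ultimately show ?thesis
    unfolding tower_def using D towerD(2,3)[OF t] by simp
qed

text \<open>One copy \<open>D\<close> of the product carries two towers: over the first projection
  with parameter \<open>\<mu>\<close>, by the injectivity of \<open>B\<close>, and over the second
  with parameter \<open>\<nu>\<close>, by that of \<open>A\<close>. Uniqueness is applied to each
  parameter separately, so \<open>\<mu>\<close> and \<open>\<nu>\<close> may differ.\<close>

lemma injective_towers_isomorphic:
  assumes tA: "tower \<mu> F A" and tB: "tower \<nu> G B" and iA: "baer_injective R A" and iB: "baer_injective R B"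
  shows "mod_isomorphic R A B"
proof -
  have A: "left_module R A" and B: "left_module R B" using towerD(1)[OF tA] towerD(1)[OF tB] by simp_all
  interpret A: left_module R A by fact
  interpret B: left_module R B by fact
  let ?P = "prod_mod A B"
  have P: "left_module R ?P" using left_module_prod_mod[OF A B] .
  have cP: "|carrier ?P| \<le>o lam" using card_prod_le tower_card[OF tA] tower_card[OF tB] by simp
  have e: "mod_lin R A ?P (\<lambda>a. (a, \<zero>\<^bsub>B\<^esub>))" "inj_on (\<lambda>a. (a, \<zero>\<^bsub>B\<^esub>)) (carrier A)"
    by (rule mod_linI) (auto intro: inj_onI)
  obtain D :: "('r, 'm) module" and \<phi> where AD: "submod_of R A D" and ph: "mod_lin R D ?P \<phi>"
    and bij: "bij_betw \<phi> (carrier D) (carrier ?P)"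
    by (rule copy_over[OF A P e cP]) blast
  have D: "left_module R D" using submod_ofD(2)[OF AD] .
  have "|carrier D| \<le>o lam" by (rule ordIso_ordLeq_trans[OF card_of_ordIsoI[OF bij] cP])
  define \<psi> where "\<psi> = inv_into (carrier D) \<phi>"
  have psi: "mod_lin R ?P D \<psi>" unfolding \<psi>_def by (rule mod_lin_inv_into[OF D ph bij])
  have pp: "\<phi> (\<psi> p) = p" if "p \<in> carrier ?P" for p
    unfolding \<psi>_def using bij that by (simp add: bij_betw_def f_inv_into_f)
  have pd: "\<psi> (\<phi> x) = x" if "x \<in> carrier D" for x
    unfolding \<psi>_def using bij that by (simp add: bij_betw_def)
  have fst_lin: "mod_lin R ?P A fst" and snd_lin: "mod_lin R ?P B snd"
    and swap_lin: "mod_lin R (prod_mod B A) ?P (\<lambda>(b, a). (a, b))"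
    by (rule mod_linI; auto)+
  note al = mod_lin_comp[OF ph fst_lin] and pi = mod_lin_comp[OF ph snd_lin]
  have si: "mod_lin R ?P D (\<lambda>(a, b). \<psi> (a, b))" using psi by simp
  have si': "mod_lin R (prod_mod B A) D (\<lambda>(b, a). \<psi> (a, b))"
    using mod_lin_comp[OF swap_lin psi] by (simp add: case_prod_unfold)
  have "tower \<mu> (fibre D (\<lambda>x. fst (\<phi> x)) ` F) D"
    by (rule tower_fibre[OF tA D B iB \<open>|carrier D| \<le>o lam\<close> al pi si]) (simp_all add: pp pd)
  from tower_isomorphic[OF tA this] have 1: "mod_isomorphic R A D" .
  have "tower \<nu> (fibre D (\<lambda>x. snd (\<phi> x)) ` G) D"
    by (rule tower_fibre[OF tB D A iA \<open>|carrier D| \<le>o lam\<close> pi al si']) (simp_all add: pp pd)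
  from tower_isomorphic[OF this tB] have 2: "mod_isomorphic R D B" .
  show ?thesis using mod_isomorphic_trans[OF 1 2] .
qed

end

subsection \<open>Existence of limit models\<close>

lemma aboveS_suc:
  assumes r: "Well_order r" and i: "aboveS r i \<noteq> {}"
  shows "wo_rel.suc r {i} \<in> Field r" "(i, wo_rel.suc r {i}) \<in> r" "wo_rel.suc r {i} \<noteq> i"
    "\<And>k. (i, k) \<in> r \<Longrightarrow> k \<noteq> i \<Longrightarrow> (wo_rel.suc r {i}, k) \<in> r"
proof -
  interpret wo_rel r using r by (simp add: wo_rel_def)
  have iF: "{i} \<subseteq> Field r" and ne: "AboveS {i} \<noteq> {}"
    using i by (auto simp: aboveS_def AboveS_def Field_def)
  show "suc {i} \<in> Field r" by (rule suc_inField[OF iF ne])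
  show "(i, suc {i}) \<in> r" "suc {i} \<noteq> i" using suc_greater[OF iF ne] by auto
  show "(suc {i}, k) \<in> r" if "(i, k) \<in> r" "k \<noteq> i" for k
    by (rule suc_least_AboveS) (use that in \<open>auto simp: AboveS_def Field_def\<close>)
qed

lemma limit_orderD:
  assumes "limit_order r" shows "Well_order r" "Field r \<noteq> {}" "\<And>i. i \<in> Field r \<Longrightarrow> aboveS r i \<noteq> {}"
  using assms by (auto simp: limit_order_def)

lemma Field_Restr_underS:
  assumes "Well_order r" shows "Field (Restr r (underS r i)) = underS r i"
proof -
  have "Refl r" using assms by (auto simp: well_order_on_def linear_order_on_def partial_order_on_def preorder_on_def)
  moreover have "underS r i \<subseteq> Field r" by (auto simp: underS_def Field_def)
  ultimately show ?thesis by (rule Refl_Field_Restr2)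
qed

lemma limit_order_finite_bounded:
  assumes r: "limit_order r" and X: "finite X" "X \<subseteq> Field r"
  shows "\<exists>b\<in>Field r. \<forall>x\<in>X. (x, b) \<in> r"
  using X
proof (induction X)
  case empty
  then show ?case using limit_orderD(2)[OF r] by auto
next
  case (insert x X)
  note W = Well_orderD[OF limit_orderD(1)[OF r]]
  obtain b where b: "b \<in> Field r" "\<forall>x\<in>X. (x, b) \<in> r" using insert by auto
  show ?case
  proof (cases "(x, b) \<in> r")
    case True
    then show ?thesis using b by auto
  next
    case False
    then have bx: "(b, x) \<in> r" using W(4)[of x b] b(1) insert.prems by auto
    have "\<forall>y\<in>insert x X. (y, x) \<in> r" using W(1)[of x] W(2)[OF _ bx] b(2) insert.prems by auto
    then show ?thesis using insert.prems by blast
  qed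
qed

text \<open>The members are separate records with no common ambient module. An operation in the
  union is carried out in a chosen member \<open>pk x y\<close> containing both arguments, and
  comparability of the members makes the result independent of the choice.\<close>

lemma chain_union_module:
  fixes \<C> :: "('r, 'm) module set"
  assumes ne: "\<C> \<noteq> {}" and C: "\<And>M. M \<in> \<C> \<Longrightarrow> left_module R M"
    and ch: "\<And>M N. M \<in> \<C> \<Longrightarrow> N \<in> \<C> \<Longrightarrow> submod_of R M N \<or> submod_of R N M"
  obtains U :: "('r, 'm) module" where "carrier U = (\<Union>M\<in>\<C>. carrier M)" "\<And>M. M \<in> \<C> \<Longrightarrow> submod_of R M U"
proof -
  have R: "ring R" using ne C left_module.axioms(1) by blast
  define pk where "pk x y = (SOME M. M \<in> \<C> \<and> x \<in> carrier M \<and> y \<in> carrier M)" for x y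
  have pk: "pk x y \<in> \<C> \<and> x \<in> carrier (pk x y) \<and> y \<in> carrier (pk x y)"
    if "M \<in> \<C>" "x \<in> carrier M" "y \<in> carrier M" for M x y
    unfolding pk_def by (rule someI[of _ M]) (use that in blast)
  obtain M0 where M0: "M0 \<in> \<C>" using ne by blast
  define U :: "('r, 'm) module" where
    "U = \<lparr>carrier = (\<Union>M\<in>\<C>. carrier M), mult = undefined, one = undefined, zero = \<zero>\<^bsub>M0\<^esub>,
      add = (\<lambda>x y. x \<oplus>\<^bsub>pk x y\<^esub> y), smult = (\<lambda>r x. r \<odot>\<^bsub>pk x x\<^esub> x)\<rparr>"
  have cU: "carrier U = (\<Union>M\<in>\<C>. carrier M)" by (simp add: U_def)
  have add: "x \<oplus>\<^bsub>M\<^esub> y = x \<oplus>\<^bsub>U\<^esub> y" if M: "M \<in> \<C>" "x \<in> carrier M" "y \<in> carrier M" for M x y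
    using ch[of M "pk x y"] pk[OF M] M submod_ofD(5)[of R M "pk x y" x y] submod_ofD(5)[of R "pk x y" M x y]
    by (auto simp: U_def)
  have smult: "r \<odot>\<^bsub>M\<^esub> x = r \<odot>\<^bsub>U\<^esub> x" if M: "M \<in> \<C>" "r \<in> carrier R" "x \<in> carrier M" for M r x
    using ch[of M "pk x x"] pk[OF M(1,3,3)] M submod_ofD(6)[of R M "pk x x" r x] submod_ofD(6)[of R "pk x x" M r x]
    by (auto simp: U_def)
  have zero: "\<zero>\<^bsub>M\<^esub> = \<zero>\<^bsub>U\<^esub>" if "M \<in> \<C>" for M
    using ch[OF that M0] submod_of_zero[of R M M0] submod_of_zero[of R M0 M] by (auto simp: U_def)
  have dir: "\<exists>M\<in>\<C>. x \<in> carrier M \<and> y \<in> carrier M \<and> z \<in> carrier M"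
    if "x \<in> carrier U" "y \<in> carrier U" "z \<in> carrier U" for x y z
  proof -
    have 2: "\<exists>L\<in>\<C>. carrier M \<subseteq> carrier L \<and> carrier N \<subseteq> carrier L" if "M \<in> \<C>" "N \<in> \<C>" for M N
      using ch[OF that] submod_ofD(3)[of R M N] submod_ofD(3)[of R N M] that by blast
    obtain M1 M2 M3 where M: "M1 \<in> \<C>" "x \<in> carrier M1" "M2 \<in> \<C>" "y \<in> carrier M2" "M3 \<in> \<C>" "z \<in> carrier M3"
      using \<open>x \<in> carrier U\<close> \<open>y \<in> carrier U\<close> \<open>z \<in> carrier U\<close> by (auto simp: cU)
    obtain L where L: "L \<in> \<C>" "carrier M1 \<subseteq> carrier L" "carrier M2 \<subseteq> carrier L" using 2[OF M(1,3)] by blast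
    obtain L' where L': "L' \<in> \<C>" "carrier L \<subseteq> carrier L'" "carrier M3 \<subseteq> carrier L'" using 2[OF L(1) M(5)] by blast
    then have "x \<in> carrier L'" "y \<in> carrier L'" "z \<in> carrier L'" using L M by auto
    then show ?thesis using L'(1) by blast
  qed
  have inU: "x \<in> carrier U" if "M \<in> \<C>" "x \<in> carrier M" for M x using that cU by auto
  have "left_module R U"
  proof (rule left_moduleI[OF R])
    interpret M0: left_module R M0 by (rule C[OF M0])
    show "\<zero>\<^bsub>U\<^esub> \<in> carrier U" using inU[OF M0] zero[OF M0] M0.M.zero_closed by simp
  next
    fix x y z assume x: "x \<in> carrier U" and y: "y \<in> carrier U" and z: "z \<in> carrier U"
    obtain M where M: "M \<in> \<C>" "x \<in> carrier M" "y \<in> carrier M" "z \<in> carrier M" using dir[OF x y z] by blast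
    interpret M: left_module R M by (rule C[OF M(1)])
    note a = add[OF M(1), symmetric]
    show "(x \<oplus>\<^bsub>U\<^esub> y) \<oplus>\<^bsub>U\<^esub> z = x \<oplus>\<^bsub>U\<^esub> (y \<oplus>\<^bsub>U\<^esub> z)"
      using M by (simp add: a M.M.add.m_assoc)
  next
    fix x y assume x: "x \<in> carrier U" and y: "y \<in> carrier U"
    obtain M where M: "M \<in> \<C>" "x \<in> carrier M" "y \<in> carrier M" using dir[OF x y y] by blast
    interpret M: left_module R M by (rule C[OF M(1)])
    note a = add[OF M(1), symmetric]
    show "x \<oplus>\<^bsub>U\<^esub> y \<in> carrier U" using M inU[OF M(1)] by (simp add: a)
    show "x \<oplus>\<^bsub>U\<^esub> y = y \<oplus>\<^bsub>U\<^esub> x" using M by (simp add: a M.M.add.m_comm)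
  next
    fix x assume x: "x \<in> carrier U"
    obtain M where M: "M \<in> \<C>" "x \<in> carrier M" using dir[OF x x x] by blast
    interpret M: left_module R M by (rule C[OF M(1)])
    note a = add[OF M(1), symmetric] and s = smult[OF M(1), symmetric] and z = zero[OF M(1), symmetric]
    show "\<zero>\<^bsub>U\<^esub> \<oplus>\<^bsub>U\<^esub> x = x" using M by (simp add: a z)
    have "\<ominus>\<^bsub>M\<^esub> x \<oplus>\<^bsub>U\<^esub> x = \<zero>\<^bsub>U\<^esub>" using M by (simp add: a z M.M.l_neg)
    then show "\<exists>y\<in>carrier U. y \<oplus>\<^bsub>U\<^esub> x = \<zero>\<^bsub>U\<^esub>" using inU[OF M(1), of "\<ominus>\<^bsub>M\<^esub> x"] M by auto
    show "\<one>\<^bsub>R\<^esub> \<odot>\<^bsub>U\<^esub> x = x" using M by (simp add: s M.smult_one)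
    fix c assume c: "c \<in> carrier R"
    show "c \<odot>\<^bsub>U\<^esub> x \<in> carrier U" using M c inU[OF M(1)] by (simp add: s M.smult_closed)
    fix d assume d: "d \<in> carrier R"
    show "(c \<oplus>\<^bsub>R\<^esub> d) \<odot>\<^bsub>U\<^esub> x = c \<odot>\<^bsub>U\<^esub> x \<oplus>\<^bsub>U\<^esub> d \<odot>\<^bsub>U\<^esub> x"
      using M c d by (simp add: s a M.smult_closed M.smult_l_distr)
    show "(c \<otimes>\<^bsub>R\<^esub> d) \<odot>\<^bsub>U\<^esub> x = c \<odot>\<^bsub>U\<^esub> (d \<odot>\<^bsub>U\<^esub> x)"
      using M c d by (simp add: s M.smult_closed M.smult_assoc1)
  next
    fix c x y assume c: "c \<in> carrier R" and x: "x \<in> carrier U" and y: "y \<in> carrier U"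
    obtain M where M: "M \<in> \<C>" "x \<in> carrier M" "y \<in> carrier M" using dir[OF x y y] by blast
    interpret M: left_module R M by (rule C[OF M(1)])
    note a = add[OF M(1), symmetric] and s = smult[OF M(1), symmetric]
    show "c \<odot>\<^bsub>U\<^esub> (x \<oplus>\<^bsub>U\<^esub> y) = c \<odot>\<^bsub>U\<^esub> x \<oplus>\<^bsub>U\<^esub> c \<odot>\<^bsub>U\<^esub> y"
      using M c by (simp add: s a M.smult_closed M.smult_r_distr)
  qed
  then have "submod_of R M U" if "M \<in> \<C>" for M
    unfolding submod_of_def using C[OF that] inU[OF that] add[OF that] smult[OF that] by blast
  then show thesis using that[OF cU] by blast
qed

section \<open>Translating between chains and towers\<close>

context module_universe
begin

text \<open>The set \<open>A\<close> is cofinal in the index order and \<open>bd\<close> bounds all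
  sets of fewer than \<open>\<mu>\<close> indices, so \<open>\<mu>\<close> is in effect the
  cofinality. The form covers both a given chain, with a smallest cofinal set, and a chain along a
  regular cardinal.\<close>

lemma chain_tower:
  fixes C :: "'o \<Rightarrow> ('r, 'm) module"
  assumes al: "limit_order \<alpha>" and mu: "Cinfinite \<mu>" "\<mu> \<le>o lam"
    and card: "\<And>i. i \<in> Field \<alpha> \<Longrightarrow> |carrier (C i)| =o lam"
    and mono: "\<And>i j. (i, j) \<in> \<alpha> \<Longrightarrow> submod_of R (C i) (C j)"
    and univ: "\<And>i. i \<in> Field \<alpha> \<Longrightarrow> universal_over R (C (wo_rel.suc \<alpha> {i})) (C i)"
    and sub: "\<And>i. i \<in> Field \<alpha> \<Longrightarrow> submod_of R (C i) M" and un: "carrier M = (\<Union>i\<in>Field \<alpha>. carrier (C i))"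
    and A: "A \<subseteq> Field \<alpha>" "|A| \<le>o \<mu>" "\<And>i. i \<in> Field \<alpha> \<Longrightarrow> \<exists>a\<in>A. (i, a) \<in> \<alpha>"
    and bd: "\<And>X. X \<subseteq> Field \<alpha> \<Longrightarrow> |X| <o \<mu> \<Longrightarrow> \<exists>b\<in>Field \<alpha>. \<forall>x\<in>X. (x, b) \<in> \<alpha>"
  shows "tower \<mu> (C ` Field \<alpha>) M"
proof -
  have M: "left_module R M" using limit_orderD(2)[OF al] submod_ofD(2)[OF sub] by blast
  have 1: "\<forall>N\<in>C ` Field \<alpha>. submod_of R N M \<and> |carrier N| =o lam \<and> (\<exists>N'\<in>C ` Field \<alpha>. universal_over R N' N)"
  proof
    fix N assume "N \<in> C ` Field \<alpha>"
    then obtain i where i: "i \<in> Field \<alpha>" "N = C i" by blast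
    have "wo_rel.suc \<alpha> {i} \<in> Field \<alpha>"
      by (rule aboveS_suc(1)[OF limit_orderD(1)[OF al] limit_orderD(3)[OF al i(1)]])
    then show "submod_of R N M \<and> |carrier N| =o lam \<and> (\<exists>N'\<in>C ` Field \<alpha>. universal_over R N' N)"
      using sub[OF i(1)] card[OF i(1)] univ[OF i(1)] i(2) by blast
  qed
  have 2: "\<exists>N\<in>C ` Field \<alpha>. \<forall>K\<in>X. carrier K \<subseteq> carrier N" if X: "X \<subseteq> C ` Field \<alpha>" "|X| <o \<mu>" for X
  proof -
    have "\<forall>K\<in>X. \<exists>i. i \<in> Field \<alpha> \<and> K = C i" using X(1) by blast
    from bchoice[OF this] obtain n where n: "\<forall>K\<in>X. n K \<in> Field \<alpha> \<and> K = C (n K)" by blast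
    have "n ` X \<subseteq> Field \<alpha>" using n by blast
    moreover have "|n ` X| <o \<mu>" by (rule ordLeq_ordLess_trans[OF card_of_image X(2)])
    ultimately obtain b where b: "b \<in> Field \<alpha>" "\<forall>x\<in>n ` X. (x, b) \<in> \<alpha>" using bd by blast
    have "carrier K \<subseteq> carrier (C b)" if "K \<in> X" for K
      using submod_ofD(3)[OF mono[of "n K" b]] b(2) n that by auto
    then show ?thesis using b(1) by blast
  qed
  have 3: "carrier M = (\<Union>N\<in>C ` A. carrier N)"
  proof
    show "carrier M \<subseteq> (\<Union>N\<in>C ` A. carrier N)"
    proof
      fix x assume "x \<in> carrier M"
      then obtain i where i: "i \<in> Field \<alpha>" "x \<in> carrier (C i)" using un by auto
      then obtain a where "a \<in> A" "(i, a) \<in> \<alpha>" using A(3) by blast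
      then show "x \<in> (\<Union>N\<in>C ` A. carrier N)" using submod_ofD(4)[OF mono i(2)] by auto
    qed
    show "(\<Union>N\<in>C ` A. carrier N) \<subseteq> carrier M" using un A(1) by auto
  qed
  have 4: "|C ` A| \<le>o \<mu>" by (rule ordLeq_transitive[OF card_of_image A(2)])
  have "C ` A \<subseteq> C ` Field \<alpha>" using A(1) by (rule image_mono)
  with 3 4 have "\<exists>A'\<subseteq>C ` Field \<alpha>. |A'| \<le>o \<mu> \<and> carrier M = (\<Union>N\<in>A'. carrier N)"
    by (intro exI[of _ "C ` A"] conjI)
  then show ?thesis unfolding tower_def using M mu 1 2 by simp
qed

text \<open>The cofinality of the chain is realised as the least cardinality of a cofinal set of indices.\<close>

lemma limit_model_tower:
  assumes "is_limit_model R lam M"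
  obtains \<mu> :: "'l rel" and F where "tower \<mu> F M"
proof -
  obtain \<alpha> :: "'l rel" where om: "is_ord_limit_model R lam \<alpha> M"
    using assms unfolding is_limit_model_def by blast
  note d = om[unfolded is_ord_limit_model_def]
  have al: "limit_order \<alpha>" "\<alpha> <o cardSuc lam" using conjunct1[OF d] conjunct1[OF conjunct2[OF d]] by simp_all
  from conjunct2[OF conjunct2[OF d]] obtain C :: "'l \<Rightarrow> ('r, 'm) module" where
    C: "\<forall>i\<in>Field \<alpha>. left_module R (C i) \<and> |carrier (C i)| =o lam"
      "\<forall>(i, j)\<in>\<alpha>. submod_of R (C i) (C j)"
      "\<forall>i\<in>Field \<alpha>. universal_over R (C (wo_rel.suc \<alpha> {i})) (C i)"
      "\<forall>i\<in>Field \<alpha>. submod_of R (C i) M" "carrier M = (\<Union>i\<in>Field \<alpha>. carrier (C i))"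
    by (elim exE conjE) (rule that)
  note W = Well_orderD[OF limit_orderD(1)[OF al(1)]]
  define cof where "cof A \<longleftrightarrow> A \<subseteq> Field \<alpha> \<and> (\<forall>i\<in>Field \<alpha>. \<exists>a\<in>A. (i, a) \<in> \<alpha>)" for A
  have "cof (Field \<alpha>)" using W(1) by (auto simp: cof_def)
  then have "\<exists>r\<in>{|A| |A. cof A}. \<forall>r'\<in>{|A| |A. cof A}. r \<le>o r'"
    by (intro exists_minim_Card_order) (auto simp: card_of_Card_order)
  then obtain A where A: "cof A" and min': "\<forall>r'\<in>{|A| |A. cof A}. |A| \<le>o r'" by auto
  have min: "|A| \<le>o |B|" if "cof B" for B
    by (rule bspec[OF min']) (use that in auto)
  \<comment> \<open>In a limit order a finite set has an upper bound and something strictly above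
    it, so it cannot be cofinal.\<close>
  have "infinite A"
  proof
    assume "finite A"
    then obtain b where b: "b \<in> Field \<alpha>" "\<forall>x\<in>A. (x, b) \<in> \<alpha>"
      using limit_order_finite_bounded[OF al(1), of A] A by (auto simp: cof_def)
    obtain c where c: "c \<noteq> b" "(b, c) \<in> \<alpha>" using limit_orderD(3)[OF al(1) b(1)] by (auto simp: aboveS_def)
    then have "c \<in> Field \<alpha>" by (auto simp: Field_def)
    then obtain a where "a \<in> A" "(c, a) \<in> \<alpha>" using A by (auto simp: cof_def)
    then show False using W(2)[of c a b] W(3)[of b c] b(2) c by blast
  qed
  then have inf: "Cinfinite |A|" by (simp add: cinfinite_def Field_card_of card_of_card_order_on)
  have "|Field \<alpha>| \<le>o \<alpha>" by (rule card_of_least) (rule limit_orderD(1)[OF al(1)])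
  then have "|Field \<alpha>| <o cardSuc lam" by (rule ordLeq_ordLess_trans[OF _ al(2)])
  then have "|Field \<alpha>| \<le>o lam" using cardSuc_ordLeq_ordLess[OF Card_lam card_of_Card_order] by blast
  moreover have "|A| \<le>o |Field \<alpha>|" using A by (intro card_of_mono1) (simp add: cof_def)
  ultimately have le: "|A| \<le>o lam" using ordLeq_transitive by blast
  have "tower |A| (C ` Field \<alpha>) M"
  proof (rule chain_tower[OF al(1) inf le])
    \<comment> \<open>By minimality such an \<open>X\<close> is not cofinal, and in a linear order
      an index that lies below no element of \<open>X\<close> bounds \<open>X\<close>.\<close>
    show "\<exists>b\<in>Field \<alpha>. \<forall>x\<in>X. (x, b) \<in> \<alpha>" if X: "X \<subseteq> Field \<alpha>" "|X| <o |A|" for X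
    proof -
      have "\<not> cof X"
      proof
        assume "cof X"
        from min[OF this] show False using not_ordLess_ordLeq[OF X(2)] by blast
      qed
      then obtain i where i: "i \<in> Field \<alpha>" "\<forall>x\<in>X. (i, x) \<notin> \<alpha>" using X(1) by (auto simp: cof_def)
      then have "\<forall>x\<in>X. (x, i) \<in> \<alpha>" using W(4) X(1) by blast
      then show ?thesis using i(1) by blast
    qed
    show "|A| \<le>o |A|" by (rule ordLeq_refl[OF card_of_Card_order])
    show "A \<subseteq> Field \<alpha>" "\<And>i. i \<in> Field \<alpha> \<Longrightarrow> \<exists>a\<in>A. (i, a) \<in> \<alpha>" using A by (auto simp: cof_def)
  qed (use C in auto)
  then show thesis using that by blast
qed

text \<open>Stability directly provides universal extensions only over members of a tower. An
  arbitrary \<open>N\<close> is embedded by \<open>g\<close> into a member \<open>N1\<close>; a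
  universal extension \<open>N2\<close> of \<open>N1\<close> is then universal over the image of
  \<open>N\<close>, because any extension of \<open>N\<close> can be amalgamated with
  \<open>N1\<close> over \<open>N\<close>. Renaming \<open>N2\<close> puts \<open>N\<close> itself
  inside.\<close>

lemma exists_universal_over:
  fixes N :: "('r, 'm) module"
  assumes t: "tower \<mu> F M" and N: "left_module R N" "|carrier N| =o lam"
  obtains N' where "universal_over R N' N"
proof -
  obtain N0 where N0: "N0 \<in> F" using tower_nonempty[OF t] by blast
  obtain N1 where N1: "N1 \<in> F" "universal_over R N1 N0" using towerD(6)[OF t N0] by blast
  obtain N2 where N2: "N2 \<in> F" "universal_over R N2 N1" using towerD(6)[OF t N1(1)] by blast
  have s01: "submod_of R N0 N1" and s12: "submod_of R N1 N2"
    using N1(2) N2(2) by (simp_all add: universal_over_def)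
  have m0: "left_module R N0" and m1: "left_module R N1" and m2: "left_module R N2"
    using submod_ofD(1,2)[OF s01] submod_ofD(2)[OF s12] by simp_all
  interpret N: left_module R N by fact
  interpret N0: left_module R N0 by fact
  interpret N1: left_module R N1 by fact
  have cN: "|carrier N| \<le>o lam" using N(2) by (rule ordIso_imp_ordLeq)
  \<comment> \<open>Only zero is glued to zero, so by exactness the homomorphism obtained from this
    graph vanishes only at zero.\<close>
  have H0: "submod_on R (prod_mod N N0) {(\<zero>\<^bsub>N\<^esub>, \<zero>\<^bsub>N0\<^esub>)}"
    using submod_on_zero[OF left_module_prod_mod[OF N(1) m0]] by simp
  obtain g where g: "mod_lin R N N1 g"
    "\<And>x y. x \<in> carrier N \<Longrightarrow> y \<in> carrier N0 \<Longrightarrow> g x = y \<longleftrightarrow> (x, y) \<in> {(\<zero>\<^bsub>N\<^esub>, \<zero>\<^bsub>N0\<^esub>)}"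
    using universal_over_extend[OF N1(2) towerD(5)[OF t N1(1)] N(1) cN H0] by auto
  have ker: "x = \<zero>\<^bsub>N\<^esub>" if "x \<in> carrier N" "g x = \<zero>\<^bsub>N1\<^esub>" for x
    using g(2)[OF that(1) N0.M.zero_closed] that(2) submod_of_zero[OF s01] by simp
  have inj: "inj_on g (carrier N)" by (rule mod_lin_inj_on[OF N(1) m1 g(1) ker])
  have g2: "mod_lin R N N2 g" using mod_lin_comp[OF g(1) submod_of_lin[OF s12]] .
  have cN2: "|carrier N2| =o lam" using towerD(5)[OF t N2(1)] .
  obtain K' :: "('r, 'm) module" and \<phi> where K': "submod_of R N K'" "mod_lin R K' N2 \<phi>"
    "bij_betw \<phi> (carrier K') (carrier N2)" and ph: "\<And>x. x \<in> carrier N \<Longrightarrow> \<phi> x = g x"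
    using copy_over[OF N(1) m2 g2 inj ordIso_imp_ordLeq[OF cN2]] by blast
  have mK': "left_module R K'" using submod_ofD(2)[OF K'(1)] .
  have cK': "|carrier K'| =o lam" by (rule ordIso_transitive[OF card_of_ordIsoI[OF K'(3)] cN2])
  have "\<exists>f\<in>mod_embeddings R E K'. \<forall>x\<in>carrier N. f x = x"
    if cE: "|carrier E| =o |carrier K'|" and NE: "submod_of R N E" for E :: "('r, 'm) module"
  proof -
    have E: "left_module R E" using submod_ofD(2)[OF NE] .
    have cE': "|carrier E| \<le>o lam" by (rule ordIso_imp_ordLeq[OF ordIso_transitive[OF cE cK']])
    \<comment> \<open>The graph of \<open>g\<close> inside \<open>E\<close>: its pushout amalgamates
      \<open>E\<close> with \<open>N1\<close> over \<open>N\<close>, and exactness at zero makes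
      \<open>G\<close> injective.\<close>
    define H where "H = (\<lambda>x. (x, g x)) ` carrier N"
    have H: "submod_on R (prod_mod E N1) H"
      unfolding H_def
      by (rule submod_on_mono_module[OF submod_of_prod_mod[OF NE submod_of_refl[OF m1]] graph_submod_on[OF N(1) m1 g(1)]])
    have func: "y = \<zero>\<^bsub>N1\<^esub>" if "(\<zero>\<^bsub>E\<^esub>, y) \<in> H" for y
      using that mod_lin_zero[OF N(1) m1 g(1)] submod_of_zero[OF NE] by (auto simp: H_def)
    obtain G where G: "mod_lin R E N2 G"
      "\<And>x y. x \<in> carrier E \<Longrightarrow> y \<in> carrier N1 \<Longrightarrow> G x = y \<longleftrightarrow> (x, y) \<in> H"
      by (rule universal_over_extend[OF N2(2) cN2 E cE' H func]) auto
    have Gg: "G x = g x" if "x \<in> carrier N" for x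
      using G(2)[OF submod_ofD(4)[OF NE that] mod_linD(1)[OF g(1) that]] that by (simp add: H_def)
    have "inj_on G (carrier E)"
    proof (rule mod_lin_inj_on[OF E m2 G(1)])
      fix x assume x: "x \<in> carrier E" "G x = \<zero>\<^bsub>N2\<^esub>"
      then have "G x = \<zero>\<^bsub>N1\<^esub>" using submod_of_zero[OF s12] by simp
      then have "(x, \<zero>\<^bsub>N1\<^esub>) \<in> H" using G(2)[OF x(1) N1.M.zero_closed] by simp
      then have "x \<in> carrier N" "g x = \<zero>\<^bsub>N1\<^esub>" by (auto simp: H_def)
      then show "x = \<zero>\<^bsub>E\<^esub>" using ker submod_of_zero[OF NE] by simp
    qed
    define \<psi> where "\<psi> = inv_into (carrier K') \<phi>"
    have psi: "mod_lin R N2 K' \<psi>" unfolding \<psi>_def by (rule mod_lin_inv_into[OF mK' K'(2,3)])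
    have psi_inj: "inj_on \<psi> (carrier N2)"
      using bij_betw_inv_into[OF K'(3)] by (simp add: \<psi>_def bij_betw_def)
    have "inj_on (\<lambda>x. \<psi> (G x)) (carrier E)"
    proof (rule inj_onI)
      fix x y assume xy: "x \<in> carrier E" "y \<in> carrier E" "\<psi> (G x) = \<psi> (G y)"
      have "G x = G y" by (rule inj_onD[OF psi_inj xy(3) mod_linD(1)[OF G(1) xy(1)] mod_linD(1)[OF G(1) xy(2)]])
      then show "x = y" using inj_onD[OF \<open>inj_on G (carrier E)\<close>] xy by blast
    qed
    moreover have "\<psi> (G x) = x" if x: "x \<in> carrier N" for x
    proof -
      have "\<psi> (\<phi> x) = x"
        unfolding \<psi>_def using K'(3) submod_ofD(4)[OF K'(1) x] by (simp add: bij_betw_def)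
      then show ?thesis using Gg[OF x] ph[OF x] by simp
    qed
    moreover have "mod_lin R E K' (\<lambda>x. \<psi> (G x))" using mod_lin_comp[OF G(1) psi] .
    ultimately show ?thesis
      by (intro bexI[of _ "\<lambda>x. \<psi> (G x)"]) (simp_all add: mod_embeddings_def mod_lin_iff_mod_hom)
  qed
  moreover have "|carrier K'| =o |carrier N|" by (rule ordIso_transitive[OF cK' ordIso_symmetric[OF N(2)]])
  ultimately have "universal_over R K' N" using K'(1) unfolding universal_over_def by blast
  then show thesis by (rule that)
qed

text \<open>The chain runs along the cardinal itself, with a universal extension at each successor
  and unions at limits, which keep size \<open>lam\<close> because \<open>\<mu> \<le>o lam\<close>.
  Regularity bounds every set of fewer than \<open>\<mu>\<close> indices, so that
  \<open>\<mu>\<close> itself is the parameter of the tower.\<close>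

lemma exists_limit_model_regular:
  fixes \<mu> :: "'c rel"
  assumes t: "tower \<nu> F0 M0" and mu: "Cinfinite \<mu>" "regularCard \<mu>" "\<mu> \<le>o lam"
  obtains M F where "is_limit_model R lam M" "tower \<mu> F M"
proof -
  have "|Field \<mu>| \<le>o |Field lam|" using mu(3) by (rule card_of_mono2)
  then obtain f where f: "inj_on f (Field \<mu>)" "f ` Field \<mu> \<subseteq> Field lam"
    using card_of_ordLeq[of "Field \<mu>" "Field lam"] by blast
  \<comment> \<open>\<open>is_limit_model\<close> wants index orders in the type of
    \<open>lam\<close>, so \<open>\<mu>\<close> is first copied to a cardinal \<open>r\<close>
    there.\<close>
  define r where "r = |f ` Field \<mu>|"
  have "|Field \<mu>| =o r" unfolding r_def by (rule card_of_ordIsoI[of f]) (simp add: bij_betw_def f)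
  moreover have "\<mu> =o |Field \<mu>|" using mu(1) by (intro ordIso_symmetric[OF card_of_Field_ordIso]) blast
  ultimately have mr: "\<mu> =o r" using ordIso_transitive by blast
  have rinf: "Cinfinite r" by (rule Cinfinite_cong[OF mr mu(1)])
  have rreg: "regularCard r" using regularCard_ordIso[OF mr] mu by blast
  have rle: "r \<le>o lam" by (rule ordIso_ordLeq_trans[OF ordIso_symmetric[OF mr] mu(3)])
  have Cr: "Card_order r" using rinf by blast
  have Wr: "Well_order r" using card_order_on_well_order_on[OF Cr] .
  note W = Well_orderD[OF Wr]
  have lim: "limit_order r"
    unfolding limit_order_def
  proof (intro conjI ballI)
    show "Field r \<noteq> {}" using rinf by (auto simp: cinfinite_def)
    show "aboveS r i \<noteq> {}" if "i \<in> Field r" for i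
      using infinite_Card_order_limit[OF Cr _ that] rinf by (auto simp: cinfinite_def aboveS_def)
  qed (rule Wr)
  note suc = aboveS_suc[OF Wr limit_orderD(3)[OF lim]]
  have uF: "j \<in> Field r" if "j \<in> underS r i" for i j using that by (auto simp: underS_def Field_def)
  have FW: "Field (Restr r (underS r i)) = underS r i" for i using Field_Restr_underS[OF Wr] .

  \<comment> \<open>Universality is imposed at the later index, for those \<open>j\<close> whose
    successor is \<open>i\<close>, because a recursion clause may refer only to earlier
    stages.\<close>
  define Q where "Q C i N \<longleftrightarrow> left_module R N \<and> |carrier N| =o lam \<and> (\<forall>j\<in>underS r i. submod_of R (C j) N) \<and>
     (\<forall>j\<in>underS r i. wo_rel.suc r {j} = i \<longrightarrow> universal_over R N (C j)) \<and>
     (limit_order (Restr r (underS r i)) \<longrightarrow> carrier N = (\<Union>j\<in>underS r i. carrier (C j)))"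
    for C :: "_ \<Rightarrow> ('r, 'm) module" and i N
  have union_card: "|\<Union>j\<in>J. carrier (C j)| =o lam"
    if J: "J \<subseteq> Field r" "J \<noteq> {}" and cJ: "\<And>j. j \<in> J \<Longrightarrow> |carrier (C j)| =o lam" for J and C :: "_ \<Rightarrow> ('r, 'm) module"
  proof -
    have "|J| \<le>o r" by (rule ordLeq_ordIso_trans[OF card_of_mono1[OF J(1)] card_of_Field_ordIso[OF Cr]])
    then have "|\<Union>j\<in>J. carrier (C j)| \<le>o lam"
      using cJ ordIso_imp_ordLeq by (intro UNION_Cinfinite_bound[OF _ _ Cinf_lam] ordLeq_transitive[OF _ rle]) auto
    moreover obtain j where j: "j \<in> J" using J(2) by blast
    then have "|carrier (C j)| \<le>o |\<Union>j\<in>J. carrier (C j)|" by (intro card_of_mono1) blast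
    then have "lam \<le>o |\<Union>j\<in>J. carrier (C j)|" by (rule ordIso_ordLeq_trans[OF ordIso_symmetric[OF cJ[OF j]]])
    ultimately show ?thesis by (simp add: ordIso_iff_ordLeq)
  qed
  have union_module: "\<exists>U. left_module R U \<and> |carrier U| =o lam \<and> carrier U = (\<Union>j\<in>J. carrier (C j)) \<and>
      (\<forall>j\<in>J. submod_of R (C j) U)"
    if J: "J \<subseteq> Field r" "J \<noteq> {}" and Q: "\<And>j. j \<in> J \<Longrightarrow> Q C j (C j)" for J and C :: "_ \<Rightarrow> ('r, 'm) module"
  proof -
    have card: "|carrier (C j)| =o lam" and modC: "left_module R (C j)" if "j \<in> J" for j
      using Q[OF that] by (simp_all add: Q_def)
    have sub: "submod_of R (C j) (C k)" if "(j, k) \<in> r" "j \<in> J" "k \<in> J" for j k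
    proof (cases "j = k")
      case True
      then show ?thesis using submod_of_refl[OF modC] that by simp
    next
      case False
      then show ?thesis using Q[OF that(3)] that(1) by (simp add: Q_def underS_def)
    qed
    obtain U :: "('r, 'm) module" where U: "carrier U = (\<Union>M\<in>C ` J. carrier M)" "\<And>M. M \<in> C ` J \<Longrightarrow> submod_of R M U"
    proof (rule chain_union_module[of "C ` J" R])
      show "submod_of R M N \<or> submod_of R N M" if "M \<in> C ` J" "N \<in> C ` J" for M N
      proof -
        obtain j k where jk: "j \<in> J" "k \<in> J" "M = C j" "N = C k" using \<open>M \<in> C ` J\<close> \<open>N \<in> C ` J\<close> by blast
        then show ?thesis using W(4)[of j k] sub[of j k] sub[of k j] J(1) by blast
      qed
    qed (use J modC in auto)
    have "left_module R U" using U(2) J(2) submod_ofD(2) by blast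
    moreover have "carrier U = (\<Union>j\<in>J. carrier (C j))" using U(1) by simp
    ultimately show ?thesis using union_card[OF J card] U(2) by (intro exI[of _ U]) simp
  qed
  obtain C where C: "\<And>i. i \<in> Field r \<Longrightarrow> Q C i (C i)"
  proof (rule well_order_choice[OF Wr, of Q])
    show "Q g i N" if "\<And>j. j \<in> underS r i \<Longrightarrow> f j = g j" "Q f i N" for i f g N
      using that by (simp add: Q_def)
  next
    fix i C assume i: "i \<in> Field r" and QC: "\<And>j. j \<in> underS r i \<Longrightarrow> Q C j (C j)"
    have card: "|carrier (C j)| =o lam" and modC: "left_module R (C j)" if "j \<in> underS r i" for j
      using QC[OF that] by (simp_all add: Q_def)
    have "limit_order (Restr r (underS r i)) \<longleftrightarrow>
        underS r i \<noteq> {} \<and> (\<forall>j\<in>underS r i. aboveS (Restr r (underS r i)) j \<noteq> {})"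
      using Well_order_Restr[OF Wr, of "underS r i"] by (simp add: limit_order_def FW)
    \<comment> \<open>A nonempty initial segment that is not a limit has a greatest element
      \<open>j\<close>, the predecessor of \<open>i\<close>.\<close>
    then consider (lim) "limit_order (Restr r (underS r i))" | (zero) "underS r i = {}"
      | (suc) j where "\<not> limit_order (Restr r (underS r i))" "j \<in> underS r i" "aboveS (Restr r (underS r i)) j = {}"
      by blast
    then show "\<exists>N. Q C i N"
    proof cases
      case lim
      have "underS r i \<noteq> {}" using limit_orderD(2)[OF lim] FW by simp
      then obtain U where U: "left_module R U" "|carrier U| =o lam" "carrier U = (\<Union>j\<in>underS r i. carrier (C j))"
        "\<forall>j\<in>underS r i. submod_of R (C j) U"
        using union_module[of "underS r i" C, OF _ _ QC] uF by blast
      \<comment> \<open>No index has a limit as its immediate successor, so at limits the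
        universality clause is empty.\<close>
      have "wo_rel.suc r {j} \<noteq> i" if j: "j \<in> underS r i" for j
      proof
        assume si: "wo_rel.suc r {j} = i"
        obtain k where k: "k \<noteq> j" "(j, k) \<in> r" "k \<in> underS r i"
          using limit_orderD(3)[OF lim, of j] j FW by (auto simp: aboveS_def)
        then show False using suc(4)[OF uF[OF j] k(2,1)] W(3)[of i k] si by (auto simp: underS_def)
      qed
      then have "Q C i U" using U by (simp add: Q_def)
      then show ?thesis by blast
    next
      case zero
      obtain N where N: "N \<in> F0" using tower_nonempty[OF t] by blast
      have "\<not> limit_order (Restr r (underS r i))" using limit_orderD(2) FW zero by blast
      then have "Q C i N"
        using zero towerD(5)[OF t N] submod_ofD(1)[OF towerD(4)[OF t N]] by (simp add: Q_def)
      then show ?thesis by blast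
    next
      case (suc j)
      have max: "(k, j) \<in> r" if "k \<in> underS r i" for k
        using suc(3) W(4)[OF uF[OF that] uF[OF suc(2)]] W(1)[OF uF[OF suc(2)]] that suc(2) by (auto simp: aboveS_def)
      obtain N where N: "universal_over R N (C j)" using exists_universal_over[OF t modC[OF suc(2)] card[OF suc(2)]] by blast
      have jN: "submod_of R (C j) N" and "|carrier N| =o |carrier (C j)|" using N by (simp_all add: universal_over_def)
      then have cN: "|carrier N| =o lam" using ordIso_transitive card[OF suc(2)] by blast
      have "submod_of R (C k) N" if k: "k \<in> underS r i" for k
      proof (cases "k = j")
        case False
        then have "k \<in> underS r j" using max[OF k] by (simp add: underS_def)
        then have "submod_of R (C k) (C j)" using QC[OF suc(2)] by (simp add: Q_def)
        then show ?thesis using jN by (rule submod_of_trans)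
      qed (use jN in simp)
      moreover have "universal_over R N (C k)" if k: "k \<in> underS r i" "wo_rel.suc r {k} = i" for k
      proof (cases "k = j")
        case False
        have "(i, j) \<in> r" using aboveS_suc(4)[OF Wr limit_orderD(3)[OF lim uF[OF k(1)]] max[OF k(1)]] False k(2) by simp
        then have False using W(3)[of i j] suc(2) by (auto simp: underS_def)
        then show ?thesis ..
      qed (use N in simp)
      ultimately have "Q C i N" using suc(1) cN submod_ofD(2)[OF jN] by (simp add: Q_def)
      then show ?thesis by blast
    qed
  qed (use that in blast)
  obtain M where M: "left_module R M" "carrier M = (\<Union>i\<in>Field r. carrier (C i))" "\<forall>i\<in>Field r. submod_of R (C i) M"
    using union_module[of "Field r" C, OF _ _ C] limit_orderD(2)[OF lim] by blast
  have card: "|carrier (C i)| =o lam" and modC: "left_module R (C i)" if "i \<in> Field r" for i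
    using C[OF that] by (simp_all add: Q_def)
  have mono: "submod_of R (C i) (C j)" if ij: "(i, j) \<in> r" for i j
  proof -
    have F: "i \<in> Field r" "j \<in> Field r" using ij by (auto simp: Field_def)
    show ?thesis
    proof (cases "i = j")
      case True
      then show ?thesis using submod_of_refl[OF modC[OF F(1)]] by simp
    next
      case False
      then show ?thesis using C[OF F(2)] ij by (simp add: Q_def underS_def)
    qed
  qed
  have univ: "universal_over R (C (wo_rel.suc r {i})) (C i)" if i: "i \<in> Field r" for i
    using C[OF suc(1)[OF i]] suc(2,3)[OF i] by (simp add: Q_def underS_def)
  have cont: "carrier (C i) = (\<Union>j\<in>underS r i. carrier (C j))"
    if "i \<in> Field r" "limit_order (Restr r (underS r i))" for i
    using C[OF that(1)] that(2) by (simp add: Q_def)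
  have "is_ord_limit_model R lam r M"
    unfolding is_ord_limit_model_def
  proof (intro conjI exI[of _ C])
    show "r <o cardSuc lam" by (rule ordLeq_ordLess_trans[OF rle cardSuc_greater[OF Card_lam]])
  qed (use lim card modC mono cont univ M in auto)
  then have 1: "is_limit_model R lam M" unfolding is_limit_model_def by blast
  have "tower r (C ` Field r) M"
  proof (rule chain_tower[OF lim rinf rle, of C M "Field r"])
    show "|Field r| \<le>o r" by (rule ordIso_imp_ordLeq[OF card_of_Field_ordIso[OF Cr]])
    show "\<exists>b\<in>Field r. \<forall>x\<in>X. (x, b) \<in> r" if X: "X \<subseteq> Field r" "|X| <o r" for X
    proof -
      \<comment> \<open>\<open>cofinal\<close> asks for strictly larger elements, so its failure
        gives a \<open>b\<close> with every element of \<open>X\<close> below or equal to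
        it.\<close>
      have "cofinal X r \<Longrightarrow> |X| =o r" using rreg X(1) by (simp add: regularCard_def)
      then have "\<not> cofinal X r" using not_ordLess_ordIso[OF X(2)] by blast
      then obtain b where b: "b \<in> Field r" "\<forall>x\<in>X. b = x \<or> (b, x) \<notin> r" by (auto simp: cofinal_def)
      have "(x, b) \<in> r" if "x \<in> X" for x
      proof (cases "b = x")
        case False
        then have "(b, x) \<notin> r" using b(2) that by blast
        then show ?thesis using W(4)[OF b(1) subsetD[OF X(1) that]] by blast
      qed (use W(1)[OF b(1)] in simp)
      then show ?thesis using b(1) by blast
    qed
    show "\<exists>a\<in>Field r. (i, a) \<in> r" if "i \<in> Field r" for i using W(1) that by blast
  qed (use card mono univ M in auto)
  from tower_ordIso[OF this ordIso_symmetric[OF mr]] show thesis using that[OF 1] by blast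
qed

end

subsection \<open>Counting isomorphism classes\<close>

lemma card_Field_is_aleph:
  assumes "is_aleph r c"
  shows "|Field r| =o |{x \<in> Field c. Cinfinite (Restr c (underS c x))}|"
proof -
  let ?S = "{x \<in> Field c. Cinfinite (Restr c (underS c x))}"
  have C: "Card_order c" and iso: "r =o Restr c ?S" using assms by (auto simp: is_aleph_def)
  have "Refl c"
    using card_order_on_well_order_on[OF C]
    by (auto simp: well_order_on_def linear_order_on_def partial_order_on_def preorder_on_def)
  then have "Field (Restr c ?S) = ?S" by (rule Refl_Field_Restr2) blast
  then show ?thesis using card_of_cong[OF iso] by simp
qed

text \<open>The infinite cardinal \<kappa> absorbs the added top element, so below
  \<open>\<aleph>\<^sub>\<kappa>\<^sub>+\<^sub>1\<close> there are no more infinite cardinals than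
  below \<open>\<aleph>\<^sub>\<kappa>\<close>, counted by cardinality.\<close>

lemma card_Field_ord_succ:
  assumes "Cinfinite r" shows "|Field (ord_succ r)| \<le>o r"
proof -
  have "Field (ord_succ r) \<subseteq> Some ` Field r \<union> {None}" by (auto simp: ord_succ_def Field_def)
  then have "|Field (ord_succ r)| \<le>o |Some ` Field r \<union> {None}|" by (rule card_of_mono1)
  moreover have "|Some ` Field r \<union> {None}| \<le>o r"
  proof (rule Un_Cinfinite_bound)
    show "|Some ` Field r| \<le>o r"
      by (rule ordLeq_ordIso_trans[OF card_of_image card_of_Field_ordIso]) (use assms in blast)
    show "|{None}| \<le>o r" by (rule ordLess_imp_ordLeq[OF finite_ordLess_Cinfinite[OF _ assms]]) simp
  qed (rule assms)
  ultimately show ?thesis by (rule ordLeq_transitive)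
qed

lemma Restr_underS_ordLess:
  assumes r: "Well_order r" and xy: "(x, y) \<in> r" "x \<noteq> y"
  shows "Restr r (underS r x) <o Restr r (underS r y)"
proof -
  note W = Well_orderD[OF r]
  have wo: "wo_rel r" using r by (simp add: wo_rel_def)
  have "underS r x \<subset> underS r y" using W(2)[OF _ xy(1)] W(3) xy by (auto simp: underS_def)
  then show ?thesis using ofilter_subset_ordLess[OF r wo_rel.underS_ofilter[OF wo] wo_rel.underS_ofilter[OF wo]] by blast
qed

context module_universe
begin

definition iso_rel :: "(('r, 'm) module \<times> ('r, 'm) module) set" where
  "iso_rel = {(M, N). is_limit_model R lam M \<and> is_limit_model R lam N \<and> mod_isomorphic R M N}"

lemma equiv_iso_rel: "equiv {M. is_limit_model R lam M} iso_rel"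
proof -
  have "left_module R M" if "is_limit_model R lam M" for M :: "('r, 'm) module"
    by (rule limit_model_tower[OF that]) (rule towerD(1))
  then show ?thesis
    by (intro equivI refl_onI symI transI)
      (auto simp: iso_rel_def mod_isomorphic_refl intro: mod_isomorphic_sym mod_isomorphic_trans)
qed

lemma limit_model_classes_eq: "limit_model_classes R lam = {M. is_limit_model R lam M} // iso_rel"
  by (simp add: limit_model_classes_def iso_rel_def)

lemma class_eqI:
  fixes c d :: "('r, 'm) module set"
  assumes "c \<in> limit_model_classes R lam" "d \<in> limit_model_classes R lam" "M \<in> c" "N \<in> d" "mod_isomorphic R M N"
  shows "c = d"
proof -
  note q = assms(1,2)[unfolded limit_model_classes_eq]
  have "(M, N) \<in> iso_rel"
    using subsetD[OF in_quotient_imp_subset[OF equiv_iso_rel q(1)] assms(3)]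
      subsetD[OF in_quotient_imp_subset[OF equiv_iso_rel q(2)] assms(4)] assms(5)
    by (simp add: iso_rel_def)
  then show ?thesis using quotient_eq_iff[OF equiv_iso_rel q assms(3,4)] by simp
qed

text \<open>A class is sent to the cofinality of a representative if this lies below
  \<open>c\<close>, and to \<open>None\<close> otherwise. Equal cofinalities give isomorphic models
  by uniqueness of towers; models sent to \<open>None\<close> are injective, so they share one
  class. The infinite cardinals below \<open>c\<close> have order type \<kappa> + 1, so at most
  \<kappa> values arise.\<close>

lemma card_limit_model_classes_le:
  fixes \<kappa> :: "'k rel" and c :: "'b rel"
  assumes kap: "Cinfinite \<kappa>" and al: "is_aleph (ord_succ \<kappa>) c" and noeth: "left_lt_noetherian c R"
  shows "|limit_model_classes R lam :: ('r, 'm) module set set| \<le>o \<kappa>"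
proof -
  let ?cls = "limit_model_classes R lam :: ('r, 'm) module set set"
  have Cc: "Card_order c" using al by (auto simp: is_aleph_def)
  have Wc: "Well_order c" using card_order_on_well_order_on[OF Cc] .
  define S where "S = {x \<in> Field c. Cinfinite (Restr c (underS c x))}"
  have "|S| \<le>o |Field (ord_succ \<kappa>)|"
    unfolding S_def by (rule ordIso_imp_ordLeq[OF ordIso_symmetric[OF card_Field_is_aleph[OF al]]])
  then have "|S| \<le>o \<kappa>" using card_Field_ord_succ[OF kap] by (rule ordLeq_transitive)
  then have "|Some ` S| \<le>o \<kappa>" by (rule ordLeq_transitive[OF card_of_image])
  moreover have "|{None :: 'b option}| \<le>o \<kappa>"
    by (rule ordLess_imp_ordLeq[OF finite_ordLess_Cinfinite[OF _ kap]]) simp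
  ultimately have cS: "|Some ` S \<union> {None}| \<le>o \<kappa>" using kap by (rule Un_Cinfinite_bound)

  have rep: "\<exists>p. fst (snd p) \<in> d \<and> tower (fst p :: 'l rel) (snd (snd p)) (fst (snd p))" if d: "d \<in> ?cls" for d
  proof -
    obtain M where M: "M \<in> d" using in_quotient_imp_non_empty[OF equiv_iso_rel] d unfolding limit_model_classes_eq by blast
    then have "is_limit_model R lam M"
      using in_quotient_imp_subset[OF equiv_iso_rel] d unfolding limit_model_classes_eq by blast
    then obtain \<mu> :: "'l rel" and F where "tower \<mu> F M" by (rule limit_model_tower)
    then show ?thesis using M by (intro exI[of _ "(\<mu>, M, F)"]) simp
  qed
  define p where "p d = (SOME p. fst (snd p) \<in> d \<and> tower (fst p :: 'l rel) (snd (snd p)) (fst (snd p)))" for d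
  define \<mu> M F where "\<mu> d = fst (p d)" and "M d = fst (snd (p d))" and "F d = snd (snd (p d))" for d
  have Md: "M d \<in> d" and td: "tower (\<mu> d) (F d) (M d)" if "d \<in> ?cls" for d
    using someI_ex[OF rep[OF that]] unfolding \<mu>_def M_def F_def p_def by blast+

  \<comment> \<open>\<open>\<mu> d\<close> and \<open>c\<close> live in different types; a cardinal
    below \<open>c\<close> is compared with others through the initial segment of \<open>c\<close>
    isomorphic to it.\<close>
  define seg where "seg d x \<longleftrightarrow> x \<in> Field c \<and> \<mu> d =o Restr c (underS c x)" for d x
  define h where "h d = (if \<mu> d <o c then Some (SOME x. seg d x) else None)" for d
  have Wmu: "Well_order (\<mu> d)" if "d \<in> ?cls" for d
    using towerD(2)[OF td[OF that]] card_order_on_well_order_on by blast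
  have seg: "seg d (SOME x. seg d x)" if d: "d \<in> ?cls" "\<mu> d <o c" for d
  proof -
    have "\<exists>x. seg d x" using ordLess_iff_ordIso_Restr[OF Wc Wmu[OF d(1)]] d(2) unfolding seg_def by blast
    then show ?thesis by (rule someI_ex)
  qed
  have "inj_on h ?cls"
  proof (rule inj_onI)
    fix d e assume d: "d \<in> ?cls" and e: "e \<in> ?cls" and eq: "h d = h e"
    show "d = e"
    proof (cases "\<mu> d <o c")
      case True
      then have e': "\<mu> e <o c" using eq by (simp add: h_def split: if_splits)
      then have "(SOME x. seg d x) = (SOME x. seg e x)" using True eq by (simp add: h_def)
      then obtain x where "seg d x" "seg e x" using seg[OF d True] seg[OF e e'] by metis
      then have "\<mu> d =o \<mu> e" unfolding seg_def using ordIso_transitive ordIso_symmetric by blast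
      then have "mod_isomorphic R (M d) (M e)" by (rule tower_isomorphic[OF tower_ordIso[OF td[OF d]] td[OF e]])
      then show ?thesis by (rule class_eqI[OF d e Md[OF d] Md[OF e]])
    next
      case False
      then have e': "\<not> \<mu> e <o c" using eq by (simp add: h_def split: if_splits)
      have le: "c \<le>o \<mu> d" "c \<le>o \<mu> e"
        using ordLess_or_ordLeq[OF Wmu[OF d] Wc] ordLess_or_ordLeq[OF Wmu[OF e] Wc] False e' by blast+
      have "mod_isomorphic R (M d) (M e)"
        by (rule injective_towers_isomorphic[OF td[OF d] td[OF e] tower_baer_injective[OF td[OF d] noeth le(1)]
              tower_baer_injective[OF td[OF e] noeth le(2)]])
      then show ?thesis by (rule class_eqI[OF d e Md[OF d] Md[OF e]])
    qed
  qed
  moreover have "h d \<in> Some ` S \<union> {None}" if d: "d \<in> ?cls" for d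
  proof (cases "\<mu> d <o c")
    case True
    have "seg d (SOME x. seg d x)" by (rule seg[OF d True])
    then have "(SOME x. seg d x) \<in> S"
      using Cinfinite_cong[OF _ towerD(2)[OF td[OF d]]] unfolding seg_def S_def by blast
    then show ?thesis by (simp add: h_def)
  qed (simp add: h_def)
  ultimately have "|?cls| \<le>o |Some ` S \<union> {None}|" by (rule card_of_ordLeqI)
  then show ?thesis using cS by (rule ordLeq_transitive)
qed

text \<open>The elements of \<open>S\<close> stand for the infinite cardinals \<open>s x\<close>
  below \<open>c\<close>, and \<open>m x\<close> is the successor of \<open>s x\<close>: regular,
  hence realised by a limit model, and at most \<open>c\<close>, hence \<open>I\<close> is not
  generated by fewer than \<open>m x\<close> elements. Models for different \<open>m x\<close> are
  then separated by \<open>tower_not_isomorphic\<close>.\<close>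

lemma card_limit_model_classes_ge:
  fixes \<kappa> :: "'k rel" and c :: "'a rel"
  assumes al: "is_aleph \<kappa> c" and non: "\<not> left_lt_noetherian c R"
    and M0: "is_limit_model R lam (M0 :: ('r, 'm) module)" and kap: "Cinfinite \<kappa>"
  shows "\<kappa> \<le>o |limit_model_classes R lam :: ('r, 'm) module set set|"
proof -
  let ?cls = "limit_model_classes R lam :: ('r, 'm) module set set"
  obtain \<mu>0 :: "'l rel" and F0 where t0: "tower \<mu>0 F0 M0" by (rule limit_model_tower[OF M0])
  have Cc: "Card_order c" using al by (auto simp: is_aleph_def)
  have Wc: "Well_order c" using card_order_on_well_order_on[OF Cc] .
  obtain I where I: "left_ideal I R" "\<not> lt_generated c R I"
    using non unfolding left_lt_noetherian_def by blast
  have IR: "submod_on R (reg_mod R) I" using I(1) left_ideal_iff_submod_on[OF ring] by blast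
  have IsubR: "I \<subseteq> carrier R" using submod_onD(1)[OF IR] by simp
  \<comment> \<open>\<open>I\<close> generates itself, so it has at least \<open>c\<close> elements.
    Hence \<open>c \<le>o lam\<close>, and every \<open>m x\<close> is an admissible length of a
    chain.\<close>
  have "\<not> |I| <o c"
  proof
    assume "|I| <o c"
    moreover have "I = gen_left_ideal R I"
      using gen_left_ideal_least[OF ring IR subset_refl] gen_left_ideal_superset[of I R] by blast
    ultimately show False using I(2) IsubR unfolding lt_generated_def by blast
  qed
  then have "c \<le>o |I|" using ordLess_or_ordLeq[OF card_of_Well_order Wc] by blast
  then have cle: "c \<le>o lam" by (rule ordLeq_transitive[OF _ ordLeq_transitive[OF card_of_mono1[OF IsubR] card_R]])

  define S where "S = {x \<in> Field c. Cinfinite (Restr c (underS c x))}"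
  define s where "s x = Restr c (underS c x)" for x
  define m where "m x = cardSuc (s x)" for x
  have Cs: "Cinfinite (s x)" if "x \<in> S" for x using that by (simp add: S_def s_def)
  have mc: "m x \<le>o c" if x: "x \<in> S" for x
  proof -
    have "s x <o c" unfolding s_def by (rule underS_Restr_ordLess[OF Wc]) (use x in \<open>auto simp: S_def\<close>)
    then show ?thesis unfolding m_def by (rule cardSuc_least[OF conjunct2[OF Cs[OF x]] Cc])
  qed
  have gen: "\<not> lt_generated (m x) R I" if x: "x \<in> S" for x
  proof
    assume "lt_generated (m x) R I"
    then obtain T where "T \<subseteq> carrier R" "|T| <o m x" "I = gen_left_ideal R T" unfolding lt_generated_def by blast
    moreover from this(2) have "|T| <o c" using mc[OF x] by (rule ordLess_ordLeq_trans)
    ultimately show False using I(2) unfolding lt_generated_def by blast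
  qed
  have ex: "\<exists>p. is_limit_model R lam (fst p) \<and> tower (m x) (snd p) (fst p)" if x: "x \<in> S" for x
  proof -
    obtain M F where "is_limit_model R lam M" "tower (m x) F M"
      by (rule exists_limit_model_regular[OF t0, of "m x"])
        (use Cinfinite_cardSuc[OF Cs[OF x]] regularCard_cardSuc[OF Cs[OF x]] ordLeq_transitive[OF mc[OF x] cle]
          in \<open>auto simp: m_def\<close>)
    then show ?thesis by (intro exI[of _ "(M, F)"]) simp
  qed
  define p where "p x = (SOME p. is_limit_model R lam (fst p) \<and> tower (m x) (snd p) (fst p))" for x
  have p: "is_limit_model R lam (fst (p x))" "tower (m x) (snd (p x)) (fst (p x))" if "x \<in> S" for x
    using someI_ex[OF ex[OF that]] unfolding p_def by blast+
  have "x = y" if x: "x \<in> S" and y: "y \<in> S" and iso: "(fst (p x), fst (p y)) \<in> iso_rel" for x y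
  proof (rule ccontr)
    have less: "m u <o m v" if "u \<in> S" "v \<in> S" "(u, v) \<in> c" "u \<noteq> v" for u v
    proof -
      have "s u <o s v" unfolding s_def by (rule Restr_underS_ordLess[OF Wc that(3,4)])
      then have "m u \<le>o s v" unfolding m_def by (rule cardSuc_least[OF conjunct2[OF Cs[OF that(1)]] conjunct2[OF Cs[OF that(2)]]])
      then show ?thesis unfolding m_def by (rule ordLeq_ordLess_trans[OF _ cardSuc_greater[OF conjunct2[OF Cs[OF that(2)]]]])
    qed
    have not_iso: "\<not> mod_isomorphic R (fst (p u)) (fst (p v))" if "u \<in> S" "v \<in> S" "(u, v) \<in> c" "u \<noteq> v" for u v
      by (rule tower_not_isomorphic[OF p(2)[OF that(1)] p(2)[OF that(2)] less[OF that] I(1) gen[OF that(1)]])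
    assume "x \<noteq> y"
    moreover have "(x, y) \<in> c \<or> (y, x) \<in> c" using Well_orderD(4)[OF Wc] x y by (auto simp: S_def)
    moreover have "mod_isomorphic R (fst (p x)) (fst (p y))" using iso by (simp add: iso_rel_def)
    moreover have "mod_isomorphic R (fst (p y)) (fst (p x))"
      by (rule mod_isomorphic_sym[OF towerD(1)[OF p(2)[OF x]]]) fact
    ultimately show False using not_iso[OF x y] not_iso[OF y x] by blast
  qed
  then have "inj_on (\<lambda>x. iso_rel `` {fst (p x)}) S"
    using eq_equiv_class[OF _ equiv_iso_rel] p(1) by (intro inj_onI) blast
  moreover have "iso_rel `` {fst (p x)} \<in> ?cls" if "x \<in> S" for x
    unfolding limit_model_classes_eq by (rule quotientI) (use p(1)[OF that] in simp)
  ultimately have le: "|S| \<le>o |?cls|" by (rule card_of_ordLeqI)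
  have "\<kappa> =o |Field \<kappa>|" using kap by (intro ordIso_symmetric[OF card_of_Field_ordIso]) blast
  then have "\<kappa> =o |S|" unfolding S_def by (rule ordIso_transitive[OF _ card_Field_is_aleph[OF al]])
  then show ?thesis using le by (rule ordIso_ordLeq_trans)
qed

end

theorem lemma3p19:
  fixes R :: "('r, 'x) ring_scheme"
    and \<kappa> :: "'k rel" and aleph_\<kappa> :: "'a rel" and aleph_succ_\<kappa> :: "'b rel"
    and lam :: "'l rel"
  assumes "ring R"
    and "Cinfinite \<kappa>"
    and "is_aleph \<kappa> aleph_\<kappa>"
    and "is_aleph (ord_succ \<kappa>) aleph_succ_\<kappa>"
    and "left_lt_noetherian aleph_succ_\<kappa> R"
    and "\<not> left_lt_noetherian aleph_\<kappa> R"
    and "Card_order lam"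
    and "cardSuc ( |carrier R| +c natLeq ) \<le>o lam"
    and "lam <o |UNIV :: 'm set|"
    and "stable_in TYPE('m) R lam"
  shows "|limit_model_classes R lam :: ('r, 'm) module set set| =o \<kappa>"
proof -
  have Csum: "Cinfinite ( |carrier R| +c natLeq )"
    by (rule Cinfinite_csum) (rule disjI2[OF natLeq_Cinfinite])
  have le: "|carrier R| +c natLeq \<le>o lam"
    by (rule ordLeq_transitive[OF cardSuc_ordLeq[OF conjunct2[OF Csum]] assms(8)])
  interpret module_universe R lam "TYPE('m)"
  proof (rule module_universe.intro)
    show "Cinfinite lam" using cinfinite_mono[OF le] Csum assms(7) by blast
    show "|carrier R| \<le>o lam" by (rule ordLeq_transitive[OF ordLeq_csum1[OF card_of_Card_order] le])
  qed fact+
  obtain M0 :: "('r, 'm) module" where M0: "is_limit_model R lam M0"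
    using assms(10) unfolding stable_in_def by blast
  show ?thesis
    unfolding ordIso_iff_ordLeq
    using card_limit_model_classes_le[OF assms(2,4,5)] card_limit_model_classes_ge[OF assms(3,6) M0 assms(2)] by blast
qed

end
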